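(* Let $(M,g)$ be a smooth Riemannian surface and let $p_0\in M$ be a point such that either $K$ is constant in a neighbourhood of $p_0$ or $dK\neq 0$ at $p_0$. Then: (1) $\dim\mathcal J_1=3$ if and only if $K$ is constant near $p_0$ (equivalently $I_3=0$ near $p_0$). (2) If $K$ is not constant near $p_0$, then $\dim\mathcal J_1=1$ if and only if $$I_{4b}=0,\qquad I_{5d}=0$$ identically in a neighbourhood of $p_0$. (3) Otherwise there are no local Killing vector fields near $p_0$, i.e. $\mathcal J_1=0$.
   Context: Let $H=\sum g^{ij}p_ip_j$ be the Hamiltonian of the geodesic flow of $g$ on $T^*M$. Everything is local: $\mathcal J_n=\mathcal J_n(g)$ denotes the real vector space of germs at $p_0$ of integrals homogeneous of degree $n$ in momenta, i.e. of functions $F=\sum_{i+j=n}u_{ij}(x,y)p_x^ip_y^j$ defined on $T^*U$ for some neighbourhood $U$ of $p_0$, with smooth $u_{ij}$, such that $\{H,F\}=0$ (canonical Poisson bracket). Elements of $\mathcal J_1$ are the same as germs of Killing vector fields. Differential invariants: $K$ is the Gaussian curvature, $\nabla$ the Levi-Civita connection, $\operatorname{grad}K$ the $g$-gradient of $K$, and $\operatorname{sgrad}K$ its rotation by $\pi/2$ (a local orientation is fixed). Put $d_\nabla^{\otimes1}K=dK$ and $(d_\nabla^{\otimes l}K)(\xi_1,\dots,\xi_l)=(\nabla_{\xi_1}d_\nabla^{\otimes(l-1)}K)(\xi_2,\dots,\xi_l)$. Set $I_2=K$, $I_3=|\operatorname{grad}K|^2$, and $I_{4b}=d_\nabla^{\otimes2}K(\operatorname{grad}K,\operatorname{sgrad}K)$,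 $I_{5d}=d_\nabla^{\otimes3}K(\operatorname{sgrad}K,\operatorname{sgrad}K,\operatorname{sgrad}K)$. *)

theory Defs
  imports "HOL-Analysis.Analysis"
begin

section \<open>Smooth functions\<close>

text \<open>Only meaningful for open \<open>S\<close>, where \<open>Ck_on k\<close> is the usual class \<open>C\<^sup>k\<close>: in finite
  dimension, the derivative is \<open>C\<^sup>k\<close> if and only if all directional derivatives are.\<close>

primrec Ck_on :: "nat \<Rightarrow> ('a::euclidean_space \<Rightarrow> 'b::euclidean_space) \<Rightarrow> 'a set \<Rightarrow> bool" where
  "Ck_on 0 f S \<longleftrightarrow> continuous_on S f"
| "Ck_on (Suc k) f S \<longleftrightarrow>
     (\<forall>x\<in>S. f differentiable (at x)) \<and> (\<forall>v. Ck_on k (\<lambda>x. frechet_derivative f (at x) v) S)"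

definition smooth_on :: "'a::euclidean_space set \<Rightarrow> ('a \<Rightarrow> 'b::euclidean_space) \<Rightarrow> bool" where
  "smooth_on S f \<longleftrightarrow> (\<forall>k. Ck_on k f S)"

definition partial :: "2 \<Rightarrow> (real^2 \<Rightarrow> real) \<Rightarrow> real^2 \<Rightarrow> real" where
  "partial i f x = frechet_derivative f (at x) (axis i 1)"

lemma Ck_cong:
  assumes "open S" "\<And>x. x \<in> S \<Longrightarrow> f x = g x" "Ck_on k f S"
  shows "Ck_on k g S"
  using assms(2,3)
proof (induction k arbitrary: f g)
  case 0 then show ?case by (metis Ck_on.simps(1) continuous_on_cong)
next
  case (Suc k)
  have d: "(g has_derivative D) (at x)" if "(f has_derivative D) (at x)" "x \<in> S" for x D
    using has_derivative_transform_within_open[OF that(1) assms(1) that(2)] Suc.prems(1) by blast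
  have e: "frechet_derivative f (at x) = frechet_derivative g (at x)" if "x \<in> S" for x
    using Suc.prems(2) that d frechet_derivative_at frechet_derivative_works Ck_on.simps(2) by metis
  show ?case
    using Suc.prems(2) d Suc.IH[of "\<lambda>x. frechet_derivative f (at x) v" "\<lambda>x. frechet_derivative g (at x) v" for v] e
    unfolding Ck_on.simps differentiable_def by (metis (no_types, lifting))
qed

lemma Ck_lin:
  assumes "open S" "Ck_on k f S" "Ck_on k g S"
  shows "Ck_on k (\<lambda>x. a *\<^sub>R f x + b *\<^sub>R g x) S"
  using assms(2,3)
proof (induction k arbitrary: f g)
  case 0 then show ?case by (auto intro!: continuous_intros)
next
  case (Suc k)
  have d: "((\<lambda>x. a *\<^sub>R f x + b *\<^sub>R g x) has_derivative
     (\<lambda>v. a *\<^sub>R frechet_derivative f (at x) v + b *\<^sub>R frechet_derivative g (at x) v)) (at x)" if "x \<in> S" for x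
    using Suc.prems that
    by (auto intro!: derivative_eq_intros simp: frechet_derivative_works[symmetric])
  have "Ck_on k (\<lambda>x. frechet_derivative (\<lambda>x. a *\<^sub>R f x + b *\<^sub>R g x) (at x) v) S" for v
    apply (rule Ck_cong[OF assms(1) _ Suc.IH[of "\<lambda>x. frechet_derivative f (at x) v" "\<lambda>x. frechet_derivative g (at x) v"]])
    subgoal for x using frechet_derivative_at[OF d[of x]] by metis
    using Suc.prems by auto
  then show ?case using d by (auto simp: differentiable_def)
qed

lemma partial_lin:
  assumes "f differentiable (at x)" "g differentiable (at x)"
  shows "partial i (\<lambda>x. a * f x + b * g x) x = a * partial i f x + b * partial i g x"
proof -
  have "((\<lambda>x. a * f x + b * g x) has_derivative
     (\<lambda>v. a * frechet_derivative f (at x) v + b * frechet_derivative g (at x) v)) (at x)"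
    using assms by (auto intro!: derivative_eq_intros simp: frechet_derivative_works[symmetric])
  from frechet_derivative_at[OF this] show ?thesis unfolding partial_def by metis
qed


section \<open>Riemannian surfaces\<close>

text \<open>A chart is its domain together with its coordinate map; the values of the map outside
  the domain are irrelevant.\<close>

type_synonym 'a chart = "'a set \<times> ('a \<Rightarrow> real^2)"

fun is_chart :: "'a topology \<Rightarrow> 'a chart \<Rightarrow> bool" where
  "is_chart X (U, \<phi>) \<longleftrightarrow> openin X U \<and> open (\<phi> ` U) \<and>
     homeomorphic_map (subtopology X U) (top_of_set (\<phi> ` U)) \<phi>"

fun transition :: "'a chart \<Rightarrow> 'a chart \<Rightarrow> real^2 \<Rightarrow> real^2" where
  "transition (U, \<phi>) (V, \<psi>) = \<psi> \<circ> inv_into U \<phi>"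

fun overlap :: "'a chart \<Rightarrow> 'a chart \<Rightarrow> (real^2) set" where
  "overlap (U, \<phi>) (V, \<psi>) = \<phi> ` (U \<inter> V)"

definition compatible :: "'a chart \<Rightarrow> 'a chart \<Rightarrow> bool" where
  "compatible c d \<longleftrightarrow> smooth_on (overlap c d) (transition c d) \<and>
                     smooth_on (overlap d c) (transition d c)"

text \<open>The atlas is maximal, so that it is the full smooth structure of the surface; in particular
  it contains charts of both orientations around every point.\<close>

definition smooth_surface :: "'a topology \<Rightarrow> 'a chart set \<Rightarrow> bool" where
  "smooth_surface X A \<longleftrightarrow>
     Hausdorff_space X \<and> second_countable X \<and>
     (\<Union>c\<in>A. fst c) = topspace X \<and>
     (\<forall>c\<in>A. is_chart X c) \<and>
     (\<forall>c\<in>A. \<forall>d\<in>A. compatible c d) \<and>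
     (\<forall>c. is_chart X c \<and> (\<forall>d\<in>A. compatible c d) \<longrightarrow> c \<in> A)"

text \<open>A metric is given by its matrix \<open>(g\<^sub>i\<^sub>j)\<close> in every chart of the atlas,
  subject to the transformation law of a covariant 2-tensor.\<close>

definition riemannian_metric :: "'a chart set \<Rightarrow> ('a chart \<Rightarrow> real^2 \<Rightarrow> real^2^2) \<Rightarrow> bool" where
  "riemannian_metric A g \<longleftrightarrow>
     (\<forall>(U, \<phi>)\<in>A.
        (\<forall>i j. smooth_on (\<phi> ` U) (\<lambda>x. g (U, \<phi>) x $ i $ j)) \<and>
        (\<forall>x\<in>\<phi> ` U. transpose (g (U, \<phi>) x) = g (U, \<phi>) x \<and>
                   (\<forall>v. v \<noteq> 0 \<longrightarrow> v \<bullet> (g (U, \<phi>) x *v v) > 0))) \<and>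
     (\<forall>c\<in>A. \<forall>d\<in>A. \<forall>x\<in>overlap c d.
        let D = matrix (frechet_derivative (transition c d) (at x))
        in g c x = transpose D ** g d (transition c d x) ** D)"


section \<open>Levi-Civita connection, curvature and differential invariants in a chart\<close>

text \<open>From here on \<open>h\<close> is the matrix of the metric in a fixed chart, and functions are written in
  the coordinates of that chart.\<close>

definition christoffel :: "(real^2 \<Rightarrow> real^2^2) \<Rightarrow> 2 \<Rightarrow> 2 \<Rightarrow> 2 \<Rightarrow> real^2 \<Rightarrow> real" where
  "christoffel h k i j x =
     (\<Sum>l\<in>UNIV. matrix_inv (h x) $ k $ l *
        (partial i (\<lambda>y. h y $ j $ l) x + partial j (\<lambda>y. h y $ i $ l) x
         - partial l (\<lambda>y. h y $ i $ j) x)) / 2"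

text \<open>\<open>R(\<partial>\<^sub>i, \<partial>\<^sub>j) \<partial>\<^sub>k = \<Sum>\<^sub>l riemann h l k i j \<partial>\<^sub>l\<close>, where
  \<open>R(X, Y) Z = \<nabla>\<^sub>X \<nabla>\<^sub>Y Z - \<nabla>\<^sub>Y \<nabla>\<^sub>X Z - \<nabla>\<^bsub>[X, Y]\<^esub> Z\<close>.\<close>

definition riemann :: "(real^2 \<Rightarrow> real^2^2) \<Rightarrow> 2 \<Rightarrow> 2 \<Rightarrow> 2 \<Rightarrow> 2 \<Rightarrow> real^2 \<Rightarrow> real" where
  "riemann h l k i j x =
     partial i (christoffel h l j k) x - partial j (christoffel h l i k) x
     + (\<Sum>m\<in>UNIV. christoffel h l i m x * christoffel h m j k x
                 - christoffel h l j m x * christoffel h m i k x)"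

text \<open>\<open>K = g(R(\<partial>\<^sub>1, \<partial>\<^sub>2) \<partial>\<^sub>2, \<partial>\<^sub>1) / det g\<close>\<close>

definition gauss_curvature :: "(real^2 \<Rightarrow> real^2^2) \<Rightarrow> real^2 \<Rightarrow> real" where
  "gauss_curvature h x = (\<Sum>l\<in>UNIV. h x $ 1 $ l * riemann h l 2 1 2 x) / det (h x)"

text \<open>A covariant tensor field of rank \<open>l\<close> is given by its components, indexed by the lists of
  length \<open>l\<close>. The differentiation index of a covariant derivative comes first.\<close>

type_synonym covariant_tensor = "2 list \<Rightarrow> real^2 \<Rightarrow> real"

fun cov_deriv :: "(real^2 \<Rightarrow> real^2^2) \<Rightarrow> covariant_tensor \<Rightarrow> covariant_tensor" where
  "cov_deriv h T [] x = 0"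
| "cov_deriv h T (i # js) x =
     partial i (T js) x
     - (\<Sum>k<length js. \<Sum>m\<in>UNIV. christoffel h m i (js ! k) x * T (js[k := m]) x)"

text \<open>\<open>d\<^sub>\<nabla>\<^sup>\<otimes>\<^sup>l f\<close>; for \<open>l = 1\<close> the Christoffel terms are absent and this is \<open>df\<close>.\<close>

definition iter_cov_deriv ::
  "(real^2 \<Rightarrow> real^2^2) \<Rightarrow> nat \<Rightarrow> (real^2 \<Rightarrow> real) \<Rightarrow> covariant_tensor" where
  "iter_cov_deriv h l f = (cov_deriv h ^^ l) (\<lambda>_. f)"

definition tensor_apply :: "covariant_tensor \<Rightarrow> real^2 \<Rightarrow> (real^2) list \<Rightarrow> real" where
  "tensor_apply T x vs =
     (\<Sum>js | length js = length vs. T js x * (\<Prod>k<length vs. (vs ! k) $ (js ! k)))"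

definition grad :: "(real^2 \<Rightarrow> real^2^2) \<Rightarrow> (real^2 \<Rightarrow> real) \<Rightarrow> real^2 \<Rightarrow> real^2" where
  "grad h f x = matrix_inv (h x) *v (\<chi> i. partial i f x)"

text \<open>Rotation by \<open>\<pi>/2\<close>, with respect to the metric matrix \<open>B\<close> and the orientation of the
  coordinates.\<close>

definition rotate_left :: "real^2^2 \<Rightarrow> real^2 \<Rightarrow> real^2" where
  "rotate_left B v = (1 / sqrt (det B)) *\<^sub>R vector [- ((B *v v) $ 2), (B *v v) $ 1]"

lemma rotate_left:
  assumes "transpose B = B" and D: "det B > 0"
  shows rotate_left_orthogonal: "v \<bullet> (B *v rotate_left B v) = 0"
    and rotate_left_norm: "rotate_left B v \<bullet> (B *v rotate_left B v) = v \<bullet> (B *v v)"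
    and rotate_left_oriented:
      "det (vector [v, rotate_left B v] :: real^2^2) = (v \<bullet> (B *v v)) / sqrt (det B)"
proof -
  define a b c where "a = B$1$1" and "b = B$1$2" and "c = B$2$2"
  have s: "B$2$1 = b"
    using arg_cong[OF assms(1), of "\<lambda>M. M$1$2"] by (simp add: transpose_def b_def)
  define s where "s = sqrt (det B)"
  have s2: "s^2 = a*c - b*b" and s0: "s > 0" and
       d: "det B = a*c - b*b"
    using D s by (simp_all add: s_def det_2 a_def b_def c_def)
  note m = rotate_left_def matrix_vector_mult_def inner_vec_def sum_2 UNIV_2 s
     a_def[symmetric] b_def[symmetric] c_def[symmetric] s_def[symmetric]
  have r: "rotate_left B v $ 1 = - (b * v$1 + c * v$2) / s"
          "rotate_left B v $ 2 = (a * v$1 + b * v$2) / s"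
    by (simp_all add: rotate_left_def matrix_vector_mult_def sum_2 s
        flip: s_def a_def b_def c_def)
  have n: "v \<bullet> (B *v w) = v$1 * (a * w$1 + b * w$2) + v$2 * (b * w$1 + c * w$2)" for v w
    by (simp add: matrix_vector_mult_def inner_vec_def sum_2 s flip: a_def b_def c_def)
  show "v \<bullet> (B *v rotate_left B v) = 0"
    using s0 by (simp add: n r field_simps)
  show "det (vector [v, rotate_left B v] :: real^2^2) = (v \<bullet> (B *v v)) / sqrt (det B)"
    unfolding s_def[symmetric] using s0 by (simp add: n r det_2 field_simps)
  have "rotate_left B v \<bullet> (B *v rotate_left B v) * s^2 = (a*c-b*b) * (v \<bullet> (B *v v))"
    using s0 by (simp add: n r field_simps power2_eq_square)
  then show "rotate_left B v \<bullet> (B *v rotate_left B v) = v \<bullet> (B *v v)"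
    using s0 unfolding s2[symmetric] by simp
qed

definition sgrad :: "(real^2 \<Rightarrow> real^2^2) \<Rightarrow> (real^2 \<Rightarrow> real) \<Rightarrow> real^2 \<Rightarrow> real^2" where
  "sgrad h f x = rotate_left (h x) (grad h f x)"

definition I3 :: "(real^2 \<Rightarrow> real^2^2) \<Rightarrow> real^2 \<Rightarrow> real" where
  "I3 h x = (let v = grad h (gauss_curvature h) x in v \<bullet> (h x *v v))"

definition I4b :: "(real^2 \<Rightarrow> real^2^2) \<Rightarrow> real^2 \<Rightarrow> real" where
  "I4b h x = (let K = gauss_curvature h
              in tensor_apply (iter_cov_deriv h 2 K) x [grad h K x, sgrad h K x])"

definition I5d :: "(real^2 \<Rightarrow> real^2^2) \<Rightarrow> real^2 \<Rightarrow> real" where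
  "I5d h x = (let K = gauss_curvature h
              in tensor_apply (iter_cov_deriv h 3 K) x [sgrad h K x, sgrad h K x, sgrad h K x])"


section \<open>Functions on the cotangent bundle\<close>

text \<open>Functions on the cotangent bundle of a coordinate domain, as functions of the position and
  the momentum.\<close>

type_synonym phase_fun = "real^2 \<Rightarrow> real^2 \<Rightarrow> real"

definition poisson_bracket :: "phase_fun \<Rightarrow> phase_fun \<Rightarrow> phase_fun" where
  "poisson_bracket F G x p =
     (\<Sum>i\<in>UNIV. partial i (F x) p * partial i (\<lambda>y. G y p) x
              - partial i (\<lambda>y. F y p) x * partial i (G x) p)"

definition hamiltonian :: "(real^2 \<Rightarrow> real^2^2) \<Rightarrow> phase_fun" where
  "hamiltonian h x p = (\<Sum>i\<in>UNIV. \<Sum>j\<in>UNIV. matrix_inv (h x) $ i $ j * p $ i * p $ j)"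

definition integral_on :: "(real^2 \<Rightarrow> real^2^2) \<Rightarrow> nat \<Rightarrow> (real^2) set \<Rightarrow> phase_fun \<Rightarrow> bool" where
  "integral_on h n U F \<longleftrightarrow>
     (\<exists>u. (\<forall>i\<le>n. smooth_on U (u i)) \<and>
          (\<forall>x\<in>U. \<forall>p. F x p = (\<Sum>i\<le>n. u i x * (p $ 1) ^ i * (p $ 2) ^ (n - i)))) \<and>
     (\<forall>x\<in>U. \<forall>p. poisson_bracket (hamiltonian h) F x p = 0)"

text \<open>Germs along the fibre over the origin: two functions are identified if they agree on the
  cotangent bundle of a neighbourhood of \<open>0\<close>. Germs at other points are obtained by
  translation.\<close>

quotient_type germ = phase_fun / "\<lambda>F G. \<forall>\<^sub>F x in nhds 0. \<forall>p. F x p = G x p"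
  by (rule equivpI) (auto simp: reflp_def symp_def transp_def eventually_mono elim: eventually_elim2)

instantiation germ :: real_vector
begin

lift_definition zero_germ :: germ is "\<lambda>_ _. 0" .

lift_definition plus_germ :: "germ \<Rightarrow> germ \<Rightarrow> germ" is "\<lambda>F G x p. F x p + G x p"
  by (auto elim: eventually_elim2)

lift_definition minus_germ :: "germ \<Rightarrow> germ \<Rightarrow> germ" is "\<lambda>F G x p. F x p - G x p"
  by (auto elim: eventually_elim2)

lift_definition uminus_germ :: "germ \<Rightarrow> germ" is "\<lambda>F x p. - F x p"
  by (auto elim: eventually_mono)

lift_definition scaleR_germ :: "real \<Rightarrow> germ \<Rightarrow> germ" is "\<lambda>c F x p. c * F x p"
  by (auto elim: eventually_mono)

instance
  by standard (transfer, simp add: algebra_simps)+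

end

definition germ_at :: "real^2 \<Rightarrow> phase_fun \<Rightarrow> germ" where
  "germ_at q F = abs_germ (\<lambda>x. F (q + x))"

text \<open>The space \<open>\<J>\<^sub>n\<close> at the point with coordinates \<open>q\<close>. As only germs matter, \<open>U\<close> may always
  be shrunk into the coordinate domain.\<close>

definition integral_germs :: "(real^2 \<Rightarrow> real^2^2) \<Rightarrow> real^2 \<Rightarrow> nat \<Rightarrow> germ set" where
  "integral_germs h q n = {germ_at q F | F U. open U \<and> q \<in> U \<and> integral_on h n U F}"

lemma integral_diff:
  assumes "open U" "x \<in> U" "integral_on h n U F"
  shows "(\<lambda>y. F y p) differentiable (at x)" "F x differentiable (at p)"
proof -
  obtain u where u: "\<forall>i\<le>n. smooth_on U (u i)"
    and F: "\<And>x p. x\<in>U \<Longrightarrow> F x p = (\<Sum>i\<le>n. u i x * (p $ 1) ^ i * (p $ 2) ^ (n - i))"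
    using assms(3) unfolding integral_on_def by blast
  have "i \<le> n \<Longrightarrow> Ck_on 1 (u i) U" for i using u unfolding smooth_on_def by blast
  then have du: "u i differentiable (at x)" if "i \<le> n" for i using that assms(2) by simp
  have "(\<lambda>x. \<Sum>i\<le>n. u i x * (p $ 1) ^ i * (p $ 2) ^ (n - i)) differentiable (at x)"
    using du by (intro derivative_intros) auto
  then show "(\<lambda>y. F y p) differentiable (at x)"
    unfolding differentiable_def
    using has_derivative_transform_within_open[OF _ assms(1,2), where g="\<lambda>y. F y p"] F
    by (metis (no_types, lifting))
  have "F x = (\<lambda>p. \<Sum>i\<le>n. u i x * (p $ 1) ^ i * (p $ 2) ^ (n - i))"
    using F assms(2) by auto
  moreover have "(\<lambda>p. \<Sum>i\<le>n. u i x * (p $ 1) ^ i * (p $ 2) ^ (n - i)) differentiable (at p)"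
    unfolding differentiable_def
    by (rule exI) (auto intro!: derivative_eq_intros bounded_linear.has_derivative[OF bounded_linear_vec_nth])
  ultimately show "F x differentiable (at p)" by simp
qed

lemma integral_lin:
  assumes U: "open U" and F: "integral_on h n U F" and G: "integral_on h n U G"
  shows "integral_on h n U (\<lambda>x p. a * F x p + b * G x p)"
proof -
  obtain u where u: "\<forall>i\<le>n. smooth_on U (u i)"
    and uF: "\<And>x p. x\<in>U \<Longrightarrow> F x p = (\<Sum>i\<le>n. u i x * (p $ 1) ^ i * (p $ 2) ^ (n - i))"
    using F unfolding integral_on_def by blast
  obtain v where v: "\<forall>i\<le>n. smooth_on U (v i)"
    and vG: "\<And>x p. x\<in>U \<Longrightarrow> G x p = (\<Sum>i\<le>n. v i x * (p $ 1) ^ i * (p $ 2) ^ (n - i))"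
    using G unfolding integral_on_def by blast
  have "\<forall>i\<le>n. smooth_on U (\<lambda>x. a * u i x + b * v i x)"
    using u v Ck_lin[OF U, where 'b=real, of _ _ _ a b] unfolding smooth_on_def by auto
  moreover have "\<forall>x\<in>U. \<forall>p. a * F x p + b * G x p =
     (\<Sum>i\<le>n. (a * u i x + b * v i x) * (p $ 1) ^ i * (p $ 2) ^ (n - i))"
    by (simp add: uF vG sum_distrib_left distrib_right sum.distrib mult.assoc)
  moreover have "poisson_bracket (hamiltonian h) (\<lambda>x p. a * F x p + b * G x p) x p = 0" if "x \<in> U" for x p
  proof -
    have "poisson_bracket (hamiltonian h) (\<lambda>x p. a * F x p + b * G x p) x p
      = a * poisson_bracket (hamiltonian h) F x p + b * poisson_bracket (hamiltonian h) G x p"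
      unfolding poisson_bracket_def
      using integral_diff[OF U that F] integral_diff[OF U that G]
      by (simp add: partial_lin sum_distrib_left algebra_simps sum.distrib sum_subtractf)
    then show ?thesis using F G that unfolding integral_on_def by simp
  qed
  ultimately show ?thesis
    unfolding integral_on_def by (intro conjI exI[of _ "\<lambda>i x. a * u i x + b * v i x"]) auto
qed

lemma integral_on_subset:
  assumes "integral_on h n U F" "open U" "open V" "V \<subseteq> U"
  shows "integral_on h n V F"
proof -
  have "Ck_on k f U \<Longrightarrow> Ck_on k f V" for k and f :: "real^2 \<Rightarrow> real"
    by (induction k arbitrary: f) (use assms(4) continuous_on_subset in auto)
  then show ?thesis using assms(1,4) unfolding integral_on_def smooth_on_def by (meson subsetD)
qed

lemma subspace_integral_germs: "subspace (integral_germs h q n)"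
proof -
  have 0: "integral_on h n UNIV (\<lambda>x p. 0)"
  proof -
    have "Ck_on k (\<lambda>x. 0::real) UNIV" for k
      by (induction k) auto
    then show ?thesis
      unfolding integral_on_def smooth_on_def poisson_bracket_def partial_def
      by (auto intro!: exI[of _ "\<lambda>_ _. 0"])
  qed
  have lin: "a *\<^sub>R f + b *\<^sub>R g \<in> integral_germs h q n"
    if fg: "f \<in> integral_germs h q n" "g \<in> integral_germs h q n" for f g a b
  proof -
    obtain F U where F: "f = germ_at q F" "open U" "q \<in> U" "integral_on h n U F"
      using fg(1) unfolding integral_germs_def by blast
    obtain G V where G: "g = germ_at q G" "open V" "q \<in> V" "integral_on h n V G"
      using fg(2) unfolding integral_germs_def by blast
    have UV: "open (U \<inter> V)" "q \<in> U \<inter> V" using F G by auto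
    have "integral_on h n (U \<inter> V) (\<lambda>x p. a * F x p + b * G x p)"
      by (intro integral_lin UV integral_on_subset[OF F(4,2) UV(1)] integral_on_subset[OF G(4,2) UV(1)]) auto
    moreover have "a *\<^sub>R f + b *\<^sub>R g = germ_at q (\<lambda>x p. a * F x p + b * G x p)"
      unfolding F(1) G(1) germ_at_def by (simp add: scaleR_germ.abs_eq plus_germ.abs_eq)
    ultimately show ?thesis using UV unfolding integral_germs_def by blast
  qed
  have z: "0 = germ_at q (\<lambda>x p. 0)" unfolding germ_at_def zero_germ_def by simp
  show ?thesis
    unfolding subspace_def
  proof (intro conjI ballI allI)
    show "0 \<in> integral_germs h q n"
      unfolding z integral_germs_def using 0 by (auto intro!: exI[of _ UNIV])
  next
    fix x y assume "x \<in> integral_germs h q n" "y \<in> integral_germs h q n"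
    then show "x + y \<in> integral_germs h q n" using lin[of x y 1 1] by simp
  next
    fix c x assume "x \<in> integral_germs h q n"
    then show "c *\<^sub>R x \<in> integral_germs h q n" using lin[of x x c 0] by simp
  qed
qed

definition constant_near :: "real^2 \<Rightarrow> (real^2 \<Rightarrow> real) \<Rightarrow> bool" where
  "constant_near q f \<longleftrightarrow> (\<exists>c. \<forall>\<^sub>F x in nhds q. f x = c)"

end

theory Submission
  imports Defs
begin

text \<open>A Killing field \<open>X\<close> satisfies \<open>\<nabla>X = \<omega> J\<close> for the rotation \<open>J\<close> by \<open>\<pi>/2\<close> and a function \<open>\<omega>\<close>, and
  differentiating once more expresses \<open>d\<omega>\<close> by \<open>K\<close> and \<open>X\<close>. So Killing fields are the parallel
  sections \<open>(X, \<omega>)\<close> of a connection on a bundle of rank 3, which is flat if and only if \<open>K\<close> is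
  constant; its integrability condition is \<open>dK(X) = 0\<close>. Where \<open>dK \<noteq> 0\<close>, a Killing field is
  therefore a multiple of \<open>sgrad K\<close>, the value at one point determines it up to a constant factor,
  and differentiating \<open>dK(X) = 0\<close> twice gives \<open>I\<^sub>4\<^sub>b = I\<^sub>5\<^sub>d = 0\<close> wherever \<open>X \<noteq> 0\<close>. Conversely, \<open>I\<^sub>4\<^sub>b = 0\<close>
  says that \<open>grad K\<close> and \<open>sgrad K\<close> are eigenvectors of the Hessian of \<open>K\<close>; then \<open>I\<^sub>5\<^sub>d = 0\<close> says that
  the eigenvalues are constant along the level curves of \<open>K\<close>, which makes the 1-form closed whose
  integral is the logarithm of the factor by which \<open>sgrad K\<close> has to be multiplied.\<close>

section \<open>Calculus of smooth functions\<close>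

text \<open>Everything is computed in one arbitrary chart, so the difficulty is the size of the
  curvature identities. Nothing is normalized: \<open>N\<close>, \<open>G\<close> and
  \<open>Z\<close> carry powers of \<open>det h\<close> instead of roots and quotients, which keeps
  the identities polynomial at the price of terms in \<open>t\<close>. Derivatives of the metric are
  expressed by Christoffel symbols and derivatives of \<open>K\<close> by covariant ones, so that
  the symbols can be treated as free variables.

  Differentiating dK(X) = 0 twice along X leaves only the cubic term: curvature enters with opposite
  signs and cancels, and the terms in \<omega> reduce to dK(X) since the square of J is -1.

  Conversely, if d(ln f) = \<beta> dK, then f sgrad K is Killing exactly when Hess K + \<beta> dK^2
  is a multiple of the metric. On the two eigenvectors this forces \<beta> = (\<nu> - \<mu>) / |grad
  K|^2, with \<mu> the eigenvalue on grad K and \<nu> that on sgrad K. That \<mu> is constant along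
  level curves needs only \<open>I4b\<close>, because d|grad K|^2 = 2 \<mu> dK; \<open>I5d\<close>
  is what \<nu> requires.\<close>

lemma Ck_on_Suc_imp: "Ck_on (Suc k) f S \<Longrightarrow> Ck_on k f S"
proof (induction k arbitrary: f)
  case 0
  then show ?case
    by (auto intro!: continuous_at_imp_continuous_on differentiable_imp_continuous_within)
next
  case (Suc k)
  then show ?case unfolding Ck_on.simps(2)[of "Suc k"] Ck_on.simps(2)[of k f] by blast
qed

lemma Ck_on_subset: "Ck_on k f S \<Longrightarrow> T \<subseteq> S \<Longrightarrow> Ck_on k f T"
  by (induction k arbitrary: f) (auto intro: continuous_on_subset)

text \<open>Replaces the chosen \<open>frechet_derivative\<close> by a derivative known in closed
  form, so that product and quotient rules can be fed into an induction on the order.\<close>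

lemma Ck_on_SucI:
  assumes "open S"
    and D: "\<And>x. x \<in> S \<Longrightarrow> (f has_derivative D x) (at x)"
    and C: "\<And>v. Ck_on k (\<lambda>x. D x v) S"
  shows "Ck_on (Suc k) f S"
proof -
  have "Ck_on k (\<lambda>x. frechet_derivative f (at x) v) S" for v
    using frechet_derivative_at[OF D] by (intro Ck_cong[OF assms(1) _ C[of v]]) metis
  then show ?thesis using D by (auto simp: differentiable_def)
qed

lemma Ck_on_const: "Ck_on k (\<lambda>_. c) S"
proof (induction k arbitrary: c)
  case (Suc k)
  then show ?case by simp
qed simp

lemma Ck_on_add:
  assumes "open S" "Ck_on k f S" "Ck_on k g S"
  shows "Ck_on k (\<lambda>x. f x + g x) S"
  using Ck_lin[OF assms, of 1 1] by simp

lemma Ck_on_mult: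
  fixes f g :: "'a::euclidean_space \<Rightarrow> real"
  assumes "open S" "Ck_on k f S" "Ck_on k g S"
  shows "Ck_on k (\<lambda>x. f x * g x) S"
  using assms(2,3)
proof (induction k arbitrary: f g)
  case 0
  then show ?case by (auto intro: continuous_intros)
next
  case (Suc k)
  show ?case
  proof (rule Ck_on_SucI[OF assms(1)])
    show "((\<lambda>x. f x * g x) has_derivative
       (\<lambda>v. f x * frechet_derivative g (at x) v + frechet_derivative f (at x) v * g x)) (at x)"
      if "x \<in> S" for x
      using Suc.prems that by (auto intro!: has_derivative_mult simp: frechet_derivative_works[symmetric])
    show "Ck_on k (\<lambda>x. f x * frechet_derivative g (at x) v + frechet_derivative f (at x) v * g x) S" for v
      using Suc.prems Suc.prems[THEN Ck_on_Suc_imp] by (intro Ck_on_add[OF assms(1)] Suc.IH) auto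
  qed
qed

text \<open>The derivative of 1/f is a product that contains 1/f itself, which the induction
  hypothesis covers at order \<open>k\<close>. The sign is written as a factor -1 so that closure
  under products suffices.\<close>

lemma Ck_on_inverse:
  fixes f :: "'a::euclidean_space \<Rightarrow> real"
  assumes "open S" "Ck_on k f S" "\<And>x. x \<in> S \<Longrightarrow> f x \<noteq> 0"
  shows "Ck_on k (\<lambda>x. inverse (f x)) S"
  using assms(2)
proof (induction k)
  case 0
  then show ?case using assms(3) by (auto intro!: continuous_intros)
next
  case (Suc k)
  show ?case
  proof (rule Ck_on_SucI[OF assms(1)])
    show "((\<lambda>x. inverse (f x)) has_derivative
       (\<lambda>v. - 1 * (inverse (f x) * frechet_derivative f (at x) v * inverse (f x)))) (at x)"
      if "x \<in> S" for x
    proof -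
      have "(f has_derivative frechet_derivative f (at x)) (at x)"
        using Suc.prems that by (simp add: frechet_derivative_works[symmetric])
      from Deriv.has_derivative_inverse[OF assms(3)[OF that] this] show ?thesis by simp
    qed
    show "Ck_on k (\<lambda>x. - 1 * (inverse (f x) * frechet_derivative f (at x) v * inverse (f x))) S" for v
      by (intro Ck_on_mult[OF assms(1)] Ck_on_const Suc.IH Ck_on_Suc_imp[OF Suc.prems])
        (use Suc.prems in auto)
  qed
qed

context
  fixes S :: "'a::euclidean_space set"
  assumes S: "open S"
begin

lemma smooth_on_const: "smooth_on S (\<lambda>_. c)"
  by (simp add: smooth_on_def Ck_on_const)

lemma smooth_on_add: "smooth_on S f \<Longrightarrow> smooth_on S g \<Longrightarrow> smooth_on S (\<lambda>x. f x + g x)"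
  by (simp add: smooth_on_def Ck_on_add[OF S])

lemma smooth_on_mult:
  fixes f g :: "'a \<Rightarrow> real"
  shows "smooth_on S f \<Longrightarrow> smooth_on S g \<Longrightarrow> smooth_on S (\<lambda>x. f x * g x)"
  by (simp add: smooth_on_def Ck_on_mult[OF S])

lemma smooth_on_minus:
  fixes f :: "'a \<Rightarrow> real"
  shows "smooth_on S f \<Longrightarrow> smooth_on S (\<lambda>x. - f x)"
  using smooth_on_mult[OF smooth_on_const[of "-1"], of f] by simp

lemma smooth_on_diff:
  fixes f g :: "'a \<Rightarrow> real"
  shows "smooth_on S f \<Longrightarrow> smooth_on S g \<Longrightarrow> smooth_on S (\<lambda>x. f x - g x)"
  using smooth_on_add[OF _ smooth_on_minus[of g], of f] by simp

lemma smooth_on_inverse: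
  fixes f :: "'a \<Rightarrow> real"
  shows "smooth_on S f \<Longrightarrow> (\<And>x. x \<in> S \<Longrightarrow> f x \<noteq> 0) \<Longrightarrow> smooth_on S (\<lambda>x. inverse (f x))"
  by (simp add: smooth_on_def Ck_on_inverse[OF S])

lemma smooth_on_divide:
  fixes f g :: "'a \<Rightarrow> real"
  assumes "smooth_on S f" "smooth_on S g" "\<And>x. x \<in> S \<Longrightarrow> g x \<noteq> 0"
  shows "smooth_on S (\<lambda>x. f x / g x)"
  using smooth_on_mult[OF assms(1) smooth_on_inverse[OF assms(2,3)]] by (simp add: divide_inverse)

lemma smooth_on_sum:
  "(\<And>i. i \<in> I \<Longrightarrow> smooth_on S (f i)) \<Longrightarrow> smooth_on S (\<lambda>x. \<Sum>i\<in>I. f i x)"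
  by (induction I rule: infinite_finite_induct) (auto intro: smooth_on_const smooth_on_add)

lemma smooth_on_cong: "smooth_on S f \<Longrightarrow> (\<And>x. x \<in> S \<Longrightarrow> f x = g x) \<Longrightarrow> smooth_on S g"
  unfolding smooth_on_def using Ck_cong[OF S, of f g] by blast

end

lemma smooth_on_subset: "smooth_on S f \<Longrightarrow> T \<subseteq> S \<Longrightarrow> smooth_on T f"
  by (auto simp: smooth_on_def intro: Ck_on_subset)

lemma smooth_on_differentiable: "smooth_on S f \<Longrightarrow> x \<in> S \<Longrightarrow> f differentiable (at x)"
  unfolding smooth_on_def using Ck_on.simps(2)[of 0 f S] by blast

lemma smooth_on_continuous: "smooth_on S f \<Longrightarrow> continuous_on S f"
  unfolding smooth_on_def using Ck_on.simps(1)[of f S] by blast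

lemma smooth_on_partial: "smooth_on S f \<Longrightarrow> smooth_on S (partial i f)"
  unfolding smooth_on_def partial_def[abs_def] using Ck_on.simps(2)[of _ f S] by blast

lemma partial_eqI: "(f has_derivative D) (at x) \<Longrightarrow> partial i f x = D (axis i 1)"
  unfolding partial_def using frechet_derivative_at by metis

lemma has_derivative_partial:
  assumes "f differentiable (at x)"
  shows "(f has_derivative (\<lambda>v. v$1 * partial 1 f x + v$2 * partial 2 f x)) (at x)"
proof -
  have D: "(f has_derivative frechet_derivative f (at x)) (at x)"
    using assms by (simp add: frechet_derivative_works)
  then interpret bounded_linear "frechet_derivative f (at x)" by (rule has_derivative_bounded_linear)
  have "v = v$1 *\<^sub>R axis 1 1 + v$2 *\<^sub>R axis 2 1" for v :: "real^2"
    by (simp add: vec_eq_iff forall_2 axis_def)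
  then have "frechet_derivative f (at x) v = v$1 * partial 1 f x + v$2 * partial 2 f x" for v
    unfolding partial_def by (metis add scaleR real_scaleR_def)
  then have "frechet_derivative f (at x) = (\<lambda>v. v$1 * partial 1 f x + v$2 * partial 2 f x)" by blast
  with D show ?thesis by simp
qed

lemma partial_const: "partial i (\<lambda>_. c) x = 0"
  by (simp add: partial_def)

lemma partial_add:
  "f differentiable (at x) \<Longrightarrow> g differentiable (at x) \<Longrightarrow>
    partial i (\<lambda>x. f x + g x) x = partial i f x + partial i g x"
  using partial_lin[of f x g i 1 1] by simp

lemma partial_diff:
  "f differentiable (at x) \<Longrightarrow> g differentiable (at x) \<Longrightarrow>
    partial i (\<lambda>x. f x - g x) x = partial i f x - partial i g x"
  using partial_lin[of f x g i 1 "-1"] by simp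

lemma partial_minus:
  "f differentiable (at x) \<Longrightarrow> partial i (\<lambda>x. - f x) x = - partial i f x"
  using partial_lin[of f x f i "-1" 0] by simp

lemma partial_mult:
  assumes "f differentiable (at x)" "g differentiable (at x)"
  shows "partial i (\<lambda>x. f x * g x) x = partial i f x * g x + f x * partial i g x"
  using partial_eqI[OF has_derivative_mult[OF assms[unfolded frechet_derivative_works]]]
  by (simp add: partial_def add.commute)

lemma partial_cong:
  assumes "open S" "x \<in> S" "\<And>y. y \<in> S \<Longrightarrow> f y = g y" "f differentiable (at x)"
  shows "partial i f x = partial i g x"
proof -
  obtain D where "(f has_derivative D) (at x)"
    using assms(4) by (auto simp: differentiable_def)
  moreover from has_derivative_transform_within_open[OF this assms(1,2,3)]
  have "(g has_derivative D) (at x)" .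
  ultimately show ?thesis by (simp add: partial_eqI)
qed

lemma partial_eq_0:
  assumes "open S" "x \<in> S" "\<And>y. y \<in> S \<Longrightarrow> f y = c"
  shows "partial i f x = 0"
  using partial_cong[OF assms(1,2), of "\<lambda>_. c" f i] assms(3) by (simp add: partial_const)

text \<open>The mean value theorem twice, first in the direction \<open>i\<close>, then in the
  direction \<open>j\<close>. The difference on the left is symmetric in the two directions while
  the derivative on the right is not; \<open>partial_commute\<close> lives on this
  asymmetry.\<close>

lemma second_difference:
  fixes f :: "real^2 \<Rightarrow> real"
  assumes "open S" "smooth_on S f" "cball q (2*h) \<subseteq> S" "h > 0"
  shows "\<exists>\<xi>\<in>cball q (2*h). f (q + h *\<^sub>R axis i 1 + h *\<^sub>R axis j 1) - f (q + h *\<^sub>R axis i 1)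
           - f (q + h *\<^sub>R axis j 1) + f q = h * (h * partial j (partial i f) \<xi>)"
proof -
  have D: "((\<lambda>s. f (a + s *\<^sub>R axis k 1)) has_real_derivative partial k f (a + s *\<^sub>R axis k 1)) (at s)"
    if "smooth_on S f" "a + s *\<^sub>R axis k 1 \<in> S" for a s k and f :: "real^2 \<Rightarrow> real"
  proof -
    have "(f has_derivative (\<lambda>v. v$1 * partial 1 f (a + s *\<^sub>R axis k 1) + v$2 * partial 2 f (a + s *\<^sub>R axis k 1)))
       (at (a + s *\<^sub>R axis k 1))"
      using that by (intro has_derivative_partial smooth_on_differentiable)
    with has_derivative_compose[of "\<lambda>s. a + s *\<^sub>R axis k 1" "\<lambda>s. s *\<^sub>R axis k 1" s UNIV f]
    have "((\<lambda>s. f (a + s *\<^sub>R axis k 1)) has_derivative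
      (\<lambda>t. (t *\<^sub>R axis k 1)$1 * partial 1 f (a + s *\<^sub>R axis k 1) + (t *\<^sub>R axis k 1)$2 * partial 2 f (a + s *\<^sub>R axis k 1))) (at s)"
      by (fastforce intro!: derivative_eq_intros)
    moreover have "(\<lambda>t. (t *\<^sub>R axis k 1)$1 * partial 1 f (a + s *\<^sub>R axis k 1) + (t *\<^sub>R axis k 1)$2 * partial 2 f (a + s *\<^sub>R axis k 1))
      = (*) (partial k f (a + s *\<^sub>R axis k 1))"
      using exhaust_2[of k] by (auto simp: axis_def)
    ultimately show ?thesis by (simp add: has_field_derivative_def)
  qed
  have ball: "q + s *\<^sub>R axis i 1 + t *\<^sub>R axis j 1 \<in> cball q (2*h)"
    if "0 \<le> s" "s \<le> h" "0 \<le> t" "t \<le> h" for s t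
  proof -
    have "dist q (q + s *\<^sub>R axis i 1 + t *\<^sub>R axis j 1) = norm (s *\<^sub>R axis i 1 + t *\<^sub>R axis j 1 :: real^2)"
      by (metis add.assoc add_diff_cancel_left' dist_commute dist_norm)
    also have "\<dots> \<le> norm (s *\<^sub>R axis i 1 :: real^2) + norm (t *\<^sub>R axis j 1 :: real^2)"
      by (rule norm_triangle_ineq)
    finally show ?thesis using that by simp
  qed
  have mem: "q + s *\<^sub>R axis i 1 + t *\<^sub>R axis j 1 \<in> S"
    if "0 \<le> s" "s \<le> h" "0 \<le> t" "t \<le> h" for s t
    using ball[OF that] assms(3) by blast
  define \<phi> where "\<phi> s = f ((q + h *\<^sub>R axis j 1) + s *\<^sub>R axis i 1) - f (q + s *\<^sub>R axis i 1)" for s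
  have "\<exists>s. 0 < s \<and> s < h \<and> \<phi> h - \<phi> 0 = (h - 0) *
     (partial i f ((q + h *\<^sub>R axis j 1) + s *\<^sub>R axis i 1) - partial i f (q + s *\<^sub>R axis i 1))"
    unfolding \<phi>_def
    using mem[of _ h] mem[of _ 0] assms(2,4)
    by (intro MVT2 DERIV_diff D) (auto simp: add_ac)
  then obtain s where s: "0 < s" "s < h"
    "\<phi> h - \<phi> 0 = h * (partial i f ((q + s *\<^sub>R axis i 1) + h *\<^sub>R axis j 1) - partial i f ((q + s *\<^sub>R axis i 1) + 0 *\<^sub>R axis j 1))"
    by (auto simp: add_ac)
  have "\<exists>t. 0 < t \<and> t < h \<and> partial i f ((q + s *\<^sub>R axis i 1) + h *\<^sub>R axis j 1) - partial i f ((q + s *\<^sub>R axis i 1) + 0 *\<^sub>R axis j 1)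
     = (h - 0) * partial j (partial i f) ((q + s *\<^sub>R axis i 1) + t *\<^sub>R axis j 1)"
    using mem[of s] s assms(2,4) by (intro MVT2 D smooth_on_partial) auto
  then obtain t where t: "0 < t" "t < h" "partial i f ((q + s *\<^sub>R axis i 1) + h *\<^sub>R axis j 1) - partial i f ((q + s *\<^sub>R axis i 1) + 0 *\<^sub>R axis j 1)
     = h * partial j (partial i f) ((q + s *\<^sub>R axis i 1) + t *\<^sub>R axis j 1)" by auto
  show ?thesis
  proof (rule bexI)
    show "q + s *\<^sub>R axis i 1 + t *\<^sub>R axis j 1 \<in> cball q (2*h)"
      using ball[of s t] s(1,2) t(1,2) by simp
    have eq: "q + h *\<^sub>R axis j 1 + h *\<^sub>R axis i 1 = q + h *\<^sub>R axis i 1 + h *\<^sub>R axis j 1"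
      by (simp add: add_ac)
    show "f (q + h *\<^sub>R axis i 1 + h *\<^sub>R axis j 1) - f (q + h *\<^sub>R axis i 1)
           - f (q + h *\<^sub>R axis j 1) + f q
       = h * (h * partial j (partial i f) (q + s *\<^sub>R axis i 1 + t *\<^sub>R axis j 1))"
      using s(3) unfolding t(3) \<phi>_def eq by simp
  qed
qed

lemma partial_commute:
  assumes "open S" "smooth_on S f" "q \<in> S"
  shows "partial i (partial j f) q = partial j (partial i f) q"
proof (rule ccontr)
  let ?u = "partial i (partial j f)" and ?v = "partial j (partial i f)"
  assume "?u q \<noteq> ?v q"
  then have "(\<lambda>x. ?u x) \<midarrow>q\<rightarrow> ?u q" "(\<lambda>x. ?v x) \<midarrow>q\<rightarrow> ?v q" and e: "dist (?u q) (?v q) / 2 > 0"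
    using assms(1,3) smooth_on_continuous[OF smooth_on_partial[OF smooth_on_partial[OF assms(2)]]]
    by (auto simp: continuous_on_eq_continuous_at isCont_def)
  \<comment> \<open>Half of the assumed gap. Near \<open>q\<close> each mixed derivative stays
    within \<open>e\<close> of its value at \<open>q\<close>, yet a common second difference will
    force the two to share a value.\<close>
  define e where "e = dist (?u q) (?v q) / 2"
  have "\<forall>\<^sub>F x in nhds q. dist (?u x) (?u q) < e \<and> dist (?v x) (?v q) < e \<and> x \<in> S"
    using \<open>?u \<midarrow>q\<rightarrow> ?u q\<close> \<open>?v \<midarrow>q\<rightarrow> ?v q\<close> e assms
    unfolding tendsto_at_iff_tendsto_nhds e_def[symmetric]
    by (intro eventually_conj) (auto simp: tendsto_iff eventually_nhds)
  then obtain d where d: "d > 0" "\<And>x. dist x q < d \<Longrightarrow> dist (?u x) (?u q) < e \<and> dist (?v x) (?v q) < e \<and> x \<in> S"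
    unfolding eventually_nhds_metric by blast
  \<comment> \<open>Makes the closed ball of radius 2h, which contains both intermediate points, lie
    strictly within distance \<open>d\<close>.\<close>
  define h where "h = d / 3"
  have h: "cball q (2*h) \<subseteq> S" "h > 0" using d by (auto simp: h_def dist_commute)
  obtain \<xi> where \<xi>: "\<xi> \<in> cball q (2*h)"
    "f (q + h *\<^sub>R axis i 1 + h *\<^sub>R axis j 1) - f (q + h *\<^sub>R axis i 1)
           - f (q + h *\<^sub>R axis j 1) + f q = h * (h * ?v \<xi>)"
    using second_difference[OF assms(1,2) h, of i j] by blast
  obtain \<eta> where \<eta>: "\<eta> \<in> cball q (2*h)"
    "f (q + h *\<^sub>R axis j 1 + h *\<^sub>R axis i 1) - f (q + h *\<^sub>R axis j 1)
           - f (q + h *\<^sub>R axis i 1) + f q = h * (h * ?u \<eta>)"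
    using second_difference[OF assms(1,2) h, of j i] by blast
  have eq: "q + h *\<^sub>R axis j 1 + h *\<^sub>R axis i 1 = q + h *\<^sub>R axis i 1 + h *\<^sub>R axis j 1"
    by (simp add: add_ac)
  have "h * (h * ?v \<xi>) = h * (h * ?u \<eta>)"
    using \<xi>(2) \<eta>(2) unfolding eq by argo
  with h(2) have "?v \<xi> = ?u \<eta>" by simp
  with \<xi>(1) \<eta>(1) have "dist (?v \<xi>) (?v q) < e" "dist (?v \<xi>) (?u q) < e"
    using d(2)[of \<xi>] d(2)[of \<eta>] d(1) by (auto simp: h_def dist_commute)
  then show False
    unfolding e_def using dist_triangle[of "?u q" "?v q" "?v \<xi>"] by (simp add: dist_commute)
qed

section \<open>Flat linear systems of partial differential equations\<close>

text \<open>The integral from 0 to \<open>x\<close>, for \<open>x\<close> of either sign.\<close>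

definition pint :: "(real \<Rightarrow> 'v::banach) \<Rightarrow> real \<Rightarrow> 'v" where
  "pint f x = x *\<^sub>R integral {0..1} (\<lambda>t. f (x * t))"

lemma pint_0: "pint f 0 = 0"
  by (simp add: pint_def)

lemma mult_unit_mem:
  fixes x t r :: real
  assumes "x \<in> {-r..r}" "t \<in> {0..1}"
  shows "x * t \<in> {-r..r}"
proof -
  have "\<bar>x * t\<bar> = \<bar>x\<bar> * t" using assms by (simp add: abs_mult)
  also have "\<dots> \<le> r * 1" using assms by (intro mult_mono) auto
  finally show ?thesis by auto
qed

lemma pint_eq_aux:
  fixes f :: "real \<Rightarrow> 'v::banach"
  assumes "\<And>x. x \<in> {-r..r} \<Longrightarrow> (g has_vector_derivative f x) (at x within {-r..r})" "x \<in> {-r..r}"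
  shows "((\<lambda>t. x *\<^sub>R f (x * t)) has_integral g x - g 0) {0..1}"
proof -
  have "((\<lambda>t. g (x * t)) has_vector_derivative x *\<^sub>R f (x * t)) (at t within {0..1})"
    if t: "t \<in> {0..1}" for t
  proof -
    have "(*) x ` {0..1} \<subseteq> {-r..r}" using mult_unit_mem[OF assms(2)] by blast
    then have "(g has_vector_derivative f (x * t)) (at (x * t) within (*) x ` {0..1})"
      using assms(1)[OF mult_unit_mem[OF assms(2) t]] has_vector_derivative_within_subset by blast
    moreover have "((*) x has_vector_derivative x) (at t within {0..1})"
      by (auto intro!: derivative_eq_intros)
    ultimately show ?thesis
      using vector_diff_chain_within[of "(*) x" x t "{0..1}" g "f (x * t)"] by (simp add: o_def)
  qed
  then show ?thesis
    using fundamental_theorem_of_calculus[of 0 1 "\<lambda>t. g (x * t)"] by simp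
qed

lemma pint_eq:
  fixes f :: "real \<Rightarrow> 'v::banach"
  assumes "\<And>x. x \<in> {-r..r} \<Longrightarrow> (g has_vector_derivative f x) (at x within {-r..r})" "x \<in> {-r..r}"
  shows "pint f x = g x - g 0"
  using integral_unique[OF pint_eq_aux[of r g f x, OF assms]] by (simp add: pint_def)

text \<open>The mean value inequality based at 0. It supplies the contraction in
  \<open>picard_square\<close> and the vanishing of the defect in
  \<open>frobenius_square\<close>.\<close>

lemma has_vector_derivative_bound:
  fixes f :: "real \<Rightarrow> 'v::banach"
  assumes "\<And>x. x \<in> {-r..r} \<Longrightarrow> (g has_vector_derivative f x) (at x within {-r..r})" "x \<in> {-r..r}"
    and M: "\<And>x. x \<in> {-r..r} \<Longrightarrow> norm (f x) \<le> M"
  shows "norm (g x - g 0) \<le> \<bar>x\<bar> * M"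
proof -
  have "norm (x *\<^sub>R f (x * t)) \<le> \<bar>x\<bar> * M" if "t \<in> {0..1}" for t
    using M[OF mult_unit_mem[OF assms(2) that]] by (simp add: mult_left_mono)
  moreover have "0 \<le> M"
    using M[OF assms(2)] norm_ge_zero order_trans by blast
  ultimately show ?thesis
    using has_integral_bound[of "\<bar>x\<bar> * M" "\<lambda>t. x *\<^sub>R f (x * t)" "g x - g 0" 0 1]
      pint_eq_aux[of r g f x, OF assms(1,2)] by simp
qed

lemma pint_has_vector_derivative:
  fixes f :: "real \<Rightarrow> 'v::banach"
  assumes "continuous_on {-r..r} f" "x \<in> {-r..r}"
  shows "(pint f has_vector_derivative f x) (at x within {-r..r})"
proof -
  define g where "g x = integral {-r..x} f" for x
  have g: "(g has_vector_derivative f x) (at x within {-r..r})" if "x \<in> {-r..r}" for x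
    unfolding g_def using integral_has_vector_derivative[OF assms(1) that] .
  have "((\<lambda>x. g x - g 0) has_vector_derivative f x) (at x within {-r..r})"
    using g[OF assms(2)] by (auto intro!: derivative_eq_intros)
  then show ?thesis
    using has_vector_derivative_transform[OF assms(2), of "pint f" "\<lambda>x. g x - g 0" "f x"]
      pint_eq[of r g f, OF g] by blast
qed

lemma norm_pint_le:
  fixes f :: "real \<Rightarrow> 'v::banach"
  assumes "continuous_on {-r..r} f" "x \<in> {-r..r}" "\<And>x. x \<in> {-r..r} \<Longrightarrow> norm (f x) \<le> M"
  shows "norm (pint f x) \<le> \<bar>x\<bar> * M"
  using has_vector_derivative_bound[OF pint_has_vector_derivative[OF assms(1)] assms(2,3)]
  by (simp add: pint_0)

lemma pint_integrable:
  fixes f :: "real \<Rightarrow> 'v::banach"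
  assumes "continuous_on {-r..r} f" "x \<in> {-r..r}"
  shows "(\<lambda>t. f (x * t)) integrable_on {0..1}"
  using assms mult_unit_mem[OF assms(2)]
  by (intro integrable_continuous_interval continuous_on_compose2[OF assms(1)] continuous_intros) auto

lemma pint_add:
  fixes f :: "real \<Rightarrow> 'v::banach"
  assumes "continuous_on {-r..r} f" "continuous_on {-r..r} g" "x \<in> {-r..r}"
  shows "pint (\<lambda>t. f t + g t) x = pint f x + pint g x"
  unfolding pint_def using pint_integrable[OF assms(1,3)] pint_integrable[OF assms(2,3)]
  by (subst integral_add) (auto simp: scaleR_add_right)

lemma pint_diff:
  fixes f :: "real \<Rightarrow> 'v::banach"
  assumes "continuous_on {-r..r} f" "continuous_on {-r..r} g" "x \<in> {-r..r}"
  shows "pint (\<lambda>t. f t - g t) x = pint f x - pint g x"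
  unfolding pint_def using pint_integrable[OF assms(1,3)] pint_integrable[OF assms(2,3)]
  by (subst Henstock_Kurzweil_Integration.integral_diff) (auto simp: scaleR_diff_right)

lemma pint_cong:
  assumes "x \<in> {-r..r}" "\<And>t. t \<in> {-r..r} \<Longrightarrow> f t = g t"
  shows "pint f x = pint g x"
  unfolding pint_def using assms mult_unit_mem[OF assms(1)] by (auto intro!: integral_cong)

text \<open>Scaling to the fixed interval [0, 1] turns the endpoint into a parameter of the
  integrand, so theorems on parameter integrals apply to both variables alike.\<close>

lemma pint_continuous_fst:
  fixes F :: "real \<Rightarrow> real \<Rightarrow> 'v::banach"
  assumes "continuous_on ({-r..r} \<times> {-r..r}) (\<lambda>(x, y). F x y)"
  shows "continuous_on ({-r..r} \<times> {-r..r}) (\<lambda>(x, y). pint (\<lambda>t. F t y) x)"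
proof -
  have "continuous_on (({-r..r} \<times> {-r..r}) \<times> cbox 0 1) (\<lambda>(z, t). F (fst z * t) (snd z))"
    using mult_unit_mem[of _ r]
    by (auto intro!: continuous_on_compose2[OF assms, of _ "\<lambda>(z, t). (fst z * t, snd z)", simplified split_beta fst_conv snd_conv] continuous_intros
        simp: split_beta)
  from integral_continuous_on_param[OF this] show ?thesis
    by (auto simp: pint_def split_beta intro!: continuous_intros)
qed

lemma pint_continuous_snd:
  fixes F :: "real \<Rightarrow> real \<Rightarrow> 'v::banach"
  assumes "continuous_on ({-r..r} \<times> {-r..r}) (\<lambda>(x, y). F x y)"
  shows "continuous_on ({-r..r} \<times> {-r..r}) (\<lambda>(x, y). pint (\<lambda>t. F x t) y)"
proof -
  have "continuous_on (({-r..r} \<times> {-r..r}) \<times> cbox 0 1) (\<lambda>(z, t). F (fst z) (snd z * t))"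
    using mult_unit_mem[of _ r]
    by (auto intro!: continuous_on_compose2[OF assms, of _ "\<lambda>(z, t). (fst z, snd z * t)", simplified split_beta fst_conv snd_conv] continuous_intros
        simp: split_beta)
  from integral_continuous_on_param[OF this] show ?thesis
    by (auto simp: pint_def split_beta intro!: continuous_intros)
qed

lemma pint_leibniz:
  fixes F F' :: "real \<Rightarrow> real \<Rightarrow> 'v::banach"
  assumes "\<And>x y. x \<in> {-r..r} \<Longrightarrow> y \<in> {-r..r} \<Longrightarrow> (F x has_vector_derivative F' x y) (at y within {-r..r})"
    and "continuous_on ({-r..r} \<times> {-r..r}) (\<lambda>(x, y). F' x y)"
    and "\<And>y. y \<in> {-r..r} \<Longrightarrow> continuous_on {-r..r} (\<lambda>x. F x y)"
    and x: "x \<in> {-r..r}" and y: "y \<in> {-r..r}"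
  shows "((\<lambda>y. pint (\<lambda>t. F t y) x) has_vector_derivative pint (\<lambda>t. F' t y) x) (at y within {-r..r})"
proof -
  have "((\<lambda>y. integral (cbox 0 1) (\<lambda>t. F (x * t) y)) has_vector_derivative integral (cbox 0 1) (\<lambda>t. F' (x * t) y))
    (at y within {-r..r})"
  proof (rule leibniz_rule_vector_derivative[OF _ _ _ y])
    show "((\<lambda>x'. F (x * t) x') has_vector_derivative F' (x * t) x') (at x' within {- r..r})"
      if "x' \<in> {-r..r}" "t \<in> cbox 0 1" for x' t
      using that assms(1) mult_unit_mem[OF x] by simp
    show "(\<lambda>t. F (x * t) x') integrable_on cbox 0 1" if "x' \<in> {-r..r}" for x'
      using pint_integrable[OF assms(3)[OF that] x] by simp
    show "continuous_on ({- r..r} \<times> cbox 0 1) (\<lambda>(y, t). F' (x * t) y)"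
      using mult_unit_mem[OF x]
      by (auto intro!: continuous_on_compose2[OF assms(2), of _ "\<lambda>(y, t). (x * t, y)", simplified split_beta fst_conv snd_conv] continuous_intros
        simp: split_beta)
  qed simp
  then show ?thesis unfolding pint_def by (auto intro!: derivative_eq_intros)
qed

section \<open>Fixed points and flat systems on a square\<close>

lemma bounded_bilinear_matrix_vector_mult: "bounded_bilinear ((*v) :: real^'n::finite^'m::finite \<Rightarrow> _)"
proof -
  have "bilinear ((*v) :: real^'n^'m \<Rightarrow> _)"
    unfolding bilinear_def linear_iff
    by (auto simp: matrix_vector_right_distrib matrix_vector_mult_add_rdistrib
        matrix_vector_mult_scaleR scaleR_matrix_vector_assoc)
  then show ?thesis by (simp add: bilinear_conv_bounded_bilinear)
qed

lemmas continuous_on_matrix_vector_mult =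
  bounded_bilinear.continuous_on[OF bounded_bilinear_matrix_vector_mult]

lemma continuous_on_snd_slice:
  assumes "continuous_on (I \<times> J) (\<lambda>(x, y). F x y)" "x \<in> I"
  shows "continuous_on J (F x)"
  using assms(2) by (auto intro!: continuous_on_compose2[OF assms(1), of _ "\<lambda>y. (x, y)", simplified split_beta fst_conv snd_conv] continuous_intros)

lemma continuous_on_fst_slice:
  assumes "continuous_on (I \<times> J) (\<lambda>(x, y). F x y)" "y \<in> J"
  shows "continuous_on I (\<lambda>x. F x y)"
  using assms(2) by (auto intro!: continuous_on_compose2[OF assms(1), of _ "\<lambda>x. (x, y)", simplified split_beta fst_conv snd_conv] continuous_intros)

text \<open>The function that solves the system along the first axis and then along all lines parallel to
  the second one.\<close>

lemma picard_square:
  fixes A B :: "real \<Rightarrow> real \<Rightarrow> real^'n::finite^'n" and s0 :: "real^'n"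
  assumes r: "0 < r" "4 * (r * M) \<le> 1"
    and cA: "continuous_on ({-r..r} \<times> {-r..r}) (\<lambda>(x, y). A x y)"
    and cB: "continuous_on ({-r..r} \<times> {-r..r}) (\<lambda>(x, y). B x y)"
    and bA: "\<And>x y v. x \<in> {-r..r} \<Longrightarrow> y \<in> {-r..r} \<Longrightarrow> norm (A x y *v v) \<le> M * norm v"
    and bB: "\<And>x y v. x \<in> {-r..r} \<Longrightarrow> y \<in> {-r..r} \<Longrightarrow> norm (B x y *v v) \<le> M * norm v"
  obtains s where "continuous_on ({-r..r} \<times> {-r..r}) (\<lambda>(x, y). s x y)"
    "\<And>x y. x \<in> {-r..r} \<Longrightarrow> y \<in> {-r..r} \<Longrightarrow>
      s x y = s0 + pint (\<lambda>t. A t 0 *v s t 0) x + pint (\<lambda>t. B x t *v s x t) y"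
proof -
  define I where "I = {-r..r}"
  have I0: "0 \<in> I" using r by (simp add: I_def)
  have M0: "0 \<le> M"
  proof -
    obtain k :: 'n where True by blast
    have "0 \<le> M * norm (axis k 1 :: real^'n)"
      using bA[of 0 0 "axis k 1"] I0 by (auto simp: I_def intro: order_trans[OF norm_ge_zero])
    then show ?thesis by simp
  qed
  \<comment> \<open>A retraction of the line onto the interval. Composing with it makes every
    iterate a bounded continuous function on the whole plane, hence an element of the complete space
    \<open>bcontfun\<close>, although \<open>A\<close> and \<open>B\<close> are only controlled on
    the square.\<close>
  define c where "c x = max (- r) (min r x)" for x
  have c: "c x \<in> I" for x using r by (auto simp: c_def I_def)
  have c_id: "c x = x" if "x \<in> I" for x using that by (auto simp: c_def I_def)
  have cont_c: "continuous_on S c" for S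
    unfolding c_def[abs_def] by (intro continuous_intros)
  define G :: "(real \<times> real \<Rightarrow> real^'n) \<Rightarrow> real \<Rightarrow> real \<Rightarrow> real^'n" where
    "G \<phi> x y = s0 + pint (\<lambda>t. A t 0 *v \<phi> (t, 0)) x + pint (\<lambda>t. B x t *v \<phi> (x, t)) y" for \<phi> x y
  have cA\<phi>: "continuous_on (I \<times> I) (\<lambda>(x, y). A x y *v \<phi> (x, y))"
    and cB\<phi>: "continuous_on (I \<times> I) (\<lambda>(x, y). B x y *v \<phi> (x, y))"
    if "continuous_on UNIV \<phi>" for \<phi> :: "real \<times> real \<Rightarrow> real^'n"
    using cA cB continuous_on_subset[OF that]
    by (auto simp: split_beta I_def intro!: continuous_on_matrix_vector_mult)
  have contG: "continuous_on (I \<times> I) (\<lambda>(x, y). G \<phi> x y)"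
    if "continuous_on UNIV \<phi>" for \<phi> :: "real \<times> real \<Rightarrow> real^'n"
  proof -
    have "continuous_on (I \<times> I) (\<lambda>(x, y). pint (\<lambda>t. B x t *v \<phi> (x, t)) y)"
      unfolding I_def using cB\<phi>[OF that] by (intro pint_continuous_snd) (simp add: I_def)
    moreover have "continuous_on I (\<lambda>x. pint (\<lambda>t. A t 0 *v \<phi> (t, 0)) x)"
      using continuous_on_fst_slice[OF pint_continuous_fst[OF cA\<phi>[OF that, unfolded I_def]], of 0] I0
      by (simp add: I_def)
    then have "continuous_on (I \<times> I) (\<lambda>z. pint (\<lambda>t. A t 0 *v \<phi> (t, 0)) (fst z))"
      by (rule continuous_on_compose2) (auto intro!: continuous_intros)
    ultimately show ?thesis
      unfolding G_def split_beta by (intro continuous_intros) auto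
  qed
  define T where "T \<phi> = (\<lambda>z. G \<phi> (c (fst z)) (c (snd z)))" for \<phi>
  have contT: "continuous_on UNIV (T \<phi>)" if "continuous_on UNIV \<phi>" for \<phi>
    unfolding T_def
    by (rule continuous_on_compose2[OF contG[OF that], of UNIV "\<lambda>z. (c (fst z), c (snd z))", simplified split_beta fst_conv snd_conv])
      (use c in \<open>auto intro!: continuous_intros continuous_on_compose2[OF cont_c[of UNIV]]\<close>)
  have Tb: "T \<phi> \<in> bcontfun" if "continuous_on UNIV \<phi>" for \<phi>
  proof -
    have "bounded ((\<lambda>(x, y). G \<phi> x y) ` (I \<times> I))"
      by (intro compact_imp_bounded compact_continuous_image contG that) (simp add: I_def compact_Times)
    then have "bounded (range (T \<phi>))"
      by (rule bounded_subset) (use c in \<open>auto simp: T_def\<close>)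
    with contT[OF that] show ?thesis by (simp add: bcontfun_def)
  qed
  define TT where "TT \<phi> = Bcontfun (T (apply_bcontfun \<phi>))" for \<phi>
  have TT: "apply_bcontfun (TT \<phi>) z = T (apply_bcontfun \<phi>) z" for \<phi> z
    unfolding TT_def by (subst Bcontfun_inverse) (auto intro: Tb)
  \<comment> \<open>Each of the two integrals changes by at most r M times the distance; the
    hypothesis on 4 r M is exactly what makes their sum a contraction with constant 1/2.\<close>
  have "dist (TT \<phi>) (TT \<psi>) \<le> (1/2) * dist \<phi> \<psi>" for \<phi> \<psi>
  proof (rule dist_bound)
    fix z :: "real \<times> real"
    define x y where "x = c (fst z)" and "y = c (snd z)"
    have x: "x \<in> I" and y: "y \<in> I" by (simp_all add: x_def y_def c)
    let ?d = "dist \<phi> \<psi>"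
    have d: "norm (apply_bcontfun \<phi> p - apply_bcontfun \<psi> p) \<le> ?d" for p
      using dist_bounded[of \<phi> p \<psi>] by (simp add: dist_norm)
    have bd: "norm (pint (\<lambda>t. D t *v apply_bcontfun \<phi> (k t)) u - pint (\<lambda>t. D t *v apply_bcontfun \<psi> (k t)) u) \<le> r * (M * ?d)"
      if "continuous_on I D" "continuous_on I k" "\<And>t v. t \<in> I \<Longrightarrow> norm (D t *v v) \<le> M * norm v" "u \<in> I"
      for D :: "real \<Rightarrow> real^'n^'n" and k u
    proof -
      have cc: "continuous_on I (\<lambda>t. D t *v apply_bcontfun f (k t))" for f
        by (intro continuous_on_matrix_vector_mult that(1) continuous_on_compose2[OF continuous_on_apply_bcontfun[of UNIV] that(2)]) auto
      have "norm (pint (\<lambda>t. D t *v apply_bcontfun \<phi> (k t) - D t *v apply_bcontfun \<psi> (k t)) u) \<le> \<bar>u\<bar> * (M * ?d)"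
      proof (rule norm_pint_le)
        show "continuous_on {-r..r} (\<lambda>t. D t *v apply_bcontfun \<phi> (k t) - D t *v apply_bcontfun \<psi> (k t))"
          using cc by (auto intro!: continuous_intros simp: I_def)
        show "norm (D t *v apply_bcontfun \<phi> (k t) - D t *v apply_bcontfun \<psi> (k t)) \<le> M * ?d" if "t \<in> {-r..r}" for t
          using order_trans[OF \<open>\<And>t v. t \<in> I \<Longrightarrow> norm (D t *v v) \<le> M * norm v\<close> mult_left_mono[OF d M0]] that
          by (simp add: I_def flip: matrix_vector_mult_diff_distrib)
      qed (use that in \<open>auto simp: I_def\<close>)
      also have "\<dots> \<le> r * (M * ?d)"
        using that(4) M0 by (intro mult_right_mono) (auto simp: I_def)
      finally show ?thesis
        using pint_diff[OF cc[of \<phi>, unfolded I_def] cc[of \<psi>, unfolded I_def]] that(4) by (simp add: I_def)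
    qed
    have "dist (apply_bcontfun (TT \<phi>) z) (apply_bcontfun (TT \<psi>) z) =
      norm ((pint (\<lambda>t. A t 0 *v apply_bcontfun \<phi> (t, 0)) x - pint (\<lambda>t. A t 0 *v apply_bcontfun \<psi> (t, 0)) x)
       + (pint (\<lambda>t. B x t *v apply_bcontfun \<phi> (x, t)) y - pint (\<lambda>t. B x t *v apply_bcontfun \<psi> (x, t)) y))"
      by (simp add: TT T_def G_def x_def y_def dist_norm algebra_simps)
    also have "\<dots> \<le> r * (M * ?d) + r * (M * ?d)"
      using x y I0 continuous_on_fst_slice[OF cA, of 0] continuous_on_snd_slice[OF cB, of x] bA bB
      by (intro norm_triangle_mono bd) (auto simp: I_def intro!: continuous_intros)
    also have "\<dots> = 2 * (r * M) * ?d" by simp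
    also have "\<dots> \<le> (1/2) * ?d" using r by (intro mult_right_mono) auto
    finally show "dist (apply_bcontfun (TT \<phi>) z) (apply_bcontfun (TT \<psi>) z) \<le> (1/2) * ?d" .
  qed
  then obtain \<phi> where \<phi>: "TT \<phi> = \<phi>"
    using banach_fix_type[of "1/2" TT] by auto
  show thesis
  proof (rule that[of "\<lambda>x y. apply_bcontfun \<phi> (x, y)"])
    show "continuous_on ({-r..r} \<times> {-r..r}) (\<lambda>(x, y). apply_bcontfun \<phi> (x, y))"
      by simp
    show "apply_bcontfun \<phi> (x, y) = s0 + pint (\<lambda>t. A t 0 *v apply_bcontfun \<phi> (t, 0)) x
       + pint (\<lambda>t. B x t *v apply_bcontfun \<phi> (x, t)) y" if "x \<in> {-r..r}" "y \<in> {-r..r}" for x y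
      using TT[of \<phi> "(x, y)"] that by (simp add: \<phi> T_def G_def c_id I_def)
  qed
qed

text \<open>Let \<open>w\<close> be obtained from the function \<open>s\<close> of the previous lemma by integrating \<open>A s\<close> along the
  lines parallel to the first axis. By flatness, \<open>e = s - w\<close> satisfies a linear integral equation
  without any derivative of \<open>s\<close>, so that \<open>e = 0\<close> on a small square. This avoids differentiating
  \<open>s\<close> with respect to a parameter.\<close>

lemma frobenius_square:
  fixes A B A' B' :: "real \<Rightarrow> real \<Rightarrow> real^'n::finite^'n" and s0 :: "real^'n"
  assumes r: "0 < r" "r \<le> 1" "4 * (r * M) \<le> 1"
    and cA: "continuous_on ({-r..r} \<times> {-r..r}) (\<lambda>(x, y). A x y)"
    and cB: "continuous_on ({-r..r} \<times> {-r..r}) (\<lambda>(x, y). B x y)"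
    and cA': "continuous_on ({-r..r} \<times> {-r..r}) (\<lambda>(x, y). A' x y)"
    and cB': "continuous_on ({-r..r} \<times> {-r..r}) (\<lambda>(x, y). B' x y)"
    and bA: "\<And>x y v. x \<in> {-r..r} \<Longrightarrow> y \<in> {-r..r} \<Longrightarrow> norm (A x y *v v) \<le> M * norm v"
    and bB: "\<And>x y v. x \<in> {-r..r} \<Longrightarrow> y \<in> {-r..r} \<Longrightarrow> norm (B x y *v v) \<le> M * norm v"
    and bB': "\<And>x y v. x \<in> {-r..r} \<Longrightarrow> y \<in> {-r..r} \<Longrightarrow> norm (B' x y *v v) \<le> M * norm v"
    and A': "\<And>x y. x \<in> {-r..r} \<Longrightarrow> y \<in> {-r..r} \<Longrightarrow> (A x has_vector_derivative A' x y) (at y within {-r..r})"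
    and B': "\<And>x y. x \<in> {-r..r} \<Longrightarrow> y \<in> {-r..r} \<Longrightarrow> ((\<lambda>x. B x y) has_vector_derivative B' x y) (at x within {-r..r})"
    and flat: "\<And>x y. x \<in> {-r..r} \<Longrightarrow> y \<in> {-r..r} \<Longrightarrow> A' x y + A x y ** B x y = B' x y + B x y ** A x y"
  obtains s where "continuous_on ({-r..r} \<times> {-r..r}) (\<lambda>(x, y). s x y)" "s 0 0 = s0"
    "\<And>x y. x \<in> {-r..r} \<Longrightarrow> y \<in> {-r..r} \<Longrightarrow>
      ((\<lambda>x. s x y) has_vector_derivative A x y *v s x y) (at x within {-r..r})"
    "\<And>x y. x \<in> {-r..r} \<Longrightarrow> y \<in> {-r..r} \<Longrightarrow>
      (s x has_vector_derivative B x y *v s x y) (at y within {-r..r})"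
proof -
  define I where "I = {-r..r}"
  obtain s where cs: "continuous_on (I \<times> I) (\<lambda>(x, y). s x y)"
    and s: "\<And>x y. x \<in> I \<Longrightarrow> y \<in> I \<Longrightarrow>
      s x y = s0 + pint (\<lambda>t. A t 0 *v s t 0) x + pint (\<lambda>t. B x t *v s x t) y"
    using picard_square[OF r(1,3) cA cB bA bB, of s0] unfolding I_def by blast
  note c = cA[folded I_def] cB[folded I_def] cA'[folded I_def] cB'[folded I_def] cs
  have I0: "0 \<in> I" using r by (simp add: I_def)
  note mvm = bounded_bilinear.has_vector_derivative[OF bounded_bilinear_matrix_vector_mult]
  have cAs: "continuous_on (I \<times> I) (\<lambda>(x, y). A x y *v s x y)"
    using c by (auto simp: split_beta intro!: continuous_on_matrix_vector_mult)
  have cBs: "continuous_on (I \<times> I) (\<lambda>(x, y). B x y *v s x y)"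
    using c by (auto simp: split_beta intro!: continuous_on_matrix_vector_mult)
  have sy: "(s x has_vector_derivative B x y *v s x y) (at y within I)" if "x \<in> I" "y \<in> I" for x y
  proof -
    have "((\<lambda>y. s0 + pint (\<lambda>t. A t 0 *v s t 0) x + pint (\<lambda>t. B x t *v s x t) y) has_vector_derivative B x y *v s x y)
      (at y within I)"
      using pint_has_vector_derivative[of r "\<lambda>t. B x t *v s x t" y] continuous_on_snd_slice[OF cBs that(1)] that
      by (auto intro!: derivative_eq_intros simp: I_def)
    then show ?thesis
      using that by (auto intro: has_vector_derivative_transform simp: s)
  qed
  define w where "w x y = s 0 y + pint (\<lambda>t. A t y *v s t y) x" for x y
  define e where "e x y = s x y - w x y" for x y
  have cw: "continuous_on (I \<times> I) (\<lambda>(x, y). w x y)"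
  proof -
    have "continuous_on (I \<times> I) (\<lambda>z. s 0 (snd z))"
      by (rule continuous_on_compose2[OF continuous_on_snd_slice[OF cs I0]]) (auto intro!: continuous_intros)
    then show ?thesis
      using pint_continuous_fst[OF cAs[unfolded I_def]]
      unfolding w_def split_beta I_def by (intro continuous_on_add)
  qed
  have ce: "continuous_on (I \<times> I) (\<lambda>(x, y). e x y)"
    using cw cs unfolding e_def split_beta by (intro continuous_on_diff)
  have wx: "((\<lambda>x. w x y) has_vector_derivative A x y *v s x y) (at x within I)" if "x \<in> I" "y \<in> I" for x y
    unfolding w_def
    using pint_has_vector_derivative[of r "\<lambda>t. A t y *v s t y" x] continuous_on_fst_slice[OF cAs that(2)] that
    by (auto intro!: derivative_eq_intros simp: I_def)
  have cB'e: "continuous_on (I \<times> I) (\<lambda>(x, y). B' x y *v e x y)"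
    using c ce by (auto simp: split_beta intro!: continuous_on_matrix_vector_mult)
  have cF: "continuous_on (I \<times> I) (\<lambda>(x, y). A x y *v (B x y *v s x y) + A' x y *v s x y)"
    using c by (auto simp: split_beta intro!: continuous_on_matrix_vector_mult continuous_intros)
  have cG: "continuous_on (I \<times> I) (\<lambda>(x, y). B x y *v (A x y *v s x y) + B' x y *v w x y)"
    using c cw by (auto simp: split_beta intro!: continuous_on_matrix_vector_mult continuous_intros)
  have ey: "(e x has_vector_derivative B x y *v e x y - pint (\<lambda>t. B' t y *v e t y) x) (at y within I)"
    if x: "x \<in> I" and y: "y \<in> I" for x y
  proof -
    have "((\<lambda>y. pint (\<lambda>t. A t y *v s t y) x) has_vector_derivative
        pint (\<lambda>t. A t y *v (B t y *v s t y) + A' t y *v s t y) x) (at y within I)"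
      unfolding I_def
      by (rule pint_leibniz[where F="\<lambda>t y. A t y *v s t y"])
        (use x y in \<open>auto intro!: mvm[OF A' sy[unfolded I_def]] cF[unfolded I_def]
           continuous_on_fst_slice[OF cAs[unfolded I_def]] simp: I_def\<close>)
    \<comment> \<open>Flatness exchanges A B s + A' s for B A s + B' s, and B' s is split as B' w +
      B' e. Since the x-derivative of \<open>w\<close> is A s, the part B A s + B' w is the
      x-derivative of B w and integrates to boundary terms; only B' e remains under the
      integral.\<close>
    moreover have "pint (\<lambda>t. A t y *v (B t y *v s t y) + A' t y *v s t y) x =
        pint (\<lambda>t. (B t y *v (A t y *v s t y) + B' t y *v w t y) + B' t y *v e t y) x"
    proof (rule pint_cong[of x r])
      fix t assume "t \<in> {-r..r}"
      then have "(A' t y + A t y ** B t y) *v s t y = (B' t y + B t y ** A t y) *v s t y"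
        using flat y by (simp add: I_def)
      then show "A t y *v (B t y *v s t y) + A' t y *v s t y
         = (B t y *v (A t y *v s t y) + B' t y *v w t y) + B' t y *v e t y"
        unfolding e_def
        by (simp add: matrix_vector_mult_add_rdistrib matrix_vector_mult_diff_distrib matrix_vector_mul_assoc algebra_simps)
    qed (use x in \<open>simp add: I_def\<close>)
    also have "\<dots> = pint (\<lambda>t. B t y *v (A t y *v s t y) + B' t y *v w t y) x + pint (\<lambda>t. B' t y *v e t y) x"
      using continuous_on_fst_slice[OF cG y] continuous_on_fst_slice[OF cB'e y] x
      unfolding I_def by (intro pint_add)
    also have "pint (\<lambda>t. B t y *v (A t y *v s t y) + B' t y *v w t y) x = B x y *v w x y - B 0 y *v w 0 y"
      by (rule pint_eq[where r=r and g="\<lambda>t. B t y *v w t y"])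
        (use x y in \<open>auto intro!: mvm[OF B' wx[unfolded I_def]] simp: I_def\<close>)
    finally have "((\<lambda>y. pint (\<lambda>t. A t y *v s t y) x) has_vector_derivative
        B x y *v w x y - B 0 y *v w 0 y + pint (\<lambda>t. B' t y *v e t y) x) (at y within I)" .
    from has_vector_derivative_diff[OF sy[OF x y] has_vector_derivative_add[OF sy[OF I0 y] this]]
    have "((\<lambda>y. s x y - (s 0 y + pint (\<lambda>t. A t y *v s t y) x)) has_vector_derivative
      (B x y *v s x y - (B 0 y *v s 0 y + (B x y *v w x y - B 0 y *v w 0 y + pint (\<lambda>t. B' t y *v e t y) x)))) (at y within I)" .
    moreover have "w 0 y = s 0 y" by (simp add: w_def pint_0)
    ultimately show ?thesis
      unfolding e_def[abs_def] w_def by (simp add: matrix_vector_mult_diff_distrib algebra_simps)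
  qed
  \<comment> \<open>On the first axis \<open>s\<close> and \<open>w\<close> are integrals of the
    same function from the same initial value.\<close>
  have e0: "e x 0 = 0" if "x \<in> I" for x
    using s[OF that I0] s[OF I0 I0] by (simp add: e_def w_def pint_0)
  \<comment> \<open>At a maximum point of |e| the integral equation bounds the maximum by half of
    itself.\<close>
  have "\<exists>z\<in>I \<times> I. \<forall>y\<in>I \<times> I. norm ((\<lambda>(x, y). e x y) y) \<le> norm ((\<lambda>(x, y). e x y) z)"
    using I0 by (intro continuous_attains_sup continuous_on_norm ce) (auto simp: I_def compact_Times)
  then obtain a b where ab: "a \<in> I" "b \<in> I" and E: "\<And>x y. x \<in> I \<Longrightarrow> y \<in> I \<Longrightarrow> norm (e x y) \<le> norm (e a b)"
    by auto
  have "norm (A 0 0 *v axis undefined 1) \<le> M * norm (axis undefined 1 :: real^'n)"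
    using bA I0 unfolding I_def by blast
  then have M0: "0 \<le> M" using order_trans[OF norm_ge_zero] by fastforce
  have "norm (e a b - e a 0) \<le> \<bar>b\<bar> * (M * norm (e a b) + M * norm (e a b))"
  proof (rule has_vector_derivative_bound[of r])
    fix y assume y: "y \<in> {-r..r}"
    show "(e a has_vector_derivative B a y *v e a y - pint (\<lambda>t. B' t y *v e t y) a) (at y within {- r..r})"
      using ey ab y by (simp add: I_def)
    have "norm (pint (\<lambda>t. B' t y *v e t y) a) \<le> \<bar>a\<bar> * (M * norm (e a b))"
    proof (rule norm_pint_le[of r])
      show "continuous_on {-r..r} (\<lambda>t. B' t y *v e t y)"
        using continuous_on_fst_slice[OF cB'e] y by (simp add: I_def)
      show "norm (B' t y *v e t y) \<le> M * norm (e a b)" if "t \<in> {-r..r}" for t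
        using order_trans[OF bB'[OF that y] mult_left_mono[OF E M0]] that y by (simp add: I_def)
    qed (use ab in \<open>simp add: I_def\<close>)
    \<comment> \<open>The bound r \<le> 1 absorbs the length of the inner integration; the outer one
      will supply the small factor \<open>r\<close>.\<close>
    also have "\<dots> \<le> 1 * (M * norm (e a b))"
      using ab r M0 by (intro mult_right_mono) (auto simp: I_def)
    finally have "norm (pint (\<lambda>t. B' t y *v e t y) a) \<le> M * norm (e a b)" by simp
    moreover have "norm (B a y *v e a y) \<le> M * norm (e a b)"
      using order_trans[OF bB mult_left_mono[OF E M0]] ab y by (simp add: I_def)
    ultimately show "norm (B a y *v e a y - pint (\<lambda>t. B' t y *v e t y) a) \<le> M * norm (e a b) + M * norm (e a b)"
      by (intro norm_triangle_le_diff add_mono)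
  qed (use ab in \<open>simp add: I_def\<close>)
  also have "\<dots> \<le> r * (M * norm (e a b) + M * norm (e a b))"
    using ab M0 by (intro mult_right_mono) (auto simp: I_def)
  also have "\<dots> = 2 * (r * M) * norm (e a b)" by (simp add: algebra_simps)
  also have "\<dots> \<le> (1/2) * norm (e a b)" using r by (intro mult_right_mono) auto
  finally have "e a b = 0" using e0[OF ab(1)] by simp
  then have sw: "s x y = w x y" if "x \<in> I" "y \<in> I" for x y
    using E[OF that] by (simp add: e_def)
  show thesis
  proof (rule that[of s])
    show "s 0 0 = s0" using s[OF I0 I0] by (simp add: pint_0)
    show "((\<lambda>x. s x y) has_vector_derivative A x y *v s x y) (at x within {-r..r})"
      if "x \<in> {-r..r}" "y \<in> {-r..r}" for x y
      using wx[of x y] that sw has_vector_derivative_transform[of x I "\<lambda>x. s x y" "\<lambda>x. w x y" "A x y *v s x y"]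
      by (simp add: I_def)
  qed (use cs sy in \<open>simp_all add: I_def\<close>)
qed

section \<open>Linear systems on open sets of the plane: uniqueness, regularity, existence\<close>

lemma has_derivative_vecI:
  fixes f :: "'a::real_normed_vector \<Rightarrow> 'b::euclidean_space^'n::finite"
  assumes "\<And>k. ((\<lambda>x. f x $ k) has_derivative (\<lambda>v. f' v $ k)) (at x within S)"
  shows "(f has_derivative f') (at x within S)"
  unfolding has_derivative_componentwise_within[of f]
  using assms[unfolded has_derivative_componentwise_within[of "\<lambda>x. f x $ _"]]
  by (auto simp: Basis_vec_def inner_axis)

lemma has_derivative_vec_partial:
  fixes s :: "real^2 \<Rightarrow> real^'n::finite"
  assumes "\<And>k. (\<lambda>x. s x $ k) differentiable (at x)"
    and "\<And>i k. partial i (\<lambda>x. s x $ k) x = D i $ k"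
  shows "(s has_derivative (\<lambda>v. v$1 *\<^sub>R D 1 + v$2 *\<^sub>R D 2)) (at x)"
  using has_derivative_partial[OF assms(1)] by (intro has_derivative_vecI) (simp add: assms(2))

lemma continuous_on_componentwise_vec:
  fixes f :: "'a::topological_space \<Rightarrow> 'b::topological_space^'n::finite"
  assumes "\<And>k. continuous_on S (\<lambda>x. f x $ k)"
  shows "continuous_on S f"
proof -
  have "continuous_on S (\<lambda>x. \<chi> k. f x $ k)"
    by (intro continuous_on_vec_lambda assms)
  then show ?thesis by simp
qed

lemma continuous_on_componentwise_mat:
  fixes f :: "'a::topological_space \<Rightarrow> real^'n::finite^'m::finite"
  assumes "\<And>j k. continuous_on S (\<lambda>x. f x $ j $ k)"
  shows "continuous_on S f"
  using assms by (intro continuous_on_componentwise_vec)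

lemma bounded_matrix_action:
  fixes P :: "'a::topological_space \<Rightarrow> real^'n::finite^'m::finite"
  assumes "compact S" "continuous_on S P"
  obtains M where "M \<ge> 0" "\<And>x v. x \<in> S \<Longrightarrow> norm (P x *v v) \<le> M * norm v"
proof -
  obtain B where B: "B > 0" "\<And>(A :: real^'n^'m) v. norm (A *v v) \<le> norm A * norm v * B"
    using bounded_bilinear.pos_bounded[OF bounded_bilinear_matrix_vector_mult] by blast
  obtain N where N: "N > 0" "\<And>x. x \<in> S \<Longrightarrow> norm (P x) \<le> N"
    using compact_imp_bounded[OF compact_continuous_image[OF assms(2,1)]] unfolding bounded_pos by auto
  show thesis
  proof (rule that[of "N * B"])
    show "norm (P x *v v) \<le> N * B * norm v" if "x \<in> S" for x v
    proof -
      have "norm (P x) * norm v * B \<le> N * norm v * B"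
        using N(2)[OF that] B(1) by (intro mult_right_mono) auto
      then show ?thesis using B(2)[of "P x" v] by (simp add: mult_ac)
    qed
  qed (use B N in simp)
qed

text \<open>On a small ball the mean value inequality bounds the maximum of |s| by half of itself,
  because \<open>s\<close> vanishes at the centre.\<close>

lemma linear_system_unique:
  fixes s :: "real^2 \<Rightarrow> real^'n::finite" and P :: "2 \<Rightarrow> real^2 \<Rightarrow> real^'n^'n"
  assumes V: "open V" "q \<in> V" and cP: "\<And>i. continuous_on V (P i)"
    and d: "\<And>x k. x \<in> V \<Longrightarrow> (\<lambda>x. s x $ k) differentiable (at x)"
    and p: "\<And>x i k. x \<in> V \<Longrightarrow> partial i (\<lambda>x. s x $ k) x = (P i x *v s x) $ k"
    and s0: "s q = 0"
  shows "\<forall>\<^sub>F x in nhds q. s x = 0"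
proof -
  obtain R where R: "R > 0" "cball q R \<subseteq> V" using V open_contains_cball by blast
  note cPR = continuous_on_subset[OF cP R(2)]
  obtain M1 where M1: "M1 \<ge> 0" "\<And>x v. x \<in> cball q R \<Longrightarrow> norm (P 1 x *v v) \<le> M1 * norm v"
    using bounded_matrix_action[OF compact_cball cPR[of 1]] by blast
  obtain M2 where M2: "M2 \<ge> 0" "\<And>x v. x \<in> cball q R \<Longrightarrow> norm (P 2 x *v v) \<le> M2 * norm v"
    using bounded_matrix_action[OF compact_cball cPR[of 2]] by blast
  note M = M1(1) M2(1) M1(2) M2(2)
  define C where "C = M1 + M2"
  have C: "C \<ge> 0" using M by (simp add: C_def)
  \<comment> \<open>Gives r C \<le> 1/2; the summand 1 keeps the quotient meaningful for C =
    0.\<close>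
  define r where "r = min R (1 / (2 * C + 1))"
  have r: "r > 0" "r \<le> R" "2 * (r * C) \<le> 1"
  proof -
    have "r * (2 * C + 1) \<le> 1 / (2 * C + 1) * (2 * C + 1)"
      using C by (intro mult_right_mono) (auto simp: r_def)
    then have a: "r * (2 * C + 1) \<le> 1" using C by (auto split: if_splits)
    show "r > 0" using R C by (auto simp: r_def)
    with a show "2 * (r * C) \<le> 1" by (simp add: algebra_simps)
  qed (simp add: r_def)
  have rV: "cball q r \<subseteq> V" and rR: "x \<in> cball q r \<Longrightarrow> x \<in> cball q R" for x using r R by auto
  have D: "(s has_derivative (\<lambda>v. v$1 *\<^sub>R (P 1 x *v s x) + v$2 *\<^sub>R (P 2 x *v s x))) (at x)" if "x \<in> V" for x
    using has_derivative_vec_partial[of s x "\<lambda>i. P i x *v s x"] d p that by blast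
  have "continuous_on (cball q r) s"
    using D rV by (meson continuous_at_imp_continuous_on has_derivative_continuous subsetD)
  then have "\<exists>z\<in>cball q r. \<forall>y\<in>cball q r. norm (s y) \<le> norm (s z)"
    using r by (intro continuous_attains_sup continuous_on_norm) auto
  then obtain z where z: "z \<in> cball q r" "\<And>y. y \<in> cball q r \<Longrightarrow> norm (s y) \<le> norm (s z)" by blast
  have "norm (s z - s q) \<le> (C * norm (s z)) * norm (z - q)"
  proof (rule differentiable_bound)
    show "convex (cball q r)" by simp
    show "(s has_derivative (\<lambda>v. v$1 *\<^sub>R (P 1 x *v s x) + v$2 *\<^sub>R (P 2 x *v s x))) (at x within cball q r)"
      if "x \<in> cball q r" for x
      using D rV that has_derivative_at_withinI by blast
    show "onorm (\<lambda>v::real^2. v$1 *\<^sub>R (P 1 x *v s x) + v$2 *\<^sub>R (P 2 x *v s x)) \<le> C * norm (s z)"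
      if x: "x \<in> cball q r" for x
    proof (rule onorm_le)
      have le: "norm (v$i *\<^sub>R (P i x *v s x)) \<le> norm v * (K * norm (s z))"
        if "K \<ge> 0" "norm (P i x *v s x) \<le> K * norm (s x)" for i K and v :: "real^2"
        unfolding norm_scaleR
        using that component_le_norm_cart[of v i] order_trans[OF that(2) mult_left_mono[OF z(2)[OF x] that(1)]]
        by (intro mult_mono) auto
      fix v :: "real^2"
      have "norm (v$1 *\<^sub>R (P 1 x *v s x) + v$2 *\<^sub>R (P 2 x *v s x)) \<le> norm v * (M1 * norm (s z)) + norm v * (M2 * norm (s z))"
        by (intro norm_triangle_mono le M rR x)
      then show "norm (v$1 *\<^sub>R (P 1 x *v s x) + v$2 *\<^sub>R (P 2 x *v s x)) \<le> C * norm (s z) * norm v"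
        by (simp add: C_def algebra_simps)
    qed
  qed (use z r in auto)
  also have "\<dots> \<le> (C * norm (s z)) * r"
    using z(1) C by (intro mult_left_mono) (auto simp: dist_norm norm_minus_commute)
  also have "\<dots> = (r * C) * norm (s z)" by simp
  also have "\<dots> \<le> (1/2) * norm (s z)" using r by (intro mult_right_mono) auto
  finally have "norm (s z) \<le> 0" using s0 by simp
  then have "s x = 0" if "x \<in> ball q r" for x
    using z(2)[of x] that by (simp add: order_trans)
  then show ?thesis
    using r(1) by (intro eventually_nhds_in_open[of "ball q r", THEN eventually_mono]) auto
qed

text \<open>Bootstrapping: the derivative of \<open>s\<close> is a polynomial in \<open>s\<close>
  and the smooth coefficients, so each order of smoothness yields the next.\<close>

lemma linear_system_smooth:
  fixes s :: "real^2 \<Rightarrow> real^'n::finite" and P :: "2 \<Rightarrow> real^2 \<Rightarrow> real^'n^'n"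
  assumes V: "open V" and sP: "\<And>i j k. smooth_on V (\<lambda>x. P i x $ j $ k)"
    and D: "\<And>x. x \<in> V \<Longrightarrow> (s has_derivative (\<lambda>v. v$1 *\<^sub>R (P 1 x *v s x) + v$2 *\<^sub>R (P 2 x *v s x))) (at x)"
  shows "smooth_on V (\<lambda>x. s x $ k)"
proof -
  have Dk: "((\<lambda>x. s x $ k) has_derivative (\<lambda>v. (v$1 *\<^sub>R (P 1 x *v s x) + v$2 *\<^sub>R (P 2 x *v s x)) $ k)) (at x)"
    if "x \<in> V" for x k
    using bounded_linear.has_derivative[OF bounded_linear_vec_nth D[OF that]] .
  have "\<forall>k. Ck_on m (\<lambda>x. s x $ k) V" for m
  proof (induction m)
    case 0
    then show ?case using Dk by (auto intro!: continuous_at_imp_continuous_on has_derivative_continuous)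
  next
    case (Suc m)
    have sum: "Ck_on m (\<lambda>x. \<Sum>j\<in>J. P i x $ k $ j * s x $ j) V" for i k and J :: "'n set"
      by (induction J rule: infinite_finite_induct)
        (use Suc sP in \<open>auto intro!: Ck_on_add[OF V] Ck_on_mult[OF V] Ck_on_const simp: smooth_on_def\<close>)
    have "Ck_on m (\<lambda>x. (v$1 *\<^sub>R (P 1 x *v s x) + v$2 *\<^sub>R (P 2 x *v s x)) $ k) V" for v k
      unfolding matrix_vector_mult_def
      by (auto intro!: Ck_on_add[OF V] Ck_on_mult[OF V] Ck_on_const sum)
    then show ?case using Dk by (auto intro!: Ck_on_SucI[OF V] simp del: Ck_on.simps)
  qed
  then show ?thesis by (simp add: smooth_on_def)
qed

text \<open>\<open>flat\<close> is what equality of the mixed derivatives of solutions demands when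
  every initial value is to be attained. The solution on a square around \<open>q\<close> comes with
  derivatives along the axes only, which still have to be assembled into a total derivative.\<close>

lemma frobenius:
  fixes P :: "2 \<Rightarrow> real^2 \<Rightarrow> real^'n::finite^'n" and s0 :: "real^'n"
  assumes W: "open W" "q \<in> W" and sP: "\<And>i j k. smooth_on W (\<lambda>x. P i x $ j $ k)"
    and flat: "\<And>x j k. x \<in> W \<Longrightarrow> partial 2 (\<lambda>x. P 1 x $ j $ k) x + (P 1 x ** P 2 x) $ j $ k
       = partial 1 (\<lambda>x. P 2 x $ j $ k) x + (P 2 x ** P 1 x) $ j $ k"
  obtains V s where "open V" "q \<in> V" "V \<subseteq> W" "s q = s0" "\<And>k. smooth_on V (\<lambda>x. s x $ k)"
    "\<And>x i k. x \<in> V \<Longrightarrow> partial i (\<lambda>x. s x $ k) x = (P i x *v s x) $ k"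
proof -
  obtain R where R: "R > 0" "cball q R \<subseteq> W" using W open_contains_cball by blast
  define dP where "dP i j x = (\<chi> k l. partial i (\<lambda>x. P j x $ k $ l) x)" for i j x
  have cP: "continuous_on W (P i)" for i
    using smooth_on_continuous[OF sP] by (rule continuous_on_componentwise_mat)
  have cdP: "continuous_on W (dP i j)" for i j
    unfolding dP_def using smooth_on_continuous[OF smooth_on_partial[OF sP]]
    by (intro continuous_on_componentwise_mat) simp
  note cPR = continuous_on_subset[OF cP R(2)]
  obtain M1 where M1: "M1 \<ge> 0" "\<And>x v. x \<in> cball q R \<Longrightarrow> norm (P 1 x *v v) \<le> M1 * norm v"
    using bounded_matrix_action[OF compact_cball cPR[of 1]] by blast
  obtain M2 where M2: "M2 \<ge> 0" "\<And>x v. x \<in> cball q R \<Longrightarrow> norm (P 2 x *v v) \<le> M2 * norm v"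
    using bounded_matrix_action[OF compact_cball cPR[of 2]] by blast
  obtain M3 where M3: "M3 \<ge> 0" "\<And>x v. x \<in> cball q R \<Longrightarrow> norm (dP 1 2 x *v v) \<le> M3 * norm v"
    using bounded_matrix_action[OF compact_cball continuous_on_subset[OF cdP[of 1 2] R(2)]] by blast
  note M = M1(1) M2(1) M3(1) M1(2) M2(2) M3(2)
  define M where "M = M1 + M2 + M3"
  have Mb: "norm u \<le> M * norm v" if "norm u \<le> N * norm v" "N \<in> {M1, M2, M3}" for u v :: "real^'n" and N
  proof -
    have "N * norm v \<le> M * norm v" using that(2) M(1-3) by (intro mult_right_mono) (auto simp: M_def)
    then show ?thesis using that(1) by simp
  qed
  have M0: "M \<ge> 0" using M by (simp add: M_def)
  \<comment> \<open>R/2 keeps the square inside the ball, as its points are at distance at most 2r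
    from \<open>q\<close>; the other two entries are the size conditions of
    \<open>frobenius_square\<close>.\<close>
  define r where "r = Min {1, R / 2, 1 / (4 * M + 1)}"
  have r: "r > 0" "r \<le> 1" "2 * r \<le> R" "4 * (r * M) \<le> 1"
  proof -
    show "r > 0" "r \<le> 1" "2 * r \<le> R" using R M0 by (auto simp: r_def)
    have "r * (4 * M + 1) \<le> 1 / (4 * M + 1) * (4 * M + 1)"
      using M0 by (intro mult_right_mono) (auto simp: r_def)
    then have "r * (4 * M + 1) \<le> 1" using M0 by (auto split: if_splits)
    then show "4 * (r * M) \<le> 1" using \<open>r > 0\<close> by (simp add: algebra_simps)
  qed
  define z :: "real \<Rightarrow> real \<Rightarrow> real^2" where "z x y = q + x *\<^sub>R axis 1 1 + y *\<^sub>R axis 2 1" for x y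
  have zR: "z x y \<in> cball q R" if "x \<in> {-r..r}" "y \<in> {-r..r}" for x y
  proof -
    have "dist q (z x y) = norm (x *\<^sub>R axis 1 1 + y *\<^sub>R axis 2 1 :: real^2)"
      unfolding z_def by (metis add.assoc add_diff_cancel_left' dist_commute dist_norm)
    also have "\<dots> \<le> norm (x *\<^sub>R axis 1 1 :: real^2) + norm (y *\<^sub>R axis 2 1 :: real^2)"
      by (rule norm_triangle_ineq)
    finally show ?thesis using that r by auto
  qed
  then have zW: "z x y \<in> W" if "x \<in> {-r..r}" "y \<in> {-r..r}" for x y
    using that R by blast
  have cz: "continuous_on ({-r..r} \<times> {-r..r}) (\<lambda>(x, y). F (z x y))" if "continuous_on W F" for F :: "_ \<Rightarrow> real^'n^'n"
    unfolding split_beta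
    by (rule continuous_on_compose2[OF that]) (use zW in \<open>auto simp: z_def intro!: continuous_intros\<close>)
  have DP: "(P j has_derivative (\<lambda>v. v$1 *\<^sub>R dP 1 j x + v$2 *\<^sub>R dP 2 j x)) (at x)" if "x \<in> W" for j x
    using has_derivative_partial[OF smooth_on_differentiable[OF sP that]]
    by (intro has_derivative_vecI) (simp add: dP_def)
  have dPx: "((\<lambda>x. P j (z x y)) has_vector_derivative dP 1 j (z x y)) (at x within I)"
    and dPy: "((\<lambda>y. P j (z x y)) has_vector_derivative dP 2 j (z x y)) (at y within I)"
    if "x \<in> {-r..r}" "y \<in> {-r..r}" for j x y I
  proof -
    have "((\<lambda>x. z x y) has_derivative (\<lambda>t. t *\<^sub>R axis 1 1)) (at x within I)"
      "((\<lambda>y. z x y) has_derivative (\<lambda>t. t *\<^sub>R axis 2 1)) (at y within I)"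
      unfolding z_def by (auto intro!: derivative_eq_intros)
    note this[THEN has_derivative_compose, OF DP[OF zW[OF that]]]
    then show "((\<lambda>x. P j (z x y)) has_vector_derivative dP 1 j (z x y)) (at x within I)"
      "((\<lambda>y. P j (z x y)) has_vector_derivative dP 2 j (z x y)) (at y within I)"
      by (simp_all add: has_vector_derivative_def axis_def)
  qed
  obtain s where s: "continuous_on ({-r..r} \<times> {-r..r}) (\<lambda>(x, y). s x y)" "s 0 0 = s0"
    "\<And>x y. x \<in> {-r..r} \<Longrightarrow> y \<in> {-r..r} \<Longrightarrow>
      ((\<lambda>x. s x y) has_vector_derivative P 1 (z x y) *v s x y) (at x within {-r..r})"
    "\<And>x y. x \<in> {-r..r} \<Longrightarrow> y \<in> {-r..r} \<Longrightarrow>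
      (s x has_vector_derivative P 2 (z x y) *v s x y) (at y within {-r..r})"
  proof (rule frobenius_square[of r M "\<lambda>x y. P 1 (z x y)" "\<lambda>x y. P 2 (z x y)" "\<lambda>x y. dP 2 1 (z x y)" "\<lambda>x y. dP 1 2 (z x y)" s0])
    show "dP 2 1 (z x y) + P 1 (z x y) ** P 2 (z x y) = dP 1 2 (z x y) + P 2 (z x y) ** P 1 (z x y)"
      if "x \<in> {-r..r}" "y \<in> {-r..r}" for x y
      using flat[OF zW[OF that]] by (simp add: vec_eq_iff dP_def)
  qed (use r cz cP cdP dPx dPy Mb[OF M(4)] Mb[OF M(5)] Mb[OF M(6)] zR in auto)
  let ?J = "{-r<..<r}"
  define V where "V = {p. (p - q)$1 \<in> ?J \<and> (p - q)$2 \<in> ?J}"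
  define S where "S p = s ((p - q)$1) ((p - q)$2)" for p
  have zV: "z ((p - q)$1) ((p - q)$2) = p" for p
    by (simp add: z_def vec_eq_iff forall_2 axis_def)
  have "V = (\<lambda>p. ((p - q)$1, (p - q)$2)) -` (?J \<times> ?J)" by (auto simp: V_def)
  then have oV: "open V" by (auto intro!: open_vimage open_Times continuous_intros)
  have VW: "V \<subseteq> W" using zW[of "(p - q)$1" "(p - q)$2" for p] zV by (force simp: V_def)
  have DS: "(S has_derivative (\<lambda>v. v$1 *\<^sub>R (P 1 p *v S p) + v$2 *\<^sub>R (P 2 p *v S p))) (at p)" if p: "p \<in> V" for p
  proof -
    let ?x = "(p - q)$1" and ?y = "(p - q)$2"
    have J: "?x \<in> ?J" "?y \<in> ?J" using p by (auto simp: V_def)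
    have JI: "?J \<subseteq> {-r..r}" by auto
    have "((\<lambda>(x, y). s x y) has_derivative
        (\<lambda>(tx, ty). tx *\<^sub>R (P 1 (z ?x ?y) *v s ?x ?y) + blinfun_apply (blinfun_scaleR_left (P 2 (z ?x ?y) *v s ?x ?y)) ty))
        (at (?x, ?y) within ?J \<times> ?J)"
    \<comment> \<open>Total differentiability from one partial derivative at the point and a second
      one that exists nearby and is continuous.\<close>
    proof (rule has_derivative_partialsI[where fy="\<lambda>x y. blinfun_scaleR_left (P 2 (z x y) *v s x y)"])
      show "((\<lambda>x. s x ?y) has_derivative (\<lambda>tx. tx *\<^sub>R (P 1 (z ?x ?y) *v s ?x ?y))) (at ?x within ?J)"
        using s(3)[of ?x ?y] J JI has_derivative_subset[OF _ JI] by (auto simp: has_vector_derivative_def)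
      show "(s x has_derivative blinfun_apply (blinfun_scaleR_left (P 2 (z x y) *v s x y))) (at y within ?J)"
        if "x \<in> ?J" "y \<in> ?J" for x y
        using s(4)[of x y] that JI has_derivative_subset[OF _ JI] by (auto simp: has_vector_derivative_def)
      have "continuous_on (?J \<times> ?J) (\<lambda>(x, y). blinfun_scaleR_left (P 2 (z x y) *v s x y))"
        using continuous_on_subset[OF cz[OF cP[of 2]] Sigma_mono[OF JI JI]] continuous_on_subset[OF s(1) Sigma_mono[OF JI JI]]
        by (auto simp: split_beta intro!: continuous_intros continuous_on_matrix_vector_mult)
      then show "continuous (at (?x, ?y) within ?J \<times> ?J) (\<lambda>(x, y). blinfun_scaleR_left (P 2 (z x y) *v s x y))"
        using J by (simp add: continuous_on_eq_continuous_within del: split_paired_All)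
    qed (use J in auto)
    moreover have "at (?x, ?y) within ?J \<times> ?J = at (?x, ?y)"
      by (rule at_within_open) (use J in \<open>auto intro!: open_Times\<close>)
    ultimately have "((\<lambda>(x, y). s x y) has_derivative
        (\<lambda>(tx, ty). tx *\<^sub>R (P 1 p *v S p) + ty *\<^sub>R (P 2 p *v S p))) (at (?x, ?y))"
      by (simp only: zV S_def blinfun_scaleR_left.rep_eq)
    moreover have "((\<lambda>p. ((p - q)$1, (p - q)$2)) has_derivative (\<lambda>v. (v$1, v$2))) (at p)"
      by (auto intro!: derivative_eq_intros bounded_linear.has_derivative[OF bounded_linear_vec_nth])
    ultimately have "((\<lambda>p. (\<lambda>(x, y). s x y) ((p - q)$1, (p - q)$2)) has_derivative
        (\<lambda>v. (\<lambda>(tx, ty). tx *\<^sub>R (P 1 p *v S p) + ty *\<^sub>R (P 2 p *v S p)) (v$1, v$2))) (at p)"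
      by (rule has_derivative_compose[rotated])
    then show ?thesis by (simp add: S_def[abs_def])
  qed
  show thesis
  proof (rule that[OF oV _ VW, of S])
    show "q \<in> V" using r by (simp add: V_def)
    show "S q = s0" using s(2) by (simp add: S_def)
    show "smooth_on V (\<lambda>x. S x $ k)" for k
      using linear_system_smooth[OF oV smooth_on_subset[OF sP VW] DS] by blast
    show "partial i (\<lambda>x. S x $ k) x = (P i x *v S x) $ k" if "x \<in> V" for x i k
      using partial_eqI[OF bounded_linear.has_derivative[OF bounded_linear_vec_nth DS[OF that]]] exhaust_2[of i]
      by (auto simp: axis_def)
  qed
qed

section \<open>Levi-Civita connection and curvature in a chart\<close>

text \<open>The integrability condition of df = (u, v). Applied to the metric, to a Killing field,
  to \<open>w\<close> and to \<sigma>, it produces the curvature identities, the prolonged system,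
  the condition dK(X) = 0 and the constancy of \<mu> along level curves.\<close>

lemma partial_commute_eq:
  assumes "open S" "smooth_on S f" "\<And>y. y \<in> S \<Longrightarrow> partial 1 f y = u y" "\<And>y. y \<in> S \<Longrightarrow> partial 2 f y = v y"
    "x \<in> S"
  shows "partial 2 u x = partial 1 v x"
proof -
  note d = smooth_on_differentiable[OF smooth_on_partial[OF assms(2)] assms(5)]
  have "partial 2 u x = partial 2 (partial 1 f) x"
    by (rule partial_cong[OF assms(1,5) _ d, symmetric]) (rule assms(3))
  also have "\<dots> = partial 1 (partial 2 f) x"
    by (rule partial_commute[OF assms(1,2,5)])
  also have "\<dots> = partial 1 v x"
    by (rule partial_cong[OF assms(1,5) _ d]) (rule assms(4))
  finally show ?thesis .
qed

text \<open>Positive definiteness enters in the form of Sylvester's criterion.\<close>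

locale metric_chart =
  fixes W :: "(real^2) set" and h :: "real^2 \<Rightarrow> real^2^2"
  assumes open_W: "open W"
    and smooth_h: "smooth_on W (\<lambda>x. h x $ i $ j)"
    and sym_h: "x \<in> W \<Longrightarrow> h x $ 2 $ 1 = h x $ 1 $ 2"
    and h11_pos: "x \<in> W \<Longrightarrow> h x $ 1 $ 1 > 0"
    and det_pos: "x \<in> W \<Longrightarrow> det (h x) > 0"
begin

definition "a x = h x $ 1 $ 1"
definition "b x = h x $ 1 $ 2"
definition "c x = h x $ 2 $ 2"
definition "d x = a x * c x - b x * b x"
abbreviation "\<Gamma> \<equiv> christoffel h"
abbreviation "K \<equiv> gauss_curvature h"
abbreviation "R l k \<equiv> riemann h l k 1 2"
text \<open>The trace of the connection form, which is the differential of ln sqrt(det h); see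
  \<open>partial_d\<close>. It corrects for all quantities that are not normalized.\<close>

definition "t i x = \<Gamma> 1 i 1 x + \<Gamma> 2 i 2 x"

lemma det_h: "x \<in> W \<Longrightarrow> det (h x) = d x"
  by (simp add: det_2 d_def a_def b_def c_def sym_h)

lemma d_pos: "x \<in> W \<Longrightarrow> d x > 0"
  using det_h det_pos by metis

lemma a_pos: "x \<in> W \<Longrightarrow> a x > 0"
  using h11_pos by (simp add: a_def)

lemma matrix_inv_h:
  assumes "x \<in> W"
  shows "matrix_inv (h x) $ 1 $ 1 = c x / d x" "matrix_inv (h x) $ 1 $ 2 = - b x / d x"
    "matrix_inv (h x) $ 2 $ 1 = - b x / d x" "matrix_inv (h x) $ 2 $ 2 = a x / d x"
proof -
  define G :: "real^2^2" where "G = vector [vector [c x / d x, - b x / d x], vector [- b x / d x, a x / d x]]"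
  have "h x ** G = mat 1"
    using d_pos[OF assms] sym_h[OF assms]
    by (simp add: vec_eq_iff forall_2 matrix_matrix_mult_def sum_2 G_def mat_def divide_simps
        flip: a_def b_def c_def) (simp add: d_def)
  moreover from this have "G ** h x = mat 1" by (rule matrix_left_right_inverse[THEN iffD1])
  ultimately have inv: "matrix_inv (h x) ** h x = mat 1"
    unfolding matrix_inv_def using someI[of "\<lambda>A. h x ** A = mat 1 \<and> A ** h x = mat 1" G] by blast
  have "matrix_inv (h x) = matrix_inv (h x) ** (h x ** G)"
    by (simp only: \<open>h x ** G = mat 1\<close> matrix_mul_rid)
  also have "\<dots> = G"
    by (simp only: matrix_mul_assoc inv matrix_mul_lid)
  finally have "matrix_inv (h x) = G" .
  then show "matrix_inv (h x) $ 1 $ 1 = c x / d x" "matrix_inv (h x) $ 1 $ 2 = - b x / d x"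
    "matrix_inv (h x) $ 2 $ 1 = - b x / d x" "matrix_inv (h x) $ 2 $ 2 = a x / d x"
    by (simp_all add: G_def)
qed

lemma smooth_abcd [simp]: "smooth_on W a" "smooth_on W b" "smooth_on W c" "smooth_on W d"
proof -
  show "smooth_on W a" "smooth_on W b" "smooth_on W c"
    using smooth_h by (simp_all add: a_def[abs_def] b_def[abs_def] c_def[abs_def])
  then show "smooth_on W d"
    unfolding d_def[abs_def] by (intro smooth_on_diff smooth_on_mult open_W)
qed

lemma smooth_inv: "smooth_on W (\<lambda>x. matrix_inv (h x) $ i $ j)"
proof -
  have "smooth_on W (\<lambda>x. c x / d x)" "smooth_on W (\<lambda>x. - b x / d x)" "smooth_on W (\<lambda>x. a x / d x)"
    using d_pos by (auto intro!: smooth_on_divide smooth_on_minus open_W simp: less_imp_neq[symmetric])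
  then show ?thesis
    using exhaust_2[of i] exhaust_2[of j] matrix_inv_h
    by (auto intro: smooth_on_cong[OF open_W])
qed

lemma smooth_christoffel [simp]: "smooth_on W (\<Gamma> k i j)"
  unfolding christoffel_def[abs_def]
  by (intro smooth_on_divide smooth_on_sum smooth_on_mult smooth_on_add smooth_on_diff smooth_on_partial
      smooth_on_const open_W smooth_inv smooth_h) simp

lemma smooth_riemann [simp]: "smooth_on W (riemann h l k i j)"
  unfolding riemann_def[abs_def]
  by (intro smooth_on_sum smooth_on_mult smooth_on_add smooth_on_diff smooth_on_partial
      open_W smooth_christoffel)

lemma smooth_K [simp]: "smooth_on W K"
  unfolding gauss_curvature_def[abs_def]
  using det_pos by (intro smooth_on_divide smooth_on_sum smooth_on_mult smooth_h smooth_riemann open_W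
    smooth_on_cong[OF open_W smooth_abcd(4) det_h[symmetric]]) (auto simp: less_imp_neq[symmetric])

lemma smooth_t [simp]: "smooth_on W (t i)"
  unfolding t_def[abs_def] by (intro smooth_on_add open_W smooth_christoffel)

lemma diff_W: "smooth_on W f \<Longrightarrow> x \<in> W \<Longrightarrow> f differentiable (at x)"
  by (rule smooth_on_differentiable)

lemmas pd = partial_add partial_mult partial_diff partial_minus partial_const
  differentiable_add differentiable_mult differentiable_diff differentiable_minus differentiable_const
  diff_W smooth_on_partial

lemma christoffel_sym: "x \<in> W \<Longrightarrow> \<Gamma> k i j x = \<Gamma> k j i x"
proof -
  assume x: "x \<in> W"
  have "partial l (\<lambda>y. h y $ i $ j) x = partial l (\<lambda>y. h y $ j $ i) x" for l
    using exhaust_2[of i] exhaust_2[of j] sym_h smooth_on_differentiable[OF smooth_h x]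
    by (auto intro!: partial_cong[OF open_W x])
  then show ?thesis by (simp add: christoffel_def algebra_simps)
qed

lemma christoffel_21: "x \<in> W \<Longrightarrow> \<Gamma> k 2 1 x = \<Gamma> k 1 2 x"
  by (rule christoffel_sym)

text \<open>The metric is parallel. Lowering the upper index cancels the inverse metric in the
  Christoffel symbols, and in the sum of two lowered symbols all but one derivative of the metric
  drop out.\<close>

lemma metric_compat:
  assumes "x \<in> W"
  shows "partial i a x = 2 * (a x * \<Gamma> 1 i 1 x + b x * \<Gamma> 2 i 1 x)"
    and "partial i b x = a x * \<Gamma> 1 i 2 x + b x * \<Gamma> 2 i 2 x + b x * \<Gamma> 1 i 1 x + c x * \<Gamma> 2 i 1 x"
    and "partial i c x = 2 * (b x * \<Gamma> 1 i 2 x + c x * \<Gamma> 2 i 2 x)"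
proof -
  have p: "partial l (\<lambda>y. h y $ 1 $ 1) x = partial l a x" "partial l (\<lambda>y. h y $ 1 $ 2) x = partial l b x"
    "partial l (\<lambda>y. h y $ 2 $ 2) x = partial l c x" for l
    by (simp_all add: a_def[abs_def] b_def[abs_def] c_def[abs_def])
  have p21: "partial l (\<lambda>y. h y $ 2 $ 1) x = partial l b x" for l
    using sym_h smooth_on_differentiable[OF smooth_h assms]
    by (auto intro!: partial_cong[OF open_W assms] simp: b_def)
  have lower: "a x * \<Gamma> 1 i j x + b x * \<Gamma> 2 i j x = (partial i (\<lambda>y. h y $ j $ 1) x + partial j (\<lambda>y. h y $ i $ 1) x - partial 1 (\<lambda>y. h y $ i $ j) x) / 2"
    "b x * \<Gamma> 1 i j x + c x * \<Gamma> 2 i j x = (partial i (\<lambda>y. h y $ j $ 2) x + partial j (\<lambda>y. h y $ i $ 2) x - partial 2 (\<lambda>y. h y $ i $ j) x) / 2"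
    for i j
  proof -
    have d: "a x * c x - b x * b x \<noteq> 0" using d_pos[OF assms] by (simp add: d_def)
    have s: "a x * (c x / d x * u + - b x / d x * v) / 2 + b x * (- b x / d x * u + a x / d x * v) / 2 = u / 2"
      "b x * (c x / d x * u + - b x / d x * v) / 2 + c x * (- b x / d x * u + a x / d x * v) / 2 = v / 2" for u v
      using d unfolding d_def by (simp_all add: divide_simps) algebra+
    show "a x * \<Gamma> 1 i j x + b x * \<Gamma> 2 i j x = (partial i (\<lambda>y. h y $ j $ 1) x + partial j (\<lambda>y. h y $ i $ 1) x - partial 1 (\<lambda>y. h y $ i $ j) x) / 2"
    "b x * \<Gamma> 1 i j x + c x * \<Gamma> 2 i j x = (partial i (\<lambda>y. h y $ j $ 2) x + partial j (\<lambda>y. h y $ i $ 2) x - partial 2 (\<lambda>y. h y $ i $ j) x) / 2"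
      unfolding christoffel_def sum_2 matrix_inv_h[OF assms] times_divide_eq_right by (fact s)+
  qed
  show "partial i a x = 2 * (a x * \<Gamma> 1 i 1 x + b x * \<Gamma> 2 i 1 x)"
    "partial i b x = a x * \<Gamma> 1 i 2 x + b x * \<Gamma> 2 i 2 x + b x * \<Gamma> 1 i 1 x + c x * \<Gamma> 2 i 1 x"
    "partial i c x = 2 * (b x * \<Gamma> 1 i 2 x + c x * \<Gamma> 2 i 2 x)"
    using lower[of i 1] lower[of i 2] exhaust_2[of i] by (auto simp: p p21 field_simps)
qed

lemma partial_d: "x \<in> W \<Longrightarrow> partial i d x = 2 * t i x * d x"
  unfolding d_def[abs_def] t_def by (simp add: pd metric_compat) algebra

lemma R_expand:
  "R l k x = partial 1 (\<Gamma> l 2 k) x - partial 2 (\<Gamma> l 1 k) x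
    + (\<Gamma> l 1 1 x * \<Gamma> 1 2 k x - \<Gamma> l 2 1 x * \<Gamma> 1 1 k x)
    + (\<Gamma> l 1 2 x * \<Gamma> 2 2 k x - \<Gamma> l 2 2 x * \<Gamma> 2 1 k x)"
  by (simp add: riemann_def sum_2)

text \<open>Equal mixed derivatives of \<open>a\<close>, \<open>b\<close> and \<open>c\<close> say
  that the curvature operator is skew with respect to the metric. With the definition of
  \<open>K\<close> these are four linear equations for four components, solved after multiplication
  by \<open>d\<close>.\<close>

lemma curvature:
  assumes "x \<in> W"
  shows "R 1 1 x = K x * b x" "R 1 2 x = K x * c x" "R 2 1 x = - K x * a x" "R 2 2 x = - K x * b x"
proof -
  have ra: "a x * R 1 1 x + b x * R 2 1 x = 0"
    using partial_commute_eq[OF open_W smooth_abcd(1) metric_compat(1) metric_compat(1) assms] assms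
    by (simp add: pd metric_compat R_expand) algebra
  have rc: "b x * R 1 2 x + c x * R 2 2 x = 0"
    using partial_commute_eq[OF open_W smooth_abcd(3) metric_compat(3) metric_compat(3) assms] assms
    by (simp add: pd metric_compat R_expand) algebra
  have rb: "a x * R 1 2 x + b x * R 2 2 x + b x * R 1 1 x + c x * R 2 1 x = 0"
    using partial_commute_eq[OF open_W smooth_abcd(2) metric_compat(2) metric_compat(2) assms] assms
    by (simp add: pd metric_compat R_expand) algebra
  have k: "K x * d x = a x * R 1 2 x + b x * R 2 2 x"
    using d_pos[OF assms] by (simp add: gauss_curvature_def sum_2 det_h assms a_def b_def)
  have "d x * R 1 1 x = d x * (K x * b x)" "d x * R 1 2 x = d x * (K x * c x)"
    "d x * R 2 1 x = d x * (- K x * a x)" "d x * R 2 2 x = d x * (- K x * b x)"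
    using ra rb rc k unfolding d_def by algebra+
  moreover have "d x \<noteq> 0" using d_pos[OF assms] by simp
  ultimately show "R 1 1 x = K x * b x" "R 1 2 x = K x * c x" "R 2 1 x = - K x * a x" "R 2 2 x = - K x * b x"
    unfolding mult_cancel_left by blast+
qed

text \<open>The curvature operator is trace-free, and the products of Christoffel symbols cancel in
  its trace.\<close>

lemma partial_t: "x \<in> W \<Longrightarrow> partial 1 (t 2) x = partial 2 (t 1) x"
proof -
  assume x: "x \<in> W"
  have "R 1 1 x + R 2 2 x = 0" using curvature(1,4)[OF x] by simp
  then have "partial 1 (\<Gamma> 1 2 1) x - partial 2 (\<Gamma> 1 1 1) x + partial 1 (\<Gamma> 2 2 2) x - partial 2 (\<Gamma> 2 1 2) x = 0"
    unfolding R_expand by (simp add: algebra_simps)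
  then show ?thesis using x by (simp add: t_def[abs_def] pd)
qed

end

section \<open>Killing fields\<close>

lemma partial_vec_nth: "partial i (\<lambda>p. p $ j) x = (if i = j then 1 else 0)"
  using partial_eqI[OF bounded_linear.has_derivative[OF bounded_linear_vec_nth has_derivative_ident], of i j x]
  by (simp add: axis_def)

lemma differentiable_vec_nth: "(\<lambda>p. p $ j) differentiable (at x)"
  using bounded_linear_imp_differentiable[OF bounded_linear_vec_nth] .

lemma quadratic_form_eq_0:
  fixes u v w :: real
  shows "(\<forall>p::real^2. u * (p$1 * p$1) + v * (p$1 * p$2) + w * (p$2 * p$2) = 0) \<longleftrightarrow> u = 0 \<and> v = 0 \<and> w = 0"
proof
  assume *: "\<forall>p::real^2. u * (p$1 * p$1) + v * (p$1 * p$2) + w * (p$2 * p$2) = 0"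
  show "u = 0 \<and> v = 0 \<and> w = 0"
    using *[rule_format, of "vector [1, 0]"] *[rule_format, of "vector [0, 1]"] *[rule_format, of "vector [1, 1]"]
    by simp
qed simp

context metric_chart
begin

text \<open>\<open>N / sqrt (det h)\<close> is the rotation by \<open>\<pi>/2\<close>, as a matrix with row index \<open>k\<close> and column index
  \<open>i\<close>. Here and below, square roots are avoided by not normalizing.\<close>

definition N :: "2 \<Rightarrow> 2 \<Rightarrow> real^2 \<Rightarrow> real" where
  "N k i x = (if k = 1 then (if i = 1 then - b x else - c x) else (if i = 1 then a x else b x))"

lemma N_simps: "N 1 1 = (\<lambda>x. - b x)" "N 1 2 = (\<lambda>x. - c x)" "N 2 1 = a" "N 2 2 = b"
  by (auto simp: N_def)

definition nabla :: "2 \<Rightarrow> (2 \<Rightarrow> real^2 \<Rightarrow> real) \<Rightarrow> 2 \<Rightarrow> real^2 \<Rightarrow> real" where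
  "nabla i X k x = partial i (X k) x + \<Gamma> k i 1 x * X 1 x + \<Gamma> k i 2 x * X 2 x"

text \<open>The quotient rule for entries of the inverse metric, whose common denominator is
  \<open>d\<close>.\<close>

lemma partial_divide_d:
  assumes "x \<in> W" "smooth_on W f"
  shows "partial i (\<lambda>x. f x / d x) x = (partial i f x - 2 * t i x * f x) / d x"
proof -
  have s: "smooth_on W (\<lambda>x. f x / d x)"
    using assms d_pos by (intro smooth_on_divide open_W) (auto simp: less_imp_neq[symmetric])
  have "partial i f x = partial i (\<lambda>x. (f x / d x) * d x) x"
    using d_pos assms by (intro partial_cong[OF open_W assms(1)]) (auto simp: diff_W less_imp_neq[symmetric])
  also have "\<dots> = partial i (\<lambda>x. f x / d x) x * d x + f x / d x * (2 * t i x * d x)"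
    using assms s partial_d by (subst partial_mult) (auto simp: diff_W)
  finally show ?thesis
    using d_pos[OF assms(1)] by (simp add: field_simps)
qed

text \<open>Invariantly the bracket is twice the sum of g^{ij} (nabla_i X^k) p_j p_k; the factor
  \<open>d\<close> clears the denominator of the inverse metric.\<close>

lemma poisson_bracket_hamiltonian:
  assumes x: "x \<in> W" and X: "\<And>k. X k differentiable (at x)"
  shows "d x * poisson_bracket (hamiltonian h) (\<lambda>x p. X 1 x * p$1 + X 2 x * p$2) x p =
     2 * (c x * nabla 1 X 1 x - b x * nabla 2 X 1 x) * (p$1 * p$1)
   + 2 * (c x * nabla 1 X 2 x - b x * nabla 2 X 2 x - b x * nabla 1 X 1 x + a x * nabla 2 X 1 x) * (p$1 * p$2)
   + 2 * (a x * nabla 2 X 2 x - b x * nabla 1 X 2 x) * (p$2 * p$2)"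
proof -
  have H: "hamiltonian h y p = c y / d y * (p$1 * p$1) + (- b y / d y) * (2 * (p$1 * p$2)) + a y / d y * (p$2 * p$2)"
    if "y \<in> W" for y p
    using that by (simp add: hamiltonian_def sum_2 matrix_inv_h algebra_simps)
  have sd: "smooth_on W (\<lambda>x. f x / d x)" if "smooth_on W f" for f
    using that d_pos by (intro smooth_on_divide open_W) (auto simp: less_imp_neq[symmetric])
  have sm: "smooth_on W (\<lambda>x. - b x)" by (intro smooth_on_minus open_W smooth_abcd)
  have Hp: "partial i (hamiltonian h x) p =
      c x / d x * (2 * p$1 * (if i = 1 then 1 else 0))
      + (- b x / d x) * (2 * (p$1 * (if i = 2 then 1 else 0) + p$2 * (if i = 1 then 1 else 0)))
      + a x / d x * (2 * p$2 * (if i = 2 then 1 else 0))" for i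
  proof -
    have "partial i (\<lambda>p. u * (p$1 * p$1) + v * (2 * (p$1 * p$2)) + w * (p$2 * p$2)) p =
        u * (2 * p$1 * (if i = 1 then 1 else 0))
        + v * (2 * (p$1 * (if i = 2 then 1 else 0) + p$2 * (if i = 1 then 1 else 0)))
        + w * (2 * p$2 * (if i = 2 then 1 else 0))" for u v w :: real
      by (simp add: partial_add partial_mult partial_const partial_vec_nth differentiable_vec_nth
          differentiable_add differentiable_mult differentiable_const)
    then show ?thesis unfolding H[OF x, abs_def] .
  qed
  have Hx: "partial i (\<lambda>y. hamiltonian h y p) x =
      (partial i c x - 2 * t i x * c x) / d x * (p$1 * p$1)
      + (- partial i b x + 2 * t i x * b x) / d x * (2 * (p$1 * p$2))
      + (partial i a x - 2 * t i x * a x) / d x * (p$2 * p$2)" for i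
  proof -
    have lin: "(\<lambda>y. u y * u' + v y * v' + w y * w') differentiable (at x)"
      "partial i (\<lambda>y. u y * u' + v y * v' + w y * w') x = partial i u x * u' + partial i v x * v' + partial i w x * w'"
      if "u differentiable (at x)" "v differentiable (at x)" "w differentiable (at x)" for u v w :: "real^2 \<Rightarrow> real" and u' v' w'
      using that by (simp_all add: pd)
    note ds = diff_W[OF sd[OF smooth_abcd(3)] x] diff_W[OF sd[OF sm] x] diff_W[OF sd[OF smooth_abcd(1)] x]
    have "partial i (\<lambda>y. hamiltonian h y p) x =
      partial i (\<lambda>y. c y / d y * (p$1 * p$1) + (- b y / d y) * (2 * (p$1 * p$2)) + a y / d y * (p$2 * p$2)) x"
      using partial_cong[OF open_W x H[symmetric] lin(1)[OF ds]] by simp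
    also have "\<dots> = partial i (\<lambda>y. c y / d y) x * (p$1 * p$1) + partial i (\<lambda>y. - b y / d y) x * (2 * (p$1 * p$2)) + partial i (\<lambda>y. a y / d y) x * (p$2 * p$2)"
      by (rule lin(2)[OF ds])
    also have "partial i (\<lambda>y. - b y / d y) x = (- partial i b x + 2 * t i x * b x) / d x"
      using x by (simp only: partial_divide_d[OF x sm]) (simp add: pd)
    finally show ?thesis using x by (simp add: partial_divide_d)
  qed
  have Fp: "partial i (\<lambda>p. X 1 x * p$1 + X 2 x * p$2) p = X 1 x * (if i = 1 then 1 else 0) + X 2 x * (if i = 2 then 1 else 0)" for i
    by (simp add: partial_add partial_mult partial_const partial_vec_nth differentiable_vec_nth
        differentiable_mult differentiable_const)
  have Fx: "partial i (\<lambda>y. X 1 y * p$1 + X 2 y * p$2) x = partial i (X 1) x * p$1 + partial i (X 2) x * p$2" for i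
    using X by (simp add: partial_add partial_mult partial_const differentiable_mult differentiable_const)
  have canc: "d x * (u / d x * v) = u * v" for u v using d_pos[OF x] by simp
  have *: "d x * poisson_bracket (hamiltonian h) (\<lambda>x p. X 1 x * p$1 + X 2 x * p$2) x p =
     (c x * (2 * p$1) - b x * (2 * p$2)) * (partial 1 (X 1) x * p$1 + partial 1 (X 2) x * p$2)
   + (- b x * (2 * p$1) + a x * (2 * p$2)) * (partial 2 (X 1) x * p$1 + partial 2 (X 2) x * p$2)
   - ((partial 1 c x - 2 * t 1 x * c x) * (p$1 * p$1)
      + (- partial 1 b x + 2 * t 1 x * b x) * (2 * (p$1 * p$2))
      + (partial 1 a x - 2 * t 1 x * a x) * (p$2 * p$2)) * X 1 x
   - ((partial 2 c x - 2 * t 2 x * c x) * (p$1 * p$1)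
      + (- partial 2 b x + 2 * t 2 x * b x) * (2 * (p$1 * p$2))
      + (partial 2 a x - 2 * t 2 x * a x) * (p$2 * p$2)) * X 2 x"
    unfolding poisson_bracket_def sum_2 Hp Hx Fp Fx using d_pos[OF x] by (simp add: field_simps)
  show ?thesis
    unfolding * metric_compat[OF x] nabla_def t_def christoffel_21[OF x] by algebra
qed

text \<open>A quadratic form in the momenta vanishes with its three coefficients. Three equations
  for the four entries of nabla X leave the skew endomorphisms, which in dimension 2 are the
  multiples of \<open>N\<close>.\<close>

lemma poisson_bracket_eq_0_iff:
  assumes x: "x \<in> W" and X: "\<And>k. X k differentiable (at x)"
  shows "(\<forall>p. poisson_bracket (hamiltonian h) (\<lambda>x p. X 1 x * p$1 + X 2 x * p$2) x p = 0) \<longleftrightarrow>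
    (\<exists>w. \<forall>i k. nabla i X k x = w * N k i x)"
proof -
  have "(\<forall>p. poisson_bracket (hamiltonian h) (\<lambda>x p. X 1 x * p$1 + X 2 x * p$2) x p = 0) \<longleftrightarrow>
    (\<forall>p. d x * poisson_bracket (hamiltonian h) (\<lambda>x p. X 1 x * p$1 + X 2 x * p$2) x p = 0)"
    using d_pos[OF x] by simp
  also have "\<dots> \<longleftrightarrow> c x * nabla 1 X 1 x - b x * nabla 2 X 1 x = 0 \<and>
     c x * nabla 1 X 2 x - b x * nabla 2 X 2 x - b x * nabla 1 X 1 x + a x * nabla 2 X 1 x = 0 \<and>
     a x * nabla 2 X 2 x - b x * nabla 1 X 2 x = 0" (is "_ \<longleftrightarrow> ?e")
    unfolding poisson_bracket_hamiltonian[of x X, OF assms] quadratic_form_eq_0 by auto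
  also have "\<dots> \<longleftrightarrow> (\<exists>w. \<forall>i k. nabla i X k x = w * N k i x)"
  proof
    assume e: ?e
    \<comment> \<open>Read off from the entry \<open>N 2 1 = a\<close>, the one known to be
      positive.\<close>
    define w where "w = nabla 1 X 2 x / a x"
    have 1: "nabla 1 X 2 x = w * a x" using a_pos[OF x] by (simp add: w_def)
    have "a x * nabla 2 X 2 x = a x * (w * b x)" using e 1 by algebra
    then have 2: "nabla 2 X 2 x = w * b x" using a_pos[OF x] by simp
    have "d x * nabla 1 X 1 x = d x * (- w * b x)" "d x * nabla 2 X 1 x = d x * (- w * c x)"
      using e 1 2 unfolding d_def by algebra+
    then have "nabla 1 X 1 x = - w * b x" "nabla 2 X 1 x = - w * c x"
      using d_pos[OF x] unfolding mult_cancel_left by auto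
    with 1 2 show "\<exists>w. \<forall>i k. nabla i X k x = w * N k i x"
      by (auto simp: forall_2 N_simps)
  next
    assume "\<exists>w. \<forall>i k. nabla i X k x = w * N k i x"
    then show ?e by (auto simp: forall_2 N_simps)
  qed
  finally show ?thesis .
qed

text \<open>The function \<omega> is \<open>w\<close> times sqrt(det h), which accounts for the
  terms -t w. Commuting derivatives of the components of X determine dw, and commuting those of
  \<open>w\<close> leaves the condition on dK, since \<open>t\<close> is closed.\<close>

lemma killing_prolongation:
  assumes V: "open V" "V \<subseteq> W" and X: "\<And>k. smooth_on V (X k)"
    and kill: "\<And>x. x \<in> V \<Longrightarrow> \<exists>w. \<forall>i k. nabla i X k x = w * N k i x"
  obtains w where "smooth_on V w"
    "\<And>x i k. x \<in> V \<Longrightarrow> partial i (X k) x = w x * N k i x - \<Gamma> k i 1 x * X 1 x - \<Gamma> k i 2 x * X 2 x"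
    "\<And>x. x \<in> V \<Longrightarrow> partial 1 w x = - K x * X 2 x - t 1 x * w x"
    "\<And>x. x \<in> V \<Longrightarrow> partial 2 w x = K x * X 1 x - t 2 x * w x"
    "\<And>x. x \<in> V \<Longrightarrow> X 1 x * partial 1 K x + X 2 x * partial 2 K x = 0"
proof -
  define w where "w x = nabla 1 X 2 x / a x" for x
  have sV: "smooth_on V f" if "smooth_on W f" for f :: "real^2 \<Rightarrow> real"
    using smooth_on_subset[OF that V(2)] .
  have w: "smooth_on V w"
    unfolding w_def nabla_def using a_pos V(2)
    by (intro smooth_on_divide smooth_on_add smooth_on_mult V(1) X smooth_on_partial sV smooth_christoffel smooth_abcd)
      (auto simp: less_imp_neq[symmetric] subset_iff)
  have dX: "partial i (X k) x = w x * N k i x - \<Gamma> k i 1 x * X 1 x - \<Gamma> k i 2 x * X 2 x" if x: "x \<in> V" for x i k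
  proof -
    obtain v where v: "\<forall>i k. nabla i X k x = v * N k i x" using kill[OF x] by blast
    then have "v = w x" using a_pos[of x] x V by (auto simp: w_def N_simps)
    then show ?thesis using v by (simp add: nabla_def algebra_simps)
  qed
  note sm = smooth_on_differentiable[OF X] smooth_on_differentiable[OF w]
  have xW: "x \<in> V \<Longrightarrow> x \<in> W" for x using V by auto
  have dX': "partial i (X 1) x = w x * N 1 i x - \<Gamma> 1 i 1 x * X 1 x - \<Gamma> 1 i 2 x * X 2 x"
    "partial i (X 2) x = w x * N 2 i x - \<Gamma> 2 i 1 x * X 1 x - \<Gamma> 2 i 2 x * X 2 x"
    if "x \<in> V" for x i using dX that by auto
  have dw: "partial 1 w x = - K x * X 2 x - t 1 x * w x \<and> partial 2 w x = K x * X 1 x - t 2 x * w x"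
    if x: "x \<in> V" for x
  proof -
    note x' = xW[OF x]
    \<comment> \<open>The defects in the two equations to be shown. The components of X give one
      linear relation each between them, with determinant \<open>d\<close>, so both vanish.\<close>
    define u1 u2 where "u1 = partial 1 w x + t 1 x * w x + K x * X 2 x"
      and "u2 = partial 2 w x + t 2 x * w x - K x * X 1 x"
    have 1: "c x * u1 = b x * u2"
      using partial_commute_eq[OF V(1) X dX'(1) dX'(1) x] x x' curvature(1,2)[OF x']
      unfolding u1_def u2_def
      by (simp add: pd sm dX' N_simps metric_compat R_expand christoffel_21 t_def) algebra
    have 2: "b x * u1 = a x * u2"
      using partial_commute_eq[OF V(1) X dX'(2) dX'(2) x] x x' curvature(3,4)[OF x']
      unfolding u1_def u2_def
      by (simp add: pd sm dX' N_simps metric_compat R_expand christoffel_21 t_def) algebra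
    have "d x * u1 = 0" "d x * u2 = 0" using 1 2 unfolding d_def by algebra+
    then have "u1 = 0" "u2 = 0" using d_pos[OF x'] by auto
    then show ?thesis by (simp add: u1_def u2_def algebra_simps)
  qed
  have XK: "X 1 x * partial 1 K x + X 2 x * partial 2 K x = 0" if x: "x \<in> V" for x
    using partial_commute_eq[OF V(1) w dw[THEN conjunct1] dw[THEN conjunct2] x] x xW[OF x] partial_t[OF xW[OF x]]
    by (simp add: pd sm dX' dw N_simps christoffel_21) (simp only: t_def christoffel_21[OF xW[OF x]]; algebra)
  show thesis
    using that[of w, OF w dX dw[THEN conjunct1] dw[THEN conjunct2] XK] by blast
qed

text \<open>\<open>F\<close> is linear in the momenta only over \<open>V\<close>, and the bracket
  sees no more than its germ along the fibre.\<close>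

lemma killing_poisson_iff:
  assumes V: "open V" "V \<subseteq> W" and X: "\<And>k. smooth_on V (X k)"
    and F: "\<And>x p. x \<in> V \<Longrightarrow> F x p = X 1 x * p$1 + X 2 x * p$2" and x: "x \<in> V"
  shows "(\<forall>p. poisson_bracket (hamiltonian h) F x p = 0) \<longleftrightarrow> (\<exists>w. \<forall>i k. nabla i X k x = w * N k i x)"
proof -
  note dX = smooth_on_differentiable[OF X x]
  have "poisson_bracket (hamiltonian h) F x p = poisson_bracket (hamiltonian h) (\<lambda>x p. X 1 x * p$1 + X 2 x * p$2) x p" for p
  proof -
    have "F x = (\<lambda>p. X 1 x * p$1 + X 2 x * p$2)" using F[OF x] by blast
    moreover have "partial i (\<lambda>y. X 1 y * p$1 + X 2 y * p$2) x = partial i (\<lambda>y. F y p) x" for i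
      using F dX by (intro partial_cong[OF V(1) x]) auto
    ultimately show ?thesis unfolding poisson_bracket_def by simp
  qed
  then show ?thesis
    using poisson_bracket_eq_0_iff[of x X] dX x V(2) by auto
qed

lemma integral_on_1E:
  assumes "integral_on h 1 V F"
  obtains X where "\<And>k. smooth_on V (X k)" "\<And>x p. x \<in> V \<Longrightarrow> F x p = X 1 x * p$1 + X (2::2) x * p$2"
proof -
  obtain u where u: "\<forall>i\<le>1. smooth_on V (u i)" "\<forall>x\<in>V. \<forall>p. F x p = (\<Sum>i\<le>1. u i x * (p $ 1) ^ i * (p $ 2) ^ (1 - i))"
    using assms unfolding integral_on_def by blast
  show thesis
    by (rule that[of "\<lambda>k::2. if k = 1 then u 1 else u 0"]) (use u in auto)
qed

lemma integral_on_1I: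
  assumes V: "open V" "V \<subseteq> W" and X: "\<And>k. smooth_on V (X k)"
    and F: "\<And>x p. x \<in> V \<Longrightarrow> F x p = X 1 x * p$1 + X 2 x * p$2"
    and kill: "\<And>x. x \<in> V \<Longrightarrow> \<exists>w. \<forall>i k. nabla i X k x = w * N k i x"
  shows "integral_on h 1 V F"
  unfolding integral_on_def
proof (intro conjI)
  show "\<exists>u. (\<forall>i\<le>1. smooth_on V (u i)) \<and> (\<forall>x\<in>V. \<forall>p. F x p = (\<Sum>i\<le>1. u i x * (p $ 1) ^ i * (p $ 2) ^ (1 - i)))"
    using X F by (intro exI[of _ "\<lambda>i. if i = 0 then X 2 else X 1"]) auto
  show "\<forall>x\<in>V. \<forall>p. poisson_bracket (hamiltonian h) F x p = 0"
    using killing_poisson_iff[OF V X F] kill by blast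
qed

end

section \<open>The invariants as polynomials in coordinates\<close>

lemma sum_lists_length_Suc:
  "(\<Sum>js | length js = Suc n. f js) = (\<Sum>i\<in>(UNIV::'a::finite set). \<Sum>js | length js = n. f (i # js))"
proof -
  have e: "{js. length js = Suc n} = (\<lambda>(i::'a, js). i # js) ` (UNIV \<times> {js. length js = n})"
    by (force simp: length_Suc_conv image_iff)
  have "inj_on (\<lambda>(i::'a, js). i # js) (UNIV \<times> {js. length js = n})"
    by (auto simp: inj_on_def)
  then show ?thesis
    unfolding e by (subst sum.reindex) (simp_all add: sum.cartesian_product split_def)
qed

lemma tensor_apply_2:
  "tensor_apply T x [u, v] = (\<Sum>i\<in>UNIV. \<Sum>j\<in>UNIV. T [i, j] x * (u$i * v$j))"
  by (simp add: tensor_apply_def sum_lists_length_Suc numeral_2_eq_2 lessThan_Suc mult_ac)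

lemma tensor_apply_3:
  "tensor_apply T x [u, v, w] = (\<Sum>i\<in>UNIV. \<Sum>j\<in>UNIV. \<Sum>k\<in>UNIV. T [i, j, k] x * (u$i * v$j * w$k))"
  by (simp add: tensor_apply_def sum_lists_length_Suc numeral_3_eq_3 lessThan_Suc mult_ac)

context metric_chart
begin

abbreviation "dK \<equiv> \<lambda>i. partial i K"

text \<open>The Hessian of \<open>K\<close>; below, \<open>T\<close> is its covariant derivative.
  They free the calculations from tensors indexed by lists.\<close>

definition "H i j x = partial i (dK j) x - \<Gamma> 1 i j x * dK 1 x - \<Gamma> 2 i j x * dK 2 x"

definition "T i j k x = partial i (H j k) x - \<Gamma> 1 i j x * H 1 k x - \<Gamma> 2 i j x * H 2 k x
   - \<Gamma> 1 i k x * H j 1 x - \<Gamma> 2 i k x * H j 2 x"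

lemma smooth_dK [simp]: "smooth_on W (dK i)"
  by (intro smooth_on_partial smooth_K)

lemma smooth_H [simp]: "smooth_on W (H i j)"
  unfolding H_def[abs_def]
  by (intro smooth_on_diff smooth_on_mult smooth_on_partial open_W smooth_christoffel smooth_K)

lemma dK_commute: "x \<in> W \<Longrightarrow> partial 2 (dK 1) x = partial 1 (dK 2) x"
  by (rule partial_commute[OF open_W smooth_K])

lemma H_21: "x \<in> W \<Longrightarrow> H 2 1 x = H 1 2 x"
  by (simp add: H_def dK_commute christoffel_21)

lemma cov_deriv_1: "cov_deriv h (\<lambda>_. K) [j] = dK j"
  by (rule ext) simp

lemma cov_deriv_2: "cov_deriv h (cov_deriv h (\<lambda>_. K)) [i, j] = H i j"
  by (rule ext) (simp add: cov_deriv_1 lessThan_Suc sum_2 H_def)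

lemma iter_cov_deriv_2: "iter_cov_deriv h 2 K [i, j] = H i j"
  by (simp add: iter_cov_deriv_def numeral_2_eq_2 cov_deriv_2 del: cov_deriv.simps)

lemma iter_cov_deriv_3: "iter_cov_deriv h 3 K [i, j, k] = T i j k"
  by (rule ext) (simp add: iter_cov_deriv_def numeral_3_eq_3 cov_deriv.simps(2)[of h "cov_deriv h (cov_deriv h (\<lambda>_. K))"]
    cov_deriv_2 lessThan_Suc sum_2 T_def del: cov_deriv.simps)

text \<open>\<open>G\<close> is \<open>det h\<close> times the gradient, \<open>Z\<close> is \<open>sqrt (det h)\<close> times the skew gradient.\<close>

definition "G k x = (if k = (1::2) then c x * dK 1 x - b x * dK 2 x else a x * dK 2 x - b x * dK 1 x)"
definition "Z k x = (if k = (1::2) then - dK 2 x else dK 1 x)"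

lemma GZ_simps: "G 1 x = c x * dK 1 x - b x * dK 2 x" "G 2 x = a x * dK 2 x - b x * dK 1 x"
  "Z 1 x = - dK 2 x" "Z 2 x = dK 1 x"
  by (simp_all add: G_def Z_def)

lemma grad_K: "x \<in> W \<Longrightarrow> grad h K x $ k = G k x / d x"
  using exhaust_2[of k]
  by (auto simp: grad_def matrix_vector_mult_def sum_2 matrix_inv_h GZ_simps diff_divide_distrib)

lemma metric_grad_K: "x \<in> W \<Longrightarrow> (h x *v grad h K x) $ i = dK i x"
proof -
  assume x: "x \<in> W"
  have "(h x *v grad h K x) $ 1 = (a x * G 1 x + b x * G 2 x) / d x"
    "(h x *v grad h K x) $ 2 = (b x * G 1 x + c x * G 2 x) / d x"
    using x sym_h[OF x] by (simp_all add: matrix_vector_mult_def sum_2 grad_K a_def b_def c_def add_divide_distrib)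
  moreover have "a x * G 1 x + b x * G 2 x = d x * dK 1 x" "b x * G 1 x + c x * G 2 x = d x * dK 2 x"
    unfolding GZ_simps d_def by algebra+
  ultimately show ?thesis using d_pos[OF x] exhaust_2[of i] by auto
qed

lemma sgrad_K: "x \<in> W \<Longrightarrow> sgrad h K x $ k = Z k x / sqrt (d x)"
  using exhaust_2[of k] by (auto simp: sgrad_def rotate_left_def det_h metric_grad_K GZ_simps)

lemma I3_eq_0_iff: "x \<in> W \<Longrightarrow> I3 h x = 0 \<longleftrightarrow> dK 1 x = 0 \<and> dK 2 x = 0"
proof -
  assume x: "x \<in> W"
  have "I3 h x = (G 1 x * dK 1 x + G 2 x * dK 2 x) / d x"
    using x by (simp add: I3_def Let_def inner_vec_def sum_2 metric_grad_K grad_K add_divide_distrib)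
  then have "I3 h x = 0 \<longleftrightarrow> a x * (G 1 x * dK 1 x + G 2 x * dK 2 x) = 0"
    using d_pos[OF x] a_pos[OF x] by simp
  \<comment> \<open>Completing the square, with the positive factor \<open>a\<close>.\<close>
  also have "a x * (G 1 x * dK 1 x + G 2 x * dK 2 x) = (a x * dK 2 x - b x * dK 1 x)^2 + d x * (dK 1 x)^2"
    unfolding GZ_simps d_def by algebra
  also have "\<dots> = 0 \<longleftrightarrow> dK 1 x = 0 \<and> dK 2 x = 0"
    using d_pos[OF x] a_pos[OF x] by (auto simp: add_nonneg_eq_0_iff)
  finally show ?thesis .
qed

lemma I4b_eq_0_iff: "x \<in> W \<Longrightarrow> I4b h x = 0 \<longleftrightarrow>
   G 1 x * (H 1 1 x * Z 1 x + H 1 2 x * Z 2 x) + G 2 x * (H 1 2 x * Z 1 x + H 2 2 x * Z 2 x) = 0"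
proof -
  assume x: "x \<in> W"
  define m where "m = sqrt (d x)"
  have m: "m > 0" "d x > 0" using d_pos[OF x] by (simp_all add: m_def)
  have "I4b h x = (G 1 x * (H 1 1 x * Z 1 x + H 1 2 x * Z 2 x) + G 2 x * (H 1 2 x * Z 1 x + H 2 2 x * Z 2 x)) / (d x * m)"
    unfolding I4b_def Let_def tensor_apply_2 iter_cov_deriv_2 sum_2 grad_K[OF x] sgrad_K[OF x] H_21[OF x] m_def[symmetric]
    using m by (simp add: field_simps)
  then show ?thesis using m by simp
qed

text \<open>The third covariant derivative of \<open>K\<close> as a cubic form on the vector (u, v).
  Its homogeneity allows a vector to be replaced by a multiple of it.\<close>

definition "T3 u v x = u * u * u * T 1 1 1 x + u * u * v * (T 1 1 2 x + T 1 2 1 x + T 2 1 1 x)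
   + u * v * v * (T 1 2 2 x + T 2 1 2 x + T 2 2 1 x) + v * v * v * T 2 2 2 x"

lemma I5d_eq_0_iff: "x \<in> W \<Longrightarrow> I5d h x = 0 \<longleftrightarrow> T3 (Z 1 x) (Z 2 x) x = 0"
proof -
  assume x: "x \<in> W"
  define m where "m = sqrt (d x)"
  have m: "m > 0" using d_pos[OF x] by (simp add: m_def)
  have "I5d h x = T3 (Z 1 x) (Z 2 x) x / (m * m * m)"
    unfolding I5d_def Let_def tensor_apply_3 iter_cov_deriv_3 sum_2 sgrad_K[OF x] T3_def m_def[symmetric]
    using m by (simp add: field_simps)
  then show ?thesis using m by simp
qed

text \<open>The connection matrices for \<open>(X\<^sub>1, X\<^sub>2, w)\<close>, where \<open>\<nabla>X = w N\<close>.\<close>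

definition "P i x = (if i = (1::2)
  then vector [vector [- \<Gamma> 1 1 1 x, - \<Gamma> 1 1 2 x, - b x], vector [- \<Gamma> 2 1 1 x, - \<Gamma> 2 1 2 x, a x], vector [0, - K x, - t 1 x]]
  else vector [vector [- \<Gamma> 1 2 1 x, - \<Gamma> 1 2 2 x, - c x], vector [- \<Gamma> 2 2 1 x, - \<Gamma> 2 2 2 x, b x], vector [K x, 0, - t 2 x]] :: real^3^3)"

lemma smooth_P: "smooth_on W (\<lambda>x. P i x $ j $ k)"
  using exhaust_2[of i] exhaust_3[of j] exhaust_3[of k]
  by (auto simp: P_def intro!: smooth_on_minus smooth_on_const open_W)

lemma P_simps: "P 1 x $ 1 $ 1 = - \<Gamma> 1 1 1 x" "P 1 x $ 1 $ 2 = - \<Gamma> 1 1 2 x" "P 1 x $ 1 $ 3 = - b x"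
  "P 1 x $ 2 $ 1 = - \<Gamma> 2 1 1 x" "P 1 x $ 2 $ 2 = - \<Gamma> 2 1 2 x" "P 1 x $ 2 $ 3 = a x"
  "P 1 x $ 3 $ 1 = 0" "P 1 x $ 3 $ 2 = - K x" "P 1 x $ 3 $ 3 = - t 1 x"
  "P 2 x $ 1 $ 1 = - \<Gamma> 1 2 1 x" "P 2 x $ 1 $ 2 = - \<Gamma> 1 2 2 x" "P 2 x $ 1 $ 3 = - c x"
  "P 2 x $ 2 $ 1 = - \<Gamma> 2 2 1 x" "P 2 x $ 2 $ 2 = - \<Gamma> 2 2 2 x" "P 2 x $ 2 $ 3 = b x"
  "P 2 x $ 3 $ 1 = K x" "P 2 x $ 3 $ 2 = 0" "P 2 x $ 3 $ 3 = - t 2 x"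
  by (simp_all add: P_def)

section \<open>Killing fields as parallel sections\<close>

definition "parallel_on V s \<longleftrightarrow> (\<forall>k. smooth_on V (\<lambda>x. s x $ k)) \<and>
   (\<forall>x\<in>V. \<forall>i k. partial i (\<lambda>x. s x $ k) x = (P i x *v s x) $ k)"

lemma integral_on_parallel:
  assumes V: "open V" "V \<subseteq> W" and F: "integral_on h 1 V F"
  obtains s where "parallel_on V s" "\<And>x p. x \<in> V \<Longrightarrow> F x p = s x $ 1 * p$1 + s x $ 2 * p$2"
    "\<And>x. x \<in> V \<Longrightarrow> s x $ 1 * dK 1 x + s x $ 2 * dK 2 x = 0"
proof -
  obtain X where X: "\<And>k. smooth_on V (X k)" and FX: "\<And>x p. x \<in> V \<Longrightarrow> F x p = X 1 x * p$1 + X (2::2) x * p$2"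
    using integral_on_1E[OF F] by blast
  have "\<exists>w. \<forall>i k. nabla i X k x = w * N k i x" if "x \<in> V" for x
    using killing_poisson_iff[OF V X FX that] F that by (auto simp: integral_on_def)
  from killing_prolongation[OF V X this] obtain w where w: "smooth_on V w"
    "\<And>x i k. x \<in> V \<Longrightarrow> partial i (X k) x = w x * N k i x - \<Gamma> k i 1 x * X 1 x - \<Gamma> k i 2 x * X 2 x"
    "\<And>x. x \<in> V \<Longrightarrow> partial 1 w x = - K x * X 2 x - t 1 x * w x"
    "\<And>x. x \<in> V \<Longrightarrow> partial 2 w x = K x * X 1 x - t 2 x * w x"
    "\<And>x. x \<in> V \<Longrightarrow> X 1 x * partial 1 K x + X 2 x * partial 2 K x = 0" by blast
  define s :: "real^2 \<Rightarrow> real^3" where "s x = vector [X 1 x, X 2 x, w x]" for x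
  have "parallel_on V s"
    unfolding parallel_on_def forall_3 forall_2 s_def
    using X w(1) V(2) by (auto simp: w(2-4) matrix_vector_mult_def sum_3 P_simps N_simps algebra_simps)
  then show thesis
    using that[of s] w(5) FX by (simp add: s_def)
qed

lemma parallel_integral_on:
  assumes V: "open V" "V \<subseteq> W" and s: "parallel_on V s"
  shows "integral_on h 1 V (\<lambda>x p. s x $ 1 * p$1 + s x $ 2 * p$2)"
proof (rule integral_on_1I[OF V])
  define X where "X k x = (if k = (1::2) then s x $ 1 else s x $ 2)" for k x
  have X: "X 1 = (\<lambda>x. s x $ 1)" "X 2 = (\<lambda>x. s x $ 2)" by (auto simp: X_def)
  show "smooth_on V (X k)" for k
    using exhaust_2[of k] s by (auto simp: X parallel_on_def)
  show "s x $ 1 * p$1 + s x $ 2 * p$2 = X 1 x * p$1 + X 2 x * p$2" for x p by (simp add: X)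
  show "\<exists>w. \<forall>i k. nabla i X k x = w * N k i x" if x: "x \<in> V" for x
    using s x V(2)
    by (intro exI[of _ "s x $ 3"])
      (auto simp: parallel_on_def forall_2 nabla_def X matrix_vector_mult_def sum_3 P_simps N_simps)
qed

lemma parallel_unique:
  assumes "open V" "V \<subseteq> W" "q \<in> V" "parallel_on V s" "s q = 0"
  shows "\<forall>\<^sub>F x in nhds q. s x = 0"
proof (rule linear_system_unique[where P=P])
  show "continuous_on V (P i)" for i
    using smooth_on_continuous[OF smooth_on_subset[OF smooth_P assms(2)]] by (rule continuous_on_componentwise_mat)
  show "(\<lambda>x. s x $ k) differentiable (at x)" if "x \<in> V" for x k
    using assms(4) that unfolding parallel_on_def by (blast intro: smooth_on_differentiable)
qed (use assms in \<open>auto simp: parallel_on_def\<close>)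

text \<open>Derivatives of \<open>K\<close> enter the flatness condition only through the third row;
  everything else cancels by \<open>curvature\<close> and \<open>partial_t\<close>.\<close>

lemma parallel_exists:
  assumes "q \<in> W" "\<And>x. x \<in> W \<Longrightarrow> dK 1 x = 0 \<and> dK 2 x = 0"
  obtains V s where "open V" "q \<in> V" "V \<subseteq> W" "parallel_on V s" "s q = s0"
proof -
  have flat: "partial 2 (\<lambda>x. P 1 x $ j $ k) x + (P 1 x ** P 2 x) $ j $ k
       = partial 1 (\<lambda>x. P 2 x $ j $ k) x + (P 2 x ** P 1 x) $ j $ k" if x: "x \<in> W" for x j k
  proof -
    have "\<forall>j k. partial 2 (\<lambda>x. P 1 x $ j $ k) x + (P 1 x ** P 2 x) $ j $ k
       = partial 1 (\<lambda>x. P 2 x $ j $ k) x + (P 2 x ** P 1 x) $ j $ k"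
      unfolding forall_3 matrix_matrix_mult_def
      using x curvature[OF x] partial_t[OF x] assms(2)[OF x]
      by (simp add: sum_3 P_simps pd metric_compat christoffel_21 R_expand t_def; algebra)
    then show ?thesis by blast
  qed
  from frobenius[OF open_W assms(1) smooth_P flat, of s0] obtain V s where
    "open V" "q \<in> V" "V \<subseteq> W" "s q = s0" "\<And>k. smooth_on V (\<lambda>x. s x $ k)"
    "\<And>x i k. x \<in> V \<Longrightarrow> partial i (\<lambda>x. s x $ k) x = (P i x *v s x) $ k" by blast
  then show thesis using that[of V s] by (simp add: parallel_on_def)
qed

lemma parallel_partials:
  assumes "parallel_on V s" "x \<in> V"
  shows "partial 1 (\<lambda>x. s x $ 1) x = - \<Gamma> 1 1 1 x * s x $ 1 - \<Gamma> 1 1 2 x * s x $ 2 - b x * s x $ 3"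
    "partial 1 (\<lambda>x. s x $ 2) x = - \<Gamma> 2 1 1 x * s x $ 1 - \<Gamma> 2 1 2 x * s x $ 2 + a x * s x $ 3"
    "partial 1 (\<lambda>x. s x $ 3) x = - K x * s x $ 2 - t 1 x * s x $ 3"
    "partial 2 (\<lambda>x. s x $ 1) x = - \<Gamma> 1 2 1 x * s x $ 1 - \<Gamma> 1 2 2 x * s x $ 2 - c x * s x $ 3"
    "partial 2 (\<lambda>x. s x $ 2) x = - \<Gamma> 2 2 1 x * s x $ 1 - \<Gamma> 2 2 2 x * s x $ 2 + b x * s x $ 3"
    "partial 2 (\<lambda>x. s x $ 3) x = K x * s x $ 1 - t 2 x * s x $ 3"
  using assms by (simp_all add: parallel_on_def matrix_vector_mult_def sum_3 P_simps)

text \<open>The covector dK composed with \<open>N\<close>, that is, the value of dK on nabla_i X up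
  to the factor \<open>w\<close>.\<close>

definition "NK i x = N 1 i x * dK 1 x + N 2 i x * dK 2 x"

lemma NK_simps: "NK 1 x = a x * dK 2 x - b x * dK 1 x" "NK 2 x = b x * dK 2 x - c x * dK 1 x"
  by (simp_all add: NK_def N_simps)

text \<open>Used as a rewrite rule together with \<open>partial_H\<close>: ordinary derivatives
  become covariant ones, and the Christoffel symbols then cancel.\<close>

lemma partial_dK:
  "partial i (dK j) x = H i j x + \<Gamma> 1 i j x * dK 1 x + \<Gamma> 2 i j x * dK 2 x"
  by (simp add: H_def)

lemma partial_H:
  "partial i (H j k) x = T i j k x + \<Gamma> 1 i j x * H 1 k x + \<Gamma> 2 i j x * H 2 k x
     + \<Gamma> 1 i k x * H j 1 x + \<Gamma> 2 i k x * H j 2 x"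
  by (simp add: T_def)

section \<open>Derivatives of the condition dK(X) = 0\<close>

context
  fixes V s
  assumes V: "open V" "V \<subseteq> W" and s: "parallel_on V s"
    and sK: "\<And>x. x \<in> V \<Longrightarrow> s x $ 1 * dK 1 x + s x $ 2 * dK 2 x = 0"
begin

lemma VW: "x \<in> V \<Longrightarrow> x \<in> W"
  using V by auto

lemma ds: "x \<in> V \<Longrightarrow> (\<lambda>x. s x $ k) differentiable (at x)"
  using s unfolding parallel_on_def by (blast intro: smooth_on_differentiable)

text \<open>The derivative of dK(X) = 0 by the product rule, with nabla X = w N.\<close>

lemma parallel_Hess:
  assumes x: "x \<in> V"
  shows "s x $ 3 * NK i x + s x $ 1 * H i 1 x + s x $ 2 * H i 2 x = 0"
proof -
  note eqs = ds x VW[OF x] parallel_partials[OF s x]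
  have 1: "partial i (\<lambda>x. s x $ 1 * dK 1 x + s x $ 2 * dK 2 x) x = 0" for i
    by (rule partial_eq_0[OF V(1) x]) (rule sK)
  have "s x $ 3 * NK 1 x + s x $ 1 * H 1 1 x + s x $ 2 * H 1 2 x = 0"
    using 1[of 1] unfolding NK_simps
    by (simp add: pd eqs partial_dK christoffel_21 H_21) algebra
  moreover have "s x $ 3 * NK 2 x + s x $ 1 * H 2 1 x + s x $ 2 * H 2 2 x = 0"
    using 1[of 2] unfolding NK_simps
    by (simp add: pd eqs partial_dK christoffel_21 H_21) algebra
  ultimately show ?thesis using exhaust_2[of i] by auto
qed

text \<open>Contraction of \<open>parallel_Hess\<close> with \<open>G\<close>: the term in
  \<open>w\<close> drops out, because \<open>N\<close> turns \<open>G\<close> into a multiple of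
  \<open>Z\<close>, on which dK vanishes.\<close>

lemma parallel_H_G:
  assumes x: "x \<in> V"
  shows "G 1 x * (H 1 1 x * s x $ 1 + H 1 2 x * s x $ 2) + G 2 x * (H 1 2 x * s x $ 1 + H 2 2 x * s x $ 2) = 0"
  using parallel_Hess[OF x, of 1] parallel_Hess[OF x, of 2]
  unfolding GZ_simps NK_simps H_21[OF VW[OF x]] by algebra

lemma parallel_T:
  assumes x: "x \<in> V"
  shows "T3 (s x $ 1) (s x $ 2) x = 0"
proof -
  note xW = VW[OF x]
  note eqs = ds x xW parallel_partials[OF s x]
  have 0: "partial j (\<lambda>x. s x $ 3 * (a x * dK 2 x - b x * dK 1 x) + s x $ 1 * H 1 1 x + s x $ 2 * H 1 2 x) x = 0"
     "partial j (\<lambda>x. s x $ 3 * (b x * dK 2 x - c x * dK 1 x) + s x $ 1 * H 2 1 x + s x $ 2 * H 2 2 x) x = 0" for j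
    using parallel_Hess[of _ 1] parallel_Hess[of _ 2] unfolding NK_simps
    by (auto intro!: partial_eq_0[OF V(1) x])
  note E = parallel_Hess[OF x, of 1] parallel_Hess[OF x, of 2]
  \<comment> \<open>This and the next three are the covariant derivatives of
    \<open>parallel_Hess\<close>; the Christoffel terms are combinations of the equations
    \<open>E\<close>. The bracket after \<open>s x $ 3\<close> is the Hessian on a basis vector and
    its rotation, symmetrized.\<close>
  have 11: "- K x * s x $ 2 * NK 1 x + 2 * s x $ 3 * (a x * H 1 2 x - b x * H 1 1 x)
     + s x $ 1 * T 1 1 1 x + s x $ 2 * T 1 1 2 x = 0"
    using 0(1)[of 1] E unfolding NK_simps
    by (simp add: pd eqs metric_compat partial_dK partial_H christoffel_21 H_21 t_def) algebra
  have 21: "K x * s x $ 1 * NK 1 x + s x $ 3 * (a x * H 2 2 x - b x * H 1 2 x + b x * H 1 2 x - c x * H 1 1 x)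
     + s x $ 1 * T 2 1 1 x + s x $ 2 * T 2 1 2 x = 0"
    using 0(1)[of 2] E unfolding NK_simps
    by (simp add: pd eqs metric_compat partial_dK partial_H christoffel_21 H_21 t_def) algebra
  have 12: "- K x * s x $ 2 * NK 2 x + s x $ 3 * (b x * H 1 2 x - c x * H 1 1 x + a x * H 2 2 x - b x * H 1 2 x)
     + s x $ 1 * T 1 2 1 x + s x $ 2 * T 1 2 2 x = 0"
    using 0(2)[of 1] E unfolding NK_simps
    by (simp add: pd eqs metric_compat partial_dK partial_H christoffel_21 H_21 t_def) algebra
  have 22: "K x * s x $ 1 * NK 2 x + 2 * s x $ 3 * (b x * H 2 2 x - c x * H 1 2 x)
     + s x $ 1 * T 2 2 1 x + s x $ 2 * T 2 2 2 x = 0"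
    using 0(2)[of 2] E unfolding NK_simps
    by (simp add: pd eqs metric_compat partial_dK partial_H christoffel_21 H_21 t_def) algebra
  \<comment> \<open>Contraction with X twice. The terms in \<open>K\<close> cancel in pairs. The
    terms in \<open>w\<close> form 2 w Hess(X, N X), which by \<open>E\<close> is a multiple of dK(N
    N X), and the square of \<open>N\<close> is -d, so dK(X) = 0 applies.\<close>
  show ?thesis
    using 11 12 21 22 E sK[OF x] unfolding NK_simps T3_def H_21[OF xW] by algebra
qed

text \<open>By dK(X) = 0 the vectors X and \<open>Z\<close> are proportional; both invariants are
  homogeneous in \<open>Z\<close>, so their vanishing on X transfers to \<open>Z\<close> wherever X
  is nonzero.\<close>

lemma parallel_invariants:
  assumes x: "x \<in> V" and nz: "s x $ 1 \<noteq> 0 \<or> s x $ 2 \<noteq> 0"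
  shows "I4b h x = 0" "I5d h x = 0"
proof -
  note xW = VW[OF x]
  have p: "s x $ 1 * Z 2 x = s x $ 2 * Z 1 x"
    using sK[OF x] unfolding GZ_simps by algebra
  have "s x $ 1 * (G 1 x * (H 1 1 x * Z 1 x + H 1 2 x * Z 2 x) + G 2 x * (H 1 2 x * Z 1 x + H 2 2 x * Z 2 x)) = 0"
    "s x $ 2 * (G 1 x * (H 1 1 x * Z 1 x + H 1 2 x * Z 2 x) + G 2 x * (H 1 2 x * Z 1 x + H 2 2 x * Z 2 x)) = 0"
    using p parallel_H_G[OF x] by algebra+
  with nz show "I4b h x = 0" unfolding I4b_eq_0_iff[OF xW] by auto
  have "(s x $ 1)^3 * T3 (Z 1 x) (Z 2 x) x = (Z 1 x)^3 * T3 (s x $ 1) (s x $ 2) x"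
    "(s x $ 2)^3 * T3 (Z 1 x) (Z 2 x) x = (Z 2 x)^3 * T3 (s x $ 1) (s x $ 2) x"
    using p unfolding T3_def by algebra+
  with nz parallel_T[OF x] show "I5d h x = 0" unfolding I5d_eq_0_iff[OF xW] by auto
qed

end

text \<open>\<open>\<mu>\<close> and \<open>\<nu>\<close> are the eigenvalues of the Hessian of \<open>K\<close> on \<open>G\<close> and \<open>Z\<close>, and \<open>\<sigma>\<close> is the squared
  length of \<open>grad K\<close>. The Killing field is \<open>f Z\<close> with \<open>d (ln f) = \<beta> dK - t\<close>.\<close>

lemma killing_exists:
  assumes q: "q \<in> W" and dK: "\<And>x. x \<in> W \<Longrightarrow> dK 1 x \<noteq> 0 \<or> dK 2 x \<noteq> 0"
    and I4b: "\<And>x. x \<in> W \<Longrightarrow> I4b h x = 0" and I5d: "\<And>x. x \<in> W \<Longrightarrow> I5d h x = 0"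
  obtains V F where "open V" "q \<in> V" "V \<subseteq> W" "integral_on h 1 V F" "F q \<noteq> (\<lambda>p. 0)"
proof -
  \<comment> \<open>\<open>d\<close> times |grad K|^2. It is also the determinant of the pair
    \<open>G\<close>, \<open>Z\<close> up to sign, and the squared length of \<open>Z\<close>; hence
    the denominators of \<nu> and \<mu>.\<close>
  define Q where "Q x = G 1 x * dK 1 x + G 2 x * dK 2 x" for x
  have Q: "Q x \<noteq> 0" if x: "x \<in> W" for x
  proof -
    have "a x * Q x = (a x * dK 2 x - b x * dK 1 x)^2 + d x * (dK 1 x)^2"
      unfolding GZ_simps d_def Q_def by algebra
    also have "\<dots> \<noteq> 0"
      using d_pos[OF x] a_pos[OF x] dK[OF x] by (auto simp: add_nonneg_eq_0_iff)
    finally show ?thesis by auto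
  qed
  define HZZ where "HZZ x = H 1 1 x * (dK 2 x * dK 2 x) - 2 * (H 1 2 x * (dK 1 x * dK 2 x)) + H 2 2 x * (dK 1 x * dK 1 x)" for x
  define \<nu> where "\<nu> x = HZZ x / Q x" for x
  define \<mu> where "\<mu> x = (G 1 x * (H 1 1 x * G 1 x + H 1 2 x * G 2 x) + G 2 x * (H 1 2 x * G 1 x + H 2 2 x * G 2 x)) / (d x * Q x)" for x
  \<comment> \<open>The only value for which Hess K + \<beta> dK^2 can be \<nu> times the metric:
    test it on \<open>G\<close>.\<close>
  define \<beta> where "\<beta> x = (\<nu> x - \<mu> x) * d x / Q x" for x
  define \<sigma> where "\<sigma> x = Q x / d x" for x
  have sG: "smooth_on W (\<lambda>x. G k x)" for k
    unfolding G_def using exhaust_2[of k]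
    by (auto intro!: smooth_on_diff smooth_on_mult open_W)
  have sQ: "smooth_on W Q"
    unfolding Q_def[abs_def] by (intro smooth_on_add smooth_on_mult open_W sG smooth_dK)
  have sHZZ: "smooth_on W HZZ"
    unfolding HZZ_def[abs_def]
    by (intro smooth_on_add smooth_on_diff smooth_on_mult smooth_on_const open_W smooth_H smooth_dK)
  have s\<nu>: "smooth_on W \<nu>"
    unfolding \<nu>_def[abs_def] by (intro smooth_on_divide open_W sHZZ sQ Q)
  have s\<mu>: "smooth_on W \<mu>"
    unfolding \<mu>_def[abs_def] using Q d_pos
    by (intro smooth_on_divide smooth_on_add smooth_on_mult open_W sG sQ smooth_H smooth_abcd)
      (auto simp: less_imp_neq[symmetric])
  have s\<beta>: "smooth_on W \<beta>"
    unfolding \<beta>_def[abs_def]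
    by (intro smooth_on_divide smooth_on_diff smooth_on_mult open_W s\<nu> s\<mu> sQ Q smooth_abcd)
  have s\<sigma>: "smooth_on W \<sigma>"
    unfolding \<sigma>_def[abs_def] using d_pos by (intro smooth_on_divide open_W sQ smooth_abcd) (auto simp: less_imp_neq[symmetric])
  note sms = smooth_on_differentiable[OF sG] smooth_on_differentiable[OF sQ] smooth_on_differentiable[OF sHZZ]
    smooth_on_differentiable[OF s\<nu>] smooth_on_differentiable[OF s\<mu>] smooth_on_differentiable[OF s\<beta>] smooth_on_differentiable[OF s\<sigma>]
  have HG: "H 1 1 x * G 1 x + H 1 2 x * G 2 x = \<mu> x * d x * dK 1 x"
    "H 1 2 x * G 1 x + H 2 2 x * G 2 x = \<mu> x * d x * dK 2 x" if x: "x \<in> W" for x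
  proof -
    have l: "\<mu> x * d x * Q x = G 1 x * (H 1 1 x * G 1 x + H 1 2 x * G 2 x) + G 2 x * (H 1 2 x * G 1 x + H 2 2 x * G 2 x)"
      using Q[OF x] d_pos[OF x] by (simp add: \<mu>_def)
    have i: "G 1 x * (H 1 1 x * - dK 2 x + H 1 2 x * dK 1 x) + G 2 x * (H 1 2 x * - dK 2 x + H 2 2 x * dK 1 x) = 0"
      using I4b[OF x] unfolding I4b_eq_0_iff[OF x] GZ_simps(3,4) .
    have "Q x * (H 1 1 x * G 1 x + H 1 2 x * G 2 x) = Q x * (\<mu> x * d x * dK 1 x)"
      "Q x * (H 1 2 x * G 1 x + H 2 2 x * G 2 x) = Q x * (\<mu> x * d x * dK 2 x)"
      using l i unfolding Q_def by algebra+
    then show "H 1 1 x * G 1 x + H 1 2 x * G 2 x = \<mu> x * d x * dK 1 x"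
      "H 1 2 x * G 1 x + H 2 2 x * G 2 x = \<mu> x * d x * dK 2 x"
      using Q[OF x] unfolding mult_cancel_left by blast+
  qed
  have \<nu>Q: "\<nu> x * Q x = HZZ x" if "x \<in> W" for x using Q[OF that] by (simp add: \<nu>_def)
  have \<beta>\<sigma>: "\<beta> x * \<sigma> x = \<nu> x - \<mu> x" "\<beta> x * Q x = (\<nu> x - \<mu> x) * d x" if "x \<in> W" for x
    using Q[OF that] d_pos[OF that] by (simp_all add: \<beta>_def \<sigma>_def)
  \<comment> \<open>A covector that vanishes on \<open>G\<close> and \<open>Z\<close> is zero, as
    the two are a basis.\<close>
  have G0: "u = 0 \<and> v = 0" if x: "x \<in> W" and "G 1 x * u + G 2 x * v = 0" "- dK 2 x * u + dK 1 x * v = 0" for x u v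
  proof -
    have "Q x * u = 0" "Q x * v = 0" using that(2,3) unfolding Q_def by algebra+
    with Q[OF x] show ?thesis by simp
  qed
  have HZ: "- H 1 1 x * dK 2 x + H 1 2 x * dK 1 x = \<nu> x * (- a x * dK 2 x + b x * dK 1 x)"
    "- H 1 2 x * dK 2 x + H 2 2 x * dK 1 x = \<nu> x * (- b x * dK 2 x + c x * dK 1 x)" if x: "x \<in> W" for x
  proof -
    have i: "G 1 x * (H 1 1 x * - dK 2 x + H 1 2 x * dK 1 x) + G 2 x * (H 1 2 x * - dK 2 x + H 2 2 x * dK 1 x) = 0"
      using I4b[OF x] unfolding I4b_eq_0_iff[OF x] GZ_simps(3,4) .
    have "- H 1 1 x * dK 2 x + H 1 2 x * dK 1 x - \<nu> x * (- a x * dK 2 x + b x * dK 1 x) = 0 \<and>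
      - H 1 2 x * dK 2 x + H 2 2 x * dK 1 x - \<nu> x * (- b x * dK 2 x + c x * dK 1 x) = 0"
    proof (rule G0[OF x])
      show "G 1 x * (- H 1 1 x * dK 2 x + H 1 2 x * dK 1 x - \<nu> x * (- a x * dK 2 x + b x * dK 1 x)) +
        G 2 x * (- H 1 2 x * dK 2 x + H 2 2 x * dK 1 x - \<nu> x * (- b x * dK 2 x + c x * dK 1 x)) = 0"
        using i unfolding GZ_simps by algebra
      show "- dK 2 x * (- H 1 1 x * dK 2 x + H 1 2 x * dK 1 x - \<nu> x * (- a x * dK 2 x + b x * dK 1 x)) +
        dK 1 x * (- H 1 2 x * dK 2 x + H 2 2 x * dK 1 x - \<nu> x * (- b x * dK 2 x + c x * dK 1 x)) = 0"
        using \<nu>Q[OF x] unfolding HZZ_def Q_def GZ_simps by algebra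
    qed
    then show "- H 1 1 x * dK 2 x + H 1 2 x * dK 1 x = \<nu> x * (- a x * dK 2 x + b x * dK 1 x)"
      "- H 1 2 x * dK 2 x + H 2 2 x * dK 1 x = \<nu> x * (- b x * dK 2 x + c x * dK 1 x)"
      by simp_all
  qed
  have dQ: "partial i Q x = 2 * t i x * Q x + 2 * \<mu> x * d x * dK i x" if x: "x \<in> W" for i x
  proof -
    have "partial i Q x = partial i (\<lambda>x. (c x * dK 1 x - b x * dK 2 x) * dK 1 x + (a x * dK 2 x - b x * dK 1 x) * dK 2 x) x"
      by (simp add: Q_def[abs_def] GZ_simps)
    also have "\<dots> = 2 * t i x * Q x + 2 * (H i 1 x * G 1 x + H i 2 x * G 2 x)"
      unfolding Q_def GZ_simps t_def using x
      by (simp add: pd metric_compat partial_dK) algebra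
    finally show ?thesis
      using HG[OF x] exhaust_2[of i] H_21[OF x] by (auto simp: algebra_simps)
  qed
  have d\<sigma>: "partial i \<sigma> x = 2 * \<mu> x * dK i x" if x: "x \<in> W" for i x
    using d_pos[OF x] unfolding \<sigma>_def[abs_def] partial_divide_d[OF x sQ] dQ[OF x] by simp
  \<comment> \<open>The form d\<sigma> = 2 \<mu> dK is closed.\<close>
  have d\<mu>: "partial 2 \<mu> x * dK 1 x = partial 1 \<mu> x * dK 2 x" if x: "x \<in> W" for x
    using partial_commute_eq[OF open_W s\<sigma> d\<sigma> d\<sigma> x] x dK_commute[OF x] by (simp add: pd sms)
  have d\<nu>: "partial 2 \<nu> x * dK 1 x = partial 1 \<nu> x * dK 2 x" if x: "x \<in> W" for x
  proof -
    have eq: "partial i \<nu> x * Q x + \<nu> x * partial i Q x = partial i HZZ x" for i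
      using partial_cong[OF open_W x, of "\<lambda>x. \<nu> x * Q x" HZZ i] \<nu>Q x by (simp add: pd sms)
    have ZQ: "- dK 2 x * partial 1 Q x + dK 1 x * partial 2 Q x = 2 * Q x * (- dK 2 x * t 1 x + dK 1 x * t 2 x)"
      unfolding dQ[OF x] by algebra
    have T: "T3 (- dK 2 x) (dK 1 x) x = 0"
      using I5d[OF x] unfolding I5d_eq_0_iff[OF x] GZ_simps(3,4) .
    have T21: "T i 2 1 x = T i 1 2 x" for i
      using partial_cong[OF open_W x, of "H 2 1" "H 1 2" i] x by (simp add: T_def H_21 diff_W)
    have dHZZ: "partial i HZZ x = partial i (H 1 1) x * (dK 2 x * dK 2 x) + 2 * H 1 1 x * dK 2 x * partial i (dK 2) x
       - 2 * (partial i (H 1 2) x * (dK 1 x * dK 2 x) + H 1 2 x * (partial i (dK 1) x * dK 2 x + dK 1 x * partial i (dK 2) x))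
       + partial i (H 2 2) x * (dK 1 x * dK 1 x) + 2 * H 2 2 x * dK 1 x * partial i (dK 1) x" for i
      unfolding HZZ_def[abs_def] using x by (simp add: pd algebra_simps)
    \<comment> \<open>The derivative of Hess(Z, Z) along \<open>Z\<close> is the cubic form plus 2
      Hess(Z, nabla_Z Z). Here nabla_Z Z is t(Z) Z plus the rotation of the covector Hess(Z, .), and
      a covector vanishes on its own rotation.\<close>
    have "- dK 2 x * partial 1 HZZ x + dK 1 x * partial 2 HZZ x =
       2 * HZZ x * (- dK 2 x * t 1 x + dK 1 x * t 2 x) + T3 (- dK 2 x) (dK 1 x) x"
      unfolding dHZZ unfolding partial_dK partial_H HZZ_def T3_def t_def T21 christoffel_21[OF x] H_21[OF x]
      by (simp add: algebra_simps)
    then have "- dK 2 x * partial 1 HZZ x + dK 1 x * partial 2 HZZ x = 2 * HZZ x * (- dK 2 x * t 1 x + dK 1 x * t 2 x)"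
      unfolding T by simp
    then have "Q x * (partial 2 \<nu> x * dK 1 x) = Q x * (partial 1 \<nu> x * dK 2 x)"
      using eq[of 1] eq[of 2] ZQ \<nu>Q[OF x] by algebra
    then show ?thesis using Q[OF x] by simp
  qed
  have d\<beta>: "partial 2 \<beta> x * dK 1 x = partial 1 \<beta> x * dK 2 x" if x: "x \<in> W" for x
  proof -
    have eq: "partial i \<beta> x * \<sigma> x + \<beta> x * partial i \<sigma> x = partial i \<nu> x - partial i \<mu> x" for i
      using partial_cong[OF open_W x, of "\<lambda>x. \<beta> x * \<sigma> x" "\<lambda>x. \<nu> x - \<mu> x" i] \<beta>\<sigma>(1) x by (simp add: pd sms)
    have "\<sigma> x * (partial 2 \<beta> x * dK 1 x) = \<sigma> x * (partial 1 \<beta> x * dK 2 x)"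
      using eq[of 1] eq[of 2] d\<nu>[OF x] d\<mu>[OF x] unfolding d\<sigma>[OF x] by algebra
    then show ?thesis using Q[OF x] d_pos[OF x] by (simp add: \<sigma>_def)
  qed
  define \<alpha> where "\<alpha> i x = \<beta> x * dK i x - t i x" for i x
  \<comment> \<open>The equation df = \<alpha> f as a flat system of rank 1, which yields the factor
    itself with value 1 at \<open>q\<close>, without integration and exponential. Flatness is the
    closedness of \<alpha>.\<close>
  define A :: "2 \<Rightarrow> real^2 \<Rightarrow> real^1^1" where "A i x = (\<chi> j k. \<alpha> i x)" for i x
  have sA: "smooth_on W (\<lambda>x. A i x $ j $ k)" for i j k
    by (simp add: A_def \<alpha>_def smooth_on_diff smooth_on_mult open_W s\<beta> del: minus_add_distrib)
  have flatA: "partial 2 (\<lambda>x. A 1 x $ j $ k) x + (A 1 x ** A 2 x) $ j $ k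
       = partial 1 (\<lambda>x. A 2 x $ j $ k) x + (A 2 x ** A 1 x) $ j $ k" if x: "x \<in> W" for x j k
    using x d\<beta>[OF x] partial_t[OF x] dK_commute[OF x]
    by (simp add: A_def \<alpha>_def matrix_matrix_mult_def pd sms)
  obtain V u where V: "open V" "q \<in> V" "V \<subseteq> W" and u: "u q = vec 1" "\<And>k. smooth_on V (\<lambda>x. u x $ k)"
    and du: "\<And>x i k. x \<in> V \<Longrightarrow> partial i (\<lambda>x. u x $ k) x = (A i x *v u x) $ k"
    by (rule frobenius[OF open_W q sA flatA, of "vec 1"]) (assumption, rule that)
  define f where "f x = u x $ 1" for x
  have sf: "smooth_on V f" and fq: "f q = 1" and df: "\<And>x i. x \<in> V \<Longrightarrow> partial i f x = \<alpha> i x * f x"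
    using u du by (simp_all add: f_def[abs_def] A_def matrix_vector_mult_def)
  define X where "X k x = f x * Z k x" for k x
  have X: "X 1 = (\<lambda>x. f x * - dK 2 x)" "X 2 = (\<lambda>x. f x * dK 1 x)"
    by (auto simp: X_def GZ_simps)
  have sX: "smooth_on V (X k)" for k
    using exhaust_2[of k] smooth_on_subset[OF smooth_dK V(3)]
    by (auto simp: X intro!: smooth_on_mult smooth_on_minus V(1) sf)
  have kill: "\<exists>w. \<forall>i k. nabla i X k x = w * N k i x" if x: "x \<in> V" for x
  proof (rule exI[of _ "f x * \<nu> x"])
    have xW: "x \<in> W" using x V by auto
    have G: "b x * G 1 x + c x * G 2 x = d x * dK 2 x" "a x * G 1 x + b x * G 2 x = d x * dK 1 x"
      unfolding GZ_simps d_def by algebra+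
    note G0 = G0[OF xW]
    \<comment> \<open>Here and in \<open>e2\<close>, one column of Hess K + \<beta> dK^2 = \<nu> h
      is tested on \<open>G\<close> and \<open>Z\<close>, where it reduces to the eigenvector
      equations.\<close>
    have "- \<beta> x * dK 1 x * dK 2 x - H 1 2 x + \<nu> x * b x = 0 \<and> - \<beta> x * dK 2 x * dK 2 x - H 2 2 x + \<nu> x * c x = 0"
      by (rule G0) (use HZ[OF xW] HG[OF xW] \<beta>\<sigma>(2)[OF xW] G in \<open>unfold Q_def, algebra+\<close>)
    then have e1: "- \<beta> x * dK i x * dK 2 x - H i 2 x = \<nu> x * N 1 i x" for i
      using exhaust_2[of i] by (auto simp: N_simps)
    have "\<beta> x * dK 1 x * dK 1 x + H 1 1 x - \<nu> x * a x = 0 \<and> \<beta> x * dK 2 x * dK 1 x + H 1 2 x - \<nu> x * b x = 0"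
      by (rule G0) (use HZ[OF xW] HG[OF xW] \<beta>\<sigma>(2)[OF xW] G in \<open>unfold Q_def, algebra+\<close>)
    then have e2: "\<beta> x * dK i x * dK 1 x + H i 1 x = \<nu> x * N 2 i x" for i
      using exhaust_2[of i] H_21[OF xW] by (auto simp: N_simps)
    have "nabla i X 1 x = f x * (- \<beta> x * dK i x * dK 2 x - H i 2 x)" for i
      using x xW smooth_on_differentiable[OF sf x] exhaust_2[of i]
      by (auto simp: nabla_def X pd df \<alpha>_def partial_dK t_def christoffel_21 algebra_simps)
    moreover have "nabla i X 2 x = f x * (\<beta> x * dK i x * dK 1 x + H i 1 x)" for i
      using x xW smooth_on_differentiable[OF sf x] exhaust_2[of i]
      by (auto simp: nabla_def X pd df \<alpha>_def partial_dK t_def christoffel_21 algebra_simps)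
    ultimately show "\<forall>i k. nabla i X k x = f x * \<nu> x * N k i x"
      unfolding e1 e2 by (simp add: forall_2)
  qed
  have "integral_on h 1 V (\<lambda>x p. X 1 x * p$1 + X 2 x * p$2)"
    by (rule integral_on_1I[OF V(1,3) sX _ kill]) simp_all
  moreover have "(\<lambda>p::real^2. X 1 q * p$1 + X 2 q * p$2) \<noteq> (\<lambda>p. 0)"
  proof
    assume "(\<lambda>p::real^2. X 1 q * p$1 + X 2 q * p$2) = (\<lambda>p. 0)"
    from fun_cong[OF this, of "axis 1 1"] fun_cong[OF this, of "axis 2 1"] show False
      using dK[OF q] fq by (simp add: X axis_def)
  qed
  ultimately show thesis using that[OF V] by blast
qed

end

section \<open>Germs\<close>

lemma germ_at_eq_iff: "germ_at q F = germ_at q G \<longleftrightarrow> (\<forall>\<^sub>F x in nhds q. \<forall>p. F x p = G x p)"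
proof -
  have shift: "(\<forall>\<^sub>F x in nhds 0. Q (q + x)) \<longleftrightarrow> (\<forall>\<^sub>F x in nhds q. Q x)" for Q :: "real^2 \<Rightarrow> bool"
  proof
    assume "\<forall>\<^sub>F x in nhds q. Q x"
    moreover have "filterlim (\<lambda>x. q + x) (nhds q) (nhds 0)"
      by (rule tendsto_eq_intros filterlim_ident refl | simp)+
    ultimately show "\<forall>\<^sub>F x in nhds 0. Q (q + x)" by (simp add: filterlim_iff)
  next
    assume "\<forall>\<^sub>F x in nhds 0. Q (q + x)"
    moreover have "filterlim (\<lambda>x. x - q) (nhds 0) (nhds q)"
      by (rule tendsto_eq_intros filterlim_ident refl | simp)+
    ultimately have "\<forall>\<^sub>F x in nhds q. Q (q + (x - q))"
      unfolding filterlim_iff by (elim allE[of _ "\<lambda>x. Q (q + x)"]) simp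
    then show "\<forall>\<^sub>F x in nhds q. Q x" by simp
  qed
  show ?thesis unfolding germ_at_def germ.abs_eq_iff by (rule shift)
qed

lemma germ_at_eq_0_iff: "germ_at q F = 0 \<longleftrightarrow> (\<forall>\<^sub>F x in nhds q. \<forall>p. F x p = 0)"
proof -
  have 0: "0 = germ_at q (\<lambda>x p. 0)" by (simp add: germ_at_def zero_germ_def)
  show ?thesis unfolding 0 by (rule germ_at_eq_iff)
qed

section \<open>Killing germs and their initial values\<close>

context metric_chart
begin

text \<open>A relation and not a map, since not every initial value is attained and the
  neighbourhood varies with the germ. It is linear and determines each side from the other, so it is
  the graph of an isomorphism between the attained initial values and the Killing germs.\<close>

definition "killing_data q s0 g \<longleftrightarrow> (\<exists>V s. open V \<and> q \<in> V \<and> V \<subseteq> W \<and> parallel_on V s \<and>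
   (\<forall>x\<in>V. s x $ 1 * dK 1 x + s x $ 2 * dK 2 x = 0) \<and> s q = s0 \<and>
   g = germ_at q (\<lambda>x p. s x $ 1 * p$1 + s x $ 2 * p$2))"

lemma integral_germs_iff:
  assumes q: "q \<in> W"
  shows "g \<in> integral_germs h q 1 \<longleftrightarrow> (\<exists>s0. killing_data q s0 g)"
proof
  assume "g \<in> integral_germs h q 1"
  then obtain F U where F: "g = germ_at q F" "open U" "q \<in> U" "integral_on h 1 U F"
    unfolding integral_germs_def by blast
  have V: "open (U \<inter> W)" "U \<inter> W \<subseteq> W" "q \<in> U \<inter> W" using F q open_W by auto
  have "integral_on h 1 (U \<inter> W) F"
    by (rule integral_on_subset[OF F(4,2) V(1)]) simp
  from integral_on_parallel[OF V(1,2) this] obtain s where s: "parallel_on (U \<inter> W) s"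
    "\<And>x p. x \<in> U \<inter> W \<Longrightarrow> F x p = s x $ 1 * p$1 + s x $ 2 * p$2"
    "\<And>x. x \<in> U \<inter> W \<Longrightarrow> s x $ 1 * dK 1 x + s x $ 2 * dK 2 x = 0" by blast
  have "g = germ_at q (\<lambda>x p. s x $ 1 * p$1 + s x $ 2 * p$2)"
    unfolding F(1) germ_at_eq_iff using eventually_nhds_in_open[OF V(1,3)] s(2)
    by (auto elim!: eventually_mono)
  then show "\<exists>s0. killing_data q s0 g"
    unfolding killing_data_def using V s by blast
next
  assume "\<exists>s0. killing_data q s0 g"
  then show "g \<in> integral_germs h q 1"
    unfolding killing_data_def integral_germs_def using parallel_integral_on by blast
qed

lemma killing_data_lin:
  assumes "killing_data q v g" "killing_data q v' g'"
  shows "killing_data q (k *\<^sub>R v + l *\<^sub>R v') (k *\<^sub>R g + l *\<^sub>R g')"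
proof -
  from assms obtain V s V' s' where V: "open V" "q \<in> V" "V \<subseteq> W" "parallel_on V s"
      "\<forall>x\<in>V. s x $ 1 * dK 1 x + s x $ 2 * dK 2 x = 0" "s q = v"
      "g = germ_at q (\<lambda>x p. s x $ 1 * p$1 + s x $ 2 * p$2)"
    and V': "open V'" "q \<in> V'" "V' \<subseteq> W" "parallel_on V' s'"
      "\<forall>x\<in>V'. s' x $ 1 * dK 1 x + s' x $ 2 * dK 2 x = 0" "s' q = v'"
      "g' = germ_at q (\<lambda>x p. s' x $ 1 * p$1 + s' x $ 2 * p$2)"
    unfolding killing_data_def by blast
  let ?V = "V \<inter> V'" and ?s = "\<lambda>x. k *\<^sub>R s x + l *\<^sub>R s' x"
  have o: "open ?V" using V V' by auto
  have sm: "smooth_on V (\<lambda>x. s x $ i)" "smooth_on V' (\<lambda>x. s' x $ i)" for i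
    using V(4) V'(4) by (auto simp: parallel_on_def)
  have "parallel_on ?V ?s"
    unfolding parallel_on_def
  proof (intro conjI allI ballI)
    show "smooth_on ?V (\<lambda>x. (k *\<^sub>R s x + l *\<^sub>R s' x) $ i)" for i
      using smooth_on_subset[OF sm(1)] smooth_on_subset[OF sm(2)]
      by (auto intro!: smooth_on_add smooth_on_mult smooth_on_const o)
    show "partial i (\<lambda>x. (k *\<^sub>R s x + l *\<^sub>R s' x) $ j) x = (P i x *v (k *\<^sub>R s x + l *\<^sub>R s' x)) $ j"
      if "x \<in> ?V" for x i j
      using that V(4) V'(4) smooth_on_differentiable[OF sm(1)] smooth_on_differentiable[OF sm(2)]
      by (simp add: partial_lin parallel_on_def matrix_vector_right_distrib matrix_vector_mult_scaleR)
  qed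
  moreover have "k *\<^sub>R g + l *\<^sub>R g' = germ_at q (\<lambda>x p. ?s x $ 1 * p$1 + ?s x $ 2 * p$2)"
    unfolding V(7) V'(7) germ_at_def by (simp add: scaleR_germ.abs_eq plus_germ.abs_eq algebra_simps)
  moreover have "\<forall>x\<in>?V. ?s x $ 1 * dK 1 x + ?s x $ 2 * dK 2 x = 0"
  proof
    fix x assume "x \<in> ?V"
    then have "s x $ 1 * dK 1 x + s x $ 2 * dK 2 x = 0" "s' x $ 1 * dK 1 x + s' x $ 2 * dK 2 x = 0"
      using V(5) V'(5) by auto
    then show "?s x $ 1 * dK 1 x + ?s x $ 2 * dK 2 x = 0" by simp algebra
  qed
  ultimately show ?thesis
    unfolding killing_data_def using V V' o
    by (intro exI[of _ ?V] exI[of _ ?s]) auto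
qed

lemma killing_data_0: "killing_data q 0 g \<Longrightarrow> g = 0"
proof -
  assume "killing_data q 0 g"
  then obtain V s where V: "open V" "q \<in> V" "V \<subseteq> W" "parallel_on V s" "s q = 0"
    "g = germ_at q (\<lambda>x p. s x $ 1 * p$1 + s x $ 2 * p$2)"
    unfolding killing_data_def by blast
  show "g = 0"
    unfolding V(6) germ_at_eq_0_iff using parallel_unique[OF V(1,3,2,4,5)] by (auto elim!: eventually_mono)
qed

text \<open>The germ knows only X, not \<open>w\<close>; but where X vanishes identically, the
  derivative of its second component along the first axis is a w.\<close>

lemma killing_data_inject:
  assumes "killing_data q v 0"
  shows "v = 0"
proof -
  from assms obtain V s where V: "open V" "q \<in> V" "V \<subseteq> W" "parallel_on V s" "s q = v"
    "0 = germ_at q (\<lambda>x p. s x $ 1 * p$1 + s x $ 2 * p$2)"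
    unfolding killing_data_def by blast
  obtain S where S: "open S" "q \<in> S" "\<And>x p. x \<in> S \<Longrightarrow> s x $ 1 * p$1 + s x $ 2 * p$(2::2) = 0"
    using V(6)[symmetric] unfolding germ_at_eq_0_iff eventually_nhds by blast
  have 0: "s x $ 1 = 0" "s x $ 2 = 0" if "x \<in> S" for x
    using S(3)[OF that, of "axis 1 1"] S(3)[OF that, of "axis 2 1"] by (simp_all add: axis_def)
  have "partial 1 (\<lambda>x. s x $ 2) q = 0"
    by (rule partial_eq_0[OF S(1,2)]) (rule 0)
  then have "a q * s q $ 3 = 0"
    using parallel_partials(2)[OF V(4,2)] 0[OF S(2)] by simp
  then have "s q $ 3 = 0" using a_pos[of q] V by auto
  then show "v = 0" using 0[OF S(2)] V(5) by (auto simp: vec_eq_iff forall_3)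
qed

text \<open>Every initial value in the fibre of rank 3 is attained, so the relation is a linear
  bijection; linearity of the chosen map comes from uniqueness.\<close>

lemma dim_integral_germs_constant:
  assumes q: "q \<in> W" and dK: "\<And>x. x \<in> W \<Longrightarrow> dK 1 x = 0 \<and> dK 2 x = 0"
  shows "dim (integral_germs h q 1) = 3"
proof -
  have "\<exists>g. killing_data q v g" for v
  proof -
    obtain V s where "open V" "q \<in> V" "V \<subseteq> W" "parallel_on V s" "s q = v"
      using parallel_exists[OF q dK, of v] by blast
    then have "killing_data q v (germ_at q (\<lambda>x p. s x $ 1 * p$1 + s x $ 2 * p$2))"
      unfolding killing_data_def using dK by (intro exI[of _ V] exI[of _ s]) auto
    then show ?thesis by blast
  qed
  then obtain L where L: "\<And>v. killing_data q v (L v)" by metis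
  have uniq: "g = L v" if "killing_data q v g" for v g
    using killing_data_0[of q "g - L v"] killing_data_lin[OF that L[of v], of 1 "-1"] by simp
  have lin: "linear L"
  proof (rule linearI)
    fix u v :: "real^3" and k :: real
    have "1 *\<^sub>R L u + 1 *\<^sub>R L v = L (1 *\<^sub>R u + 1 *\<^sub>R v)" "k *\<^sub>R L v + 0 *\<^sub>R L v = L (k *\<^sub>R v + 0 *\<^sub>R v)"
      by (rule uniq[OF killing_data_lin[OF L L]])+
    then show "L (u + v) = L u + L v" "L (k *\<^sub>R v) = k *\<^sub>R L v" by simp_all
  qed
  have inj: "inj L"
    unfolding linear_injective_0[OF lin] using killing_data_inject L by metis
  have "integral_germs h q 1 = L ` UNIV"
    using integral_germs_iff[OF q] L by (auto dest!: uniq)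
  also have "dim (L ` UNIV) = dim (UNIV :: (real^3) set)"
    using inj lin by (intro dim_image_eq) auto
  also have "\<dots> = 3" by simp
  finally show ?thesis .
qed

text \<open>If X vanishes at \<open>q\<close>, then \<open>parallel_Hess\<close> leaves w times dK
  composed with the invertible \<open>N\<close>, so \<open>w\<close> vanishes as well. A nonzero
  Killing germ is therefore nonzero at \<open>q\<close> itself.\<close>

lemma killing_data_regular:
  assumes q: "q \<in> W" and dK: "dK 1 q \<noteq> 0 \<or> dK 2 q \<noteq> 0" and v: "killing_data q v g"
  shows "v $ 1 * dK 1 q + v $ 2 * dK 2 q = 0" "v $ 1 = 0 \<Longrightarrow> v $ 2 = 0 \<Longrightarrow> v = 0"
proof -
  from v obtain V s where V: "open V" "q \<in> V" "V \<subseteq> W" "parallel_on V s" "s q = v"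
    and sK: "\<forall>x\<in>V. s x $ 1 * dK 1 x + s x $ 2 * dK 2 x = 0"
    unfolding killing_data_def by blast
  show "v $ 1 * dK 1 q + v $ 2 * dK 2 q = 0" using sK V by blast
  assume 0: "v $ 1 = 0" "v $ 2 = 0"
  have E: "v $ 3 * NK i q = 0" for i
    using parallel_Hess[OF V(1,3,4) sK[rule_format] V(2), of i] 0 V(5) by simp
  have "v $ 3 = 0"
  proof (rule ccontr)
    assume "v $ 3 \<noteq> 0"
    then have "NK 1 q = 0" "NK 2 q = 0" using E by auto
    then have "d q * dK 1 q = 0" "d q * dK 2 q = 0" unfolding NK_simps d_def by algebra+
    with d_pos[OF q] dK show False by auto
  qed
  with 0 show "v = 0" by (simp add: vec_eq_iff forall_3)
qed

text \<open>The values of X at \<open>q\<close> lie in the kernel of dK, a line. Subtracting a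
  multiple removes the value at \<open>q\<close>, and \<open>killing_data_regular\<close> removes
  the rest.\<close>

lemma killing_data_proportional:
  assumes q: "q \<in> W" and dK: "dK 1 q \<noteq> 0 \<or> dK 2 q \<noteq> 0"
    and v: "killing_data q v g" and v': "killing_data q v' g'" "g' \<noteq> 0"
  shows "\<exists>k. g = k *\<^sub>R g'"
proof -
  note r = killing_data_regular[OF q dK]
  have "v' \<noteq> 0" using v' killing_data_0 by blast
  then have nz: "v' $ 1 \<noteq> 0 \<or> v' $ 2 \<noteq> 0" using r(2)[OF v'(1)] by blast
  have "v' $ 1 * v $ 2 = v' $ 2 * v $ 1"
  proof -
    have "dK 1 q * (v' $ 1 * v $ 2 - v' $ 2 * v $ 1) = 0" "dK 2 q * (v' $ 1 * v $ 2 - v' $ 2 * v $ 1) = 0"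
      using r(1)[OF v] r(1)[OF v'(1)] by algebra+
    with dK show ?thesis by auto
  qed
  define k where "k = (if v' $ 1 \<noteq> 0 then v $ 1 / v' $ 1 else v $ 2 / v' $ 2)"
  have k: "v $ 1 = k * v' $ 1" "v $ 2 = k * v' $ 2"
    using nz \<open>v' $ 1 * v $ 2 = v' $ 2 * v $ 1\<close> by (auto simp: k_def field_simps)
  have *: "killing_data q (1 *\<^sub>R v + (- k) *\<^sub>R v') (1 *\<^sub>R g + (- k) *\<^sub>R g')"
    by (rule killing_data_lin[OF v v'(1)])
  have "1 *\<^sub>R v + (- k) *\<^sub>R v' = 0"
    by (rule r(2)[OF *]) (simp_all add: k)
  with * have "1 *\<^sub>R g + (- k) *\<^sub>R g' = 0" using killing_data_0 by metis
  then show ?thesis by (intro exI[of _ k]) simp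
qed

lemma dim_integral_germs_regular:
  assumes q: "q \<in> W" and dK: "dK 1 q \<noteq> 0 \<or> dK 2 q \<noteq> 0" and ne: "integral_germs h q 1 \<noteq> {0}"
  shows "dim (integral_germs h q 1) = 1"
proof -
  note sub = subspace_integral_germs[of h q 1]
  obtain g where g: "g \<in> integral_germs h q 1" "g \<noteq> 0"
    using ne subspace_0[OF sub] by blast
  have "integral_germs h q 1 \<subseteq> span {g}"
    using killing_data_proportional[OF q dK] g integral_germs_iff[OF q] by (force simp: span_singleton)
  moreover have "span {g} \<subseteq> integral_germs h q 1"
    using g(1) sub by (intro span_minimal) auto
  ultimately have "integral_germs h q 1 = span {g}" by blast
  then show ?thesis
    using g(2) real_vector.dim_eq_card_independent[of "{g}"] by simp
qed

text \<open>A nonzero Killing field is nonzero at \<open>q\<close>, hence near \<open>q\<close> by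
  continuity, and \<open>parallel_invariants\<close> applies at every nearby point.\<close>

lemma integral_germs_invariants:
  assumes q: "q \<in> W" and dK: "dK 1 q \<noteq> 0 \<or> dK 2 q \<noteq> 0" and ne: "integral_germs h q 1 \<noteq> {0}"
  shows "\<forall>\<^sub>F x in nhds q. I4b h x = 0 \<and> I5d h x = 0"
proof -
  obtain g where g: "g \<in> integral_germs h q 1" "g \<noteq> 0"
    using ne subspace_0[OF subspace_integral_germs[of h q 1]] by blast
  then obtain v where v: "killing_data q v g" using integral_germs_iff[OF q] by blast
  then obtain V s where V: "open V" "q \<in> V" "V \<subseteq> W" "parallel_on V s" "s q = v"
    and sK: "\<forall>x\<in>V. s x $ 1 * dK 1 x + s x $ 2 * dK 2 x = 0"
    unfolding killing_data_def by blast
  have "v \<noteq> 0" using v g(2) killing_data_0 by blast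
  then have nz: "s q $ 1 \<noteq> 0 \<or> s q $ 2 \<noteq> 0"
    using killing_data_regular(2)[OF q dK v] V(5) by blast
  have "open (V \<inter> (\<lambda>x. s x $ i) -` (- {0}))" for i
    using V(1,4) by (intro continuous_open_preimage smooth_on_continuous) (auto simp: parallel_on_def)
  note ev = eventually_nhds_in_open[OF this]
  have "\<forall>\<^sub>F x in nhds q. x \<in> V \<and> (s x $ 1 \<noteq> 0 \<or> s x $ 2 \<noteq> 0)"
    if "s q $ i \<noteq> 0" "i = 1 \<or> i = 2" for i
    using ev[of q i] that V(2) by (auto elim!: eventually_mono)
  with nz have "\<forall>\<^sub>F x in nhds q. x \<in> V \<and> (s x $ 1 \<noteq> 0 \<or> s x $ 2 \<noteq> 0)" by blast
  then show ?thesis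
    by (rule eventually_mono) (use parallel_invariants[OF V(1,3,4) sK[rule_format]] in blast)
qed

text \<open>Allows results that ask for a condition on the whole chart to be used where it holds
  only near \<open>q\<close>.\<close>

lemma metric_chart_subset: "open V \<Longrightarrow> V \<subseteq> W \<Longrightarrow> metric_chart V h"
  using smooth_h sym_h h11_pos det_pos
  by unfold_locales (auto intro: smooth_on_subset)

lemma regular_eventually:
  assumes q: "q \<in> W" and dK: "dK 1 q \<noteq> 0 \<or> dK 2 q \<noteq> 0"
  shows "\<forall>\<^sub>F x in nhds q. x \<in> W \<and> (dK 1 x \<noteq> 0 \<or> dK 2 x \<noteq> 0)"
proof -
  have "open (W \<inter> dK i -` (- {0}))" for i
    by (intro continuous_open_preimage smooth_on_continuous smooth_dK open_W) auto
  note ev = eventually_nhds_in_open[OF this]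
  have "\<forall>\<^sub>F x in nhds q. x \<in> W \<and> (dK 1 x \<noteq> 0 \<or> dK 2 x \<noteq> 0)" if "dK i q \<noteq> 0" for i
    using ev[of q i] that q exhaust_2[of i] by (auto elim!: eventually_mono)
  with dK show ?thesis by blast
qed

lemma integral_germs_nonzero:
  assumes q: "q \<in> W" and dK: "dK 1 q \<noteq> 0 \<or> dK 2 q \<noteq> 0"
    and I: "\<forall>\<^sub>F x in nhds q. I4b h x = 0 \<and> I5d h x = 0"
  shows "integral_germs h q 1 \<noteq> {0}"
proof -
  have "\<forall>\<^sub>F x in nhds q. (x \<in> W \<and> (dK 1 x \<noteq> 0 \<or> dK 2 x \<noteq> 0)) \<and> I4b h x = 0 \<and> I5d h x = 0"
    using regular_eventually[OF q dK] I by (rule eventually_conj)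
  then obtain V where V: "open V" "q \<in> V"
    "\<And>x. x \<in> V \<Longrightarrow> (x \<in> W \<and> (dK 1 x \<noteq> 0 \<or> dK 2 x \<noteq> 0)) \<and> I4b h x = 0 \<and> I5d h x = 0"
    unfolding eventually_nhds by blast
  interpret V: metric_chart V h
    by (rule metric_chart_subset) (use V in auto)
  have "dK 1 x \<noteq> 0 \<or> dK 2 x \<noteq> 0" "I4b h x = 0" "I5d h x = 0" if "x \<in> V" for x
    using V(3)[OF that] by auto
  note cond = this
  obtain V' F where F: "open V'" "q \<in> V'" "V' \<subseteq> V" "integral_on h 1 V' F" "F q \<noteq> (\<lambda>p. 0)"
    by (rule V.killing_exists[OF V(2)]) (erule cond(1), erule cond(2), erule cond(3), rule that)
  have "germ_at q F \<in> integral_germs h q 1"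
    unfolding integral_germs_def using F(1,2,4) by blast
  moreover have "germ_at q F \<noteq> 0"
    using F(5) by (auto simp: germ_at_eq_0_iff dest: eventually_nhds_x_imp_x)
  ultimately show ?thesis by blast
qed

lemma constant_near_K_iff:
  assumes q: "q \<in> W"
  shows "constant_near q K \<longleftrightarrow> (\<forall>\<^sub>F x in nhds q. x \<in> W \<and> dK 1 x = 0 \<and> dK 2 x = 0)"
proof
  assume "constant_near q K"
  then obtain k S where S: "open S" "q \<in> S" "\<And>x. x \<in> S \<Longrightarrow> K x = k"
    unfolding constant_near_def eventually_nhds by blast
  have "dK i x = 0" if "x \<in> S" for x i
    by (rule partial_eq_0[OF S(1) that S(3)])
  then show "\<forall>\<^sub>F x in nhds q. x \<in> W \<and> dK 1 x = 0 \<and> dK 2 x = 0"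
    using eventually_nhds_in_open[OF open_Int[OF S(1) open_W], of q] S(2) q
    by (auto elim!: eventually_mono)
next
  assume "\<forall>\<^sub>F x in nhds q. x \<in> W \<and> dK 1 x = 0 \<and> dK 2 x = 0"
  then obtain r where r: "r > 0" "\<And>x. dist x q < r \<Longrightarrow> x \<in> W \<and> dK 1 x = 0 \<and> dK 2 x = 0"
    unfolding eventually_nhds_metric by blast
  have "\<exists>k. \<forall>x\<in>ball q r. K x = k"
  proof (rule has_derivative_zero_constant)
    show "(K has_derivative (\<lambda>v. 0)) (at x within ball q r)" if "x \<in> ball q r" for x
      using has_derivative_partial[OF diff_W[OF smooth_K, of x]] r(2)[of x] that
      by (auto simp: dist_commute intro: has_derivative_at_withinI)
  qed simp
  then obtain k where "\<And>x. x \<in> ball q r \<Longrightarrow> K x = k" by blast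
  then show "constant_near q K"
    unfolding constant_near_def eventually_nhds_metric using r(1)
    by (intro exI[of _ k] exI[of _ r]) (simp add: dist_commute)
qed

lemma constant_near_K_iff_I3:
  assumes q: "q \<in> W"
  shows "constant_near q K \<longleftrightarrow> (\<forall>\<^sub>F x in nhds q. I3 h x = 0)"
proof -
  have "\<forall>\<^sub>F x in nhds q. x \<in> W" using eventually_nhds_in_open[OF open_W q] .
  then show ?thesis
    unfolding constant_near_K_iff[OF q]
    by (auto simp: I3_eq_0_iff elim: eventually_elim2)
qed

lemma dim_integral_germs_constant_near:
  assumes q: "q \<in> W" and "constant_near q K"
  shows "dim (integral_germs h q 1) = 3"
proof -
  obtain V where V: "open V" "q \<in> V" "\<And>x. x \<in> V \<Longrightarrow> x \<in> W \<and> dK 1 x = 0 \<and> dK 2 x = 0"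
    using assms(2) unfolding constant_near_K_iff[OF q] eventually_nhds by blast
  interpret V: metric_chart V h
    by (rule metric_chart_subset) (use V in auto)
  show ?thesis using V.dim_integral_germs_constant V by blast
qed

end

lemma metric_chart_riemannian:
  assumes "smooth_surface X A" "riemannian_metric A g" "(U, \<phi>) \<in> A"
  shows "metric_chart (\<phi> ` U) (g (U, \<phi>))"
proof
  have m: "\<And>i j. smooth_on (\<phi> ` U) (\<lambda>x. g (U, \<phi>) x $ i $ j)"
    "\<And>x. x \<in> \<phi> ` U \<Longrightarrow> transpose (g (U, \<phi>) x) = g (U, \<phi>) x"
    "\<And>x v. x \<in> \<phi> ` U \<Longrightarrow> v \<noteq> 0 \<Longrightarrow> v \<bullet> (g (U, \<phi>) x *v v) > 0"
    using assms(2,3) unfolding riemannian_metric_def by fast+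
  have "is_chart X (U, \<phi>)" using assms(1,3) unfolding smooth_surface_def by blast
  then show "open (\<phi> ` U)" by simp
  show "smooth_on (\<phi> ` U) (\<lambda>x. g (U, \<phi>) x $ i $ j)" for i j by (rule m)
  fix x assume x: "x \<in> \<phi> ` U"
  define B where "B = g (U, \<phi>) x"
  show s: "g (U, \<phi>) x $ 2 $ 1 = g (U, \<phi>) x $ 1 $ 2"
    using arg_cong[OF m(2)[OF x], of "\<lambda>M. M$1$2"] by (simp add: transpose_def)
  have q: "v \<bullet> (B *v v) = v$1 * (B$1$1 * v$1 + B$1$2 * v$2) + v$2 * (B$1$2 * v$1 + B$2$2 * v$2)" for v
    using s by (simp add: matrix_vector_mult_def inner_vec_def sum_2 B_def)
  show p: "g (U, \<phi>) x $ 1 $ 1 > 0"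
    using m(3)[OF x, of "vector [1, 0]"] q[of "vector [1, 0]"] by (simp add: B_def vec_eq_iff forall_2)
  \<comment> \<open>Orthogonal to the first basis vector, so that its squared length is a multiple
    of the determinant.\<close>
  define w :: "real^2" where "w = vector [- B$1$2, B$1$1]"
  have "w \<noteq> 0" using p by (simp add: w_def B_def vec_eq_iff forall_2)
  then have "w \<bullet> (B *v w) > 0" using m(3)[OF x] by (simp add: B_def)
  moreover have "w \<bullet> (B *v w) = B$1$1 * det B"
    using s unfolding q by (simp add: w_def det_2 B_def algebra_simps)
  ultimately have "B$1$1 * det B > 0" by simp
  with p show "det (g (U, \<phi>) x) > 0" by (simp add: B_def zero_less_mult_iff)
qed

text \<open>Where dK is nonzero the dimension is 0 or 1, so 3 is excluded there; the three cases are
  constant \<open>K\<close>, no nonzero Killing germ, and at least one.\<close>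

theorem theorem1:
  fixes X :: "'a topology" and A :: "'a chart set"
    and g :: "'a chart \<Rightarrow> real^2 \<Rightarrow> real^2^2"
    and U :: "'a set" and \<phi> :: "'a \<Rightarrow> real^2" and p0 :: 'a
    and h :: "real^2 \<Rightarrow> real^2^2" and q :: "real^2" and K :: "real^2 \<Rightarrow> real"
  assumes surface: "smooth_surface X A"
    and metric: "riemannian_metric A g"
    and chart: "(U, \<phi>) \<in> A" "p0 \<in> U"
    and h: "h = g (U, \<phi>)" and q: "q = \<phi> p0" and K: "K = gauss_curvature h"
    and regular: "constant_near q K \<or> (\<exists>i. partial i K q \<noteq> 0)"
  shows "((dim (integral_germs h q 1) = 3 \<longleftrightarrow> constant_near q K) \<and>
          (constant_near q K \<longleftrightarrow> (\<forall>\<^sub>F x in nhds q. I3 h x = 0))) \<and>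
         (\<not> constant_near q K \<longrightarrow>
            (dim (integral_germs h q 1) = 1 \<longleftrightarrow>
             (\<forall>\<^sub>F x in nhds q. I4b h x = 0 \<and> I5d h x = 0))) \<and>
         (\<not> constant_near q K \<and> \<not> (\<forall>\<^sub>F x in nhds q. I4b h x = 0 \<and> I5d h x = 0) \<longrightarrow>
            integral_germs h q 1 = {0})"
proof -
  interpret metric_chart "\<phi> ` U" h
    unfolding h by (rule metric_chart_riemannian[OF surface metric chart(1)])
  have qW: "q \<in> \<phi> ` U" using chart(2) q by simp
  have dK: "partial 1 (gauss_curvature h) q \<noteq> 0 \<or> partial 2 (gauss_curvature h) q \<noteq> 0"
    if "\<not> constant_near q (gauss_curvature h)"
    using regular[unfolded K] that by (metis exhaust_2)
  have zero: "dim {0 :: germ} = 0"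
    using real_vector.dim_span_eq_card_independent[OF independent_empty, where ?'a=germ] by simp
  note const = dim_integral_germs_constant_near[OF qW]
    and I3 = constant_near_K_iff_I3[OF qW]
  show ?thesis
  proof (cases "constant_near q (gauss_curvature h)")
    case True
    then show ?thesis using const I3 by (simp add: K)
  next
    case False
    note dim1 = dim_integral_germs_regular[OF qW dK[OF False]]
      and nec = integral_germs_invariants[OF qW dK[OF False]]
      and suf = integral_germs_nonzero[OF qW dK[OF False]]
    show ?thesis
    proof (cases "integral_germs h q 1 = {0}")
      case True
      then show ?thesis using False I3 suf zero by (auto simp: K)
    next
      case nz: False
      then show ?thesis using False I3 dim1[OF nz] nec[OF nz] by (simp add: K)
    qed
  qed
qed

end
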